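(* Let $\ell$ be a positive integer, let $x$ be a positive rational number that is not an integer, and let $\gamma=\begin{pmatrix}a&b\\c&d\end{pmatrix}\in\mathrm{SL}_2(\mathbb Z)$ with $c\ge0$. Then the function $\frac1{2\pi i}e^{-\pi i\ell cdx^2}\cdot\partial\widehat A_\ell(-x)\vert_2\gamma$ can be written as $H_1+H_2$, where $H_1(\tau)$, the holomorphic part, is given by $$C+\Bigl(\sum_{n>-cx,\ m\ge M}-\sum_{n<-cx,\ m<M}\Bigr)(-1)^{\ell n}e^{2\pi i(m-M)dx}\,(m-M)\,q^{\frac\ell2(n+cx)^2+(n+cx)(m-M)},$$ in which $n$ and $m$ take values in $\mathbb Z$, $M=\ell cx+\frac\ell2$, and $$C=-\delta_{cx}\,\frac{1-\delta_{(\ell+1)/2}+\delta_{(\ell+1)/2}\cdot(-1)^{cx}\cos(\pi dx)}{4\sin^2(\pi dx)},$$ and where $H_2(\tau)$, the nonholomorphic part, is given by $$-\frac1{2\pi}\sum_{n,m\in\mathbb Z}(-1)^{\ell n}e^{2\pi idx\left(\ell(n-cx)-(m+\frac\ell2)\right)}f\Bigl(\ell(n-cx)-\bigl(m+\tfrac\ell2\bigr);\operatorname{Im}\tau\Bigr)q^{-\frac\ell2(n-cx)^2+(n-cx)(m+\frac\ell2)},$$ with $$f(t;\operatorname{Im}\tau)=\pi|t|\,\beta\Bigl(t^2\cdot\frac{2\operatorname{Im}\tau}{\ell}\Bigr)-e^{-\pi t^2\cdot\frac{2\operatorname{Im}\tau}{\ell}}\cdot\sqrt{\frac{\ell}{2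\operatorname{Im}\tau}}.$$
   Context: $\mathbb H$ is the upper half-plane, $\tau\in\mathbb H$, $q=e^{2\pi i\tau}$, $q^r=e^{2\pi ir\tau}$. For rational $y$, $\delta_y=1$ if $y\in\mathbb Z$ and $\delta_y=0$ otherwise (when $\delta_{cx}=0$, $C=0$). $\operatorname{sgn}(y)=\pm1$ for $y\gtrless 0$ and $\operatorname{sgn}(0)=0$. $\beta(y)=\int_y^\infty u^{-1/2}e^{-\pi u}\,du$ for $y\ge0$ and $E(z)=2\int_0^ze^{-\pi u^2}du$ for real $z$. For $u\in\mathbb C\setminus(\mathbb Z\tau+\mathbb Z)$ and integer $\ell\ge1$, $$A_\ell(u;\tau)=e^{\pi i\ell u}\sum_{n\in\mathbb Z}\frac{(-1)^{\ell n}q^{\ell n(n+1)/2}}{1-e^{2\pi iu}q^n},$$ $$\widehat A_\ell(u;\tau)=A_\ell(u;\tau)+\frac i2\sum_{m=0}^{\ell-1}e^{2\pi imu}\,\theta\Bigl(m\tau+\frac{\ell-1}2;\ell\tau\Bigr)R\Bigl(\ell u-m\tau-\frac{\ell-1}2;\ell\tau\Bigr),$$ $$\theta(z;\tau)=\sum_{\nu\in\frac12+\mathbb Z}e^{\pi i\nu^2\tau+2\pi i\nu(z+\frac12)},$$ $$R(u;\tau)=\sum_{\nu\in\frac12+\mathbb Z}\Bigl\{\operatorname{sgn}(\nu)-E\Bigl(\bigl(\nu+\tfrac{\operatorname{Im}u}{\operatorname{Im}\tau}\bigr)\sqrt{2\operatorname{Im}\tau}\Bigr)\Bigr\}(-1)^{\nu-\frac12}q^{-\nu^2/2}e^{-2\pi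 i\nu u}.$$ Here $\frac{\partial}{\partial u}=\frac12\bigl(\frac{\partial}{\partial\operatorname{Re}u}-i\frac{\partial}{\partial\operatorname{Im}u}\bigr)$, $\partial\widehat A_\ell(-x;\tau)=\frac{\partial}{\partial u}\big|_{u=0}\widehat A_\ell(u-x;\tau)$, and $\partial\widehat A_\ell(-x)\vert_2\gamma(\tau)=(c\tau+d)^{-2}\,\partial\widehat A_\ell\bigl(-x;\frac{a\tau+b}{c\tau+d}\bigr)$. Holomorphic and nonholomorphic parts: let $g$ be a real analytic function on $\mathbb H$ with period $N$ ($N$ a positive integer), with Fourier expansion $g(\tau)=\sum_{n\in N^{-1}\mathbb Z}c_n(\operatorname{Im}\tau)q^n$. Suppose $c_n(+\infty)=\lim_{y\to+\infty}c_n(y)$ exists in $\mathbb C$ for each $n$ and that $\sum_n(c_n(\operatorname{Im}\tau)-c_n(+\infty))q^n$ converges absolutely and uniformly on $\{\operatorname{Im}\tau\ge Y_0\}$ for every $Y_0>0$. Then $\sum_nc_n(+\infty)q^n$ is called the holomorphic part of $g$ and $\sum_n(c_n(\operatorname{Im}\tau)-c_n(+\infty))q^n$ the nonholomorphic part. *)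

theory Defs
  imports "HOL-Analysis.Analysis"
begin

abbreviation upper_half_plane :: "complex set" where
  "upper_half_plane \<equiv> {\<tau>. Im \<tau> > 0}"

text \<open>
  \<open>qpow r \<tau>\<close> is $q^r = e^{2\pi i r\tau}$. The exponent is real, so this is a fixed branch and not
  a power of the complex number $q$.
\<close>
definition qpow :: "real \<Rightarrow> complex \<Rightarrow> complex" where
  "qpow r \<tau> = exp (2 * of_real pi * \<i> * of_real r * \<tau>)"

definition delta :: "real \<Rightarrow> real" where
  "delta y = (if y \<in> \<int> then 1 else 0)"

definition beta_fun :: "real \<Rightarrow> real" where
  "beta_fun y = (LBINT u=ereal y..\<infinity>. u powr (-1/2) * exp (- pi * u))"

text \<open>The interval integral is oriented, so \<open>E_fun\<close> is odd.\<close>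
definition E_fun :: "real \<Rightarrow> real" where
  "E_fun z = 2 * (LBINT u=ereal 0..ereal z. exp (- pi * u\<^sup>2))"

text \<open>In \<open>theta\<close> and \<open>R_fun\<close> the index $\nu\in\frac12+\mathbb Z$ is written $\nu=k+\frac12$ with \<open>k :: int\<close>.\<close>
definition theta :: "complex \<Rightarrow> complex \<Rightarrow> complex" where
  "theta z \<tau> = (\<Sum>\<^sub>\<infinity>k::int. let \<nu> = real_of_int k + 1/2 in
     exp (of_real pi * \<i> * of_real (\<nu>\<^sup>2) * \<tau> + 2 * of_real pi * \<i> * of_real \<nu> * (z + 1/2)))"

definition R_fun :: "complex \<Rightarrow> complex \<Rightarrow> complex" where
  "R_fun u \<tau> = (\<Sum>\<^sub>\<infinity>k::int. let \<nu> = real_of_int k + 1/2 in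
     of_real (sgn \<nu> - E_fun ((\<nu> + Im u / Im \<tau>) * sqrt (2 * Im \<tau>))) * (-1) powi k
       * qpow (- \<nu>\<^sup>2 / 2) \<tau> * exp (- 2 * of_real pi * \<i> * of_real \<nu> * u))"

definition A_fun :: "nat \<Rightarrow> complex \<Rightarrow> complex \<Rightarrow> complex" where
  "A_fun l u \<tau> = exp (of_real pi * \<i> * of_nat l * u) *
     (\<Sum>\<^sub>\<infinity>n::int. (-1) powi (int l * n) * qpow (real l * of_int n * (of_int n + 1) / 2) \<tau>
        / (1 - exp (2 * of_real pi * \<i> * u) * qpow (of_int n) \<tau>))"

definition A_hat :: "nat \<Rightarrow> complex \<Rightarrow> complex \<Rightarrow> complex" where
  "A_hat l u \<tau> = A_fun l u \<tau> + \<i> / 2 *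
     (\<Sum>m<l. exp (2 * of_real pi * \<i> * of_nat m * u)
        * theta (of_nat m * \<tau> + (of_nat l - 1) / 2) (of_nat l * \<tau>)
        * R_fun (of_nat l * u - of_nat m * \<tau> - (of_nat l - 1) / 2) (of_nat l * \<tau>))"

definition wirtinger :: "(complex \<Rightarrow> complex) \<Rightarrow> complex \<Rightarrow> complex" where
  "wirtinger F u = 1/2 *
     (vector_derivative (\<lambda>t::real. F (u + of_real t)) (at 0)
      - \<i> * vector_derivative (\<lambda>t::real. F (u + \<i> * of_real t)) (at 0))"

text \<open>\<open>dA_hat l v\<close> is $\tau\mapsto\partial\widehat A_\ell(v;\tau)$.\<close>
definition dA_hat :: "nat \<Rightarrow> complex \<Rightarrow> complex \<Rightarrow> complex" where
  "dA_hat l v \<tau> = wirtinger (\<lambda>u. A_hat l (u + v) \<tau>) 0"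

definition slash2 :: "(complex \<Rightarrow> complex) \<Rightarrow> int \<Rightarrow> int \<Rightarrow> int \<Rightarrow> int \<Rightarrow> complex \<Rightarrow> complex" where
  "slash2 F a b c d \<tau> = (of_int c * \<tau> + of_int d) powi (-2)
     * F ((of_int a * \<tau> + of_int b) / (of_int c * \<tau> + of_int d))"

text \<open>
  Real analyticity in the two real variables: near each point of the (open) set, the function is
  given by an absolutely convergent double power series in the real and imaginary increments.
\<close>
definition real_analytic_on :: "(complex \<Rightarrow> complex) \<Rightarrow> complex set \<Rightarrow> bool" where
  "real_analytic_on g S \<longleftrightarrow>
     (\<forall>z\<in>S. \<exists>r>0. \<exists>a :: nat \<Rightarrow> nat \<Rightarrow> complex. \<forall>s t :: real. \<bar>s\<bar> < r \<longrightarrow> \<bar>t\<bar> < r \<longrightarrow>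
        ((\<lambda>(j, k). a j k * of_real (s ^ j * t ^ k)) has_sum g (z + Complex s t)) UNIV)"

text \<open>
  \<open>g\<close> has holomorphic part \<open>H1\<close> and nonholomorphic part \<open>H2\<close>. The Fourier index
  $n\in N^{-1}\mathbb Z$ is written $n=k/N$ with \<open>k :: int\<close>; \<open>e k\<close> is the limit $c_n(+\infty)$.
  Unconditional convergence of the Fourier series at each height determines the coefficients, so
  the two parts do not depend on the choice of the period.
\<close>
definition has_hol_nonhol_parts ::
    "(complex \<Rightarrow> complex) \<Rightarrow> (complex \<Rightarrow> complex) \<Rightarrow> (complex \<Rightarrow> complex) \<Rightarrow> bool" where
  "has_hol_nonhol_parts g H1 H2 \<longleftrightarrow>
     real_analytic_on g upper_half_plane \<and>
     (\<exists>N::nat. \<exists>c :: int \<Rightarrow> real \<Rightarrow> complex. \<exists>e :: int \<Rightarrow> complex.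
        N > 0 \<and>
        (\<forall>\<tau>\<in>upper_half_plane. g (\<tau> + of_nat N) = g \<tau>) \<and>
        (\<forall>\<tau>\<in>upper_half_plane.
           ((\<lambda>k. c k (Im \<tau>) * qpow (of_int k / real N) \<tau>) has_sum g \<tau>) UNIV) \<and>
        (\<forall>k. (c k \<longlongrightarrow> e k) at_top) \<and>
        (\<forall>\<tau>\<in>upper_half_plane.
           (\<lambda>k. norm ((c k (Im \<tau>) - e k) * qpow (of_int k / real N) \<tau>)) summable_on UNIV) \<and>
        (\<forall>Y>0. uniform_limit {\<tau>. Im \<tau> \<ge> Y}
           (\<lambda>F \<tau>. \<Sum>k\<in>F. (c k (Im \<tau>) - e k) * qpow (of_int k / real N) \<tau>)
           H2 (finite_subsets_at_top UNIV)) \<and>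
        (\<forall>\<tau>\<in>upper_half_plane.
           ((\<lambda>k. e k * qpow (of_int k / real N) \<tau>) has_sum H1 \<tau>) UNIV))"

definition M_const :: "nat \<Rightarrow> real \<Rightarrow> int \<Rightarrow> real" where
  "M_const l x c = real l * of_int c * x + real l / 2"

text \<open>
  The exponent $cx$ of $-1$ is only meaningful if it is an integer; otherwise the factor
  \<open>delta (c * x)\<close> makes the whole expression vanish, so rounding down is harmless.
\<close>
definition C_const :: "nat \<Rightarrow> real \<Rightarrow> int \<Rightarrow> int \<Rightarrow> real" where
  "C_const l x c d = - delta (of_int c * x) *
     ((1 - delta ((real l + 1) / 2)
        + delta ((real l + 1) / 2) * (-1) powi \<lfloor>of_int c * x\<rfloor> * cos (pi * of_int d * x))
      / (4 * (sin (pi * of_int d * x))\<^sup>2))"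

definition H1_index_pos :: "nat \<Rightarrow> real \<Rightarrow> int \<Rightarrow> (int \<times> int) set" where
  "H1_index_pos l x c = {(n, m). of_int n > - of_int c * x \<and> of_int m \<ge> M_const l x c}"

definition H1_index_neg :: "nat \<Rightarrow> real \<Rightarrow> int \<Rightarrow> (int \<times> int) set" where
  "H1_index_neg l x c = {(n, m). of_int n < - of_int c * x \<and> of_int m < M_const l x c}"

definition H1_term :: "nat \<Rightarrow> real \<Rightarrow> int \<Rightarrow> int \<Rightarrow> complex \<Rightarrow> int \<times> int \<Rightarrow> complex" where
  "H1_term l x c d \<tau> = (\<lambda>(n, m). let M = M_const l x c in
     (-1) powi (int l * n)
     * exp (2 * of_real pi * \<i> * of_real ((of_int m - M) * of_int d * x))
     * of_real (of_int m - M)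
     * qpow (real l / 2 * (of_int n + of_int c * x)\<^sup>2 + (of_int n + of_int c * x) * (of_int m - M)) \<tau>)"

definition H1 :: "nat \<Rightarrow> real \<Rightarrow> int \<Rightarrow> int \<Rightarrow> complex \<Rightarrow> complex" where
  "H1 l x c d \<tau> = of_real (C_const l x c d)
     + ((\<Sum>\<^sub>\<infinity>p\<in>H1_index_pos l x c. H1_term l x c d \<tau> p)
        - (\<Sum>\<^sub>\<infinity>p\<in>H1_index_neg l x c. H1_term l x c d \<tau> p))"

definition f_fun :: "nat \<Rightarrow> real \<Rightarrow> real \<Rightarrow> real" where
  "f_fun l t y = pi * \<bar>t\<bar> * beta_fun (t\<^sup>2 * (2 * y / real l))
     - exp (- pi * t\<^sup>2 * (2 * y / real l)) * sqrt (real l / (2 * y))"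

definition H2_term :: "nat \<Rightarrow> real \<Rightarrow> int \<Rightarrow> int \<Rightarrow> complex \<Rightarrow> int \<times> int \<Rightarrow> complex" where
  "H2_term l x c d \<tau> = (\<lambda>(n, m).
     let s = of_int n - of_int c * x; \<mu> = of_int m + real l / 2; t = real l * s - \<mu> in
     (-1) powi (int l * n)
     * exp (2 * of_real pi * \<i> * of_real (of_int d * x * t))
     * of_real (f_fun l t (Im \<tau>))
     * qpow (- (real l / 2) * s\<^sup>2 + s * \<mu>) \<tau>)"

definition H2 :: "nat \<Rightarrow> real \<Rightarrow> int \<Rightarrow> int \<Rightarrow> complex \<Rightarrow> complex" where
  "H2 l x c d \<tau> = - 1 / (2 * of_real pi) * (\<Sum>\<^sub>\<infinity>p. H2_term l x c d \<tau> p)"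

end

theory Submission
  imports Defs "HOL-Probability.Probability" "HOL-Real_Asymp.Real_Asymp"
begin

text \<open>
  Up to a constant, the derivative of the completed Appell function at \<open>-x\<close> is the sum \<open>eis\<close>, over
  \<open>w = (m - p)\<tau> + (n - r)\<close> with \<open>m, n\<close> in \<open>\<int>\<close> and \<open>(p, r) = (0, x)\<close>, of
  \<open>exp(-\<pi>\<ell>|w|\<^sup>2/(2 Im \<tau>)) / w\<^sup>2\<close> times a phase that does not involve \<open>\<tau>\<close>.
  As \<open>|w|\<^sup>2 / Im \<tau>\<close> is invariant, \<open>\<gamma>\<close> merely permutes the lattice and moves \<open>(p, r)\<close> to
  \<open>(cx, dx)\<close>. Poisson summation over \<open>n\<close>, for each fixed \<open>m\<close>, turns \<open>eis\<close> into \<open>H1 + H2\<close>: the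
  Fourier transform of the regularised \<open>1 / w\<^sup>2\<close> is the holomorphic Lipschitz term plus the function
  \<open>f\<close>. That the derivative itself has this expansion is needed for \<open>\<gamma> = 1\<close> only, where it is obtained
  by differentiating the series for \<open>A_hat\<close> termwise.
\<close>

subsection \<open>Sums over the integers\<close>

text \<open>Without the Gaussian the sum of 1/w^2 over the lattice would converge at best
  conditionally and could not be permuted freely. With it every sum here converges absolutely, so
  none of the separate transformation laws of A, theta and R is needed. Within one row m the point z
  = (m - p) tau - r has imaginary part (m - p) Im tau. Hence the plain sum of phase/(z + n)^2
  expands in one direction for m < p, in the other for m > p, and must be evaluated at a real point
  for m = p: this is where the two index ranges with opposite signs and the constant C come from.
  For gamma = 1 the obstacle is a sign: \<open>R_fun\<close> contains sgn(nu), while f contains the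
  absolute value of l nu - m. They conflict only for nu = 1/2 and m > l/2, and the finitely many
  theta-like series left over are exactly what separates the derivative of \<open>A_fun\<close> from
  \<open>H1\<close>. Real analyticity is read off \<open>eis\<close>, whose terms are built by
  exponentials and quotients from polynomials in Re tau and Im tau.\<close>

lemma tendsto_infsum_dominated:
  fixes f :: "'b \<Rightarrow> 'a \<Rightarrow> 'c::banach"
  assumes lim: "\<And>i. i \<in> A \<Longrightarrow> ((\<lambda>x. f x i) \<longlongrightarrow> g i) F"
    and bnd: "\<forall>\<^sub>F x in F. \<forall>i\<in>A. norm (f x i) \<le> M i"
    and M: "M summable_on A"
  shows "((\<lambda>x. \<Sum>\<^sub>\<infinity>i\<in>A. f x i) \<longlongrightarrow> (\<Sum>\<^sub>\<infinity>i\<in>A. g i)) F"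
proof (cases "F = bot")
  case False
  \<comment> \<open>On \<open>S\<close> the M-test makes the partial sums converge uniformly, and
    \<open>S\<close> belongs to the filter, so the two limits may be interchanged: Tannery's theorem
    for an arbitrary filter.\<close>
  define S where "S = {x. \<forall>i\<in>A. norm (f x i) \<le> M i}"
  have gM: "norm (g i) \<le> M i" if "i \<in> A" for i
  proof (rule tendsto_upperbound[OF tendsto_norm[OF lim[OF that]] _ False])
    show "\<forall>\<^sub>F x in F. norm (f x i) \<le> M i"
      using bnd by eventually_elim (use that in auto)
  qed
  have gs: "g summable_on A"
    by (rule abs_summable_summable, rule Infinite_Sum.abs_summable_on_comparison_test'[OF M gM])
  show ?thesis
  proof (rule swap_uniform_limit')
    show "\<forall>\<^sub>F n in finite_subsets_at_top A. ((\<lambda>x. \<Sum>i\<in>n. f x i) \<longlongrightarrow> (\<Sum>i\<in>n. g i)) F"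
      by (rule eventually_finite_subsets_at_top_weakI) (auto intro!: tendsto_sum lim)
    show "((\<lambda>n. \<Sum>i\<in>n. g i) \<longlongrightarrow> (\<Sum>\<^sub>\<infinity>i\<in>A. g i)) (finite_subsets_at_top A)"
      using gs by (simp add: has_sum_def[symmetric])
    show "uniform_limit S (\<lambda>n x. \<Sum>i\<in>n. f x i) (\<lambda>x. \<Sum>\<^sub>\<infinity>i\<in>A. f x i) (finite_subsets_at_top A)"
      by (rule Weierstrass_m_test_general[OF _ M]) (auto simp: S_def)
    show "\<forall>\<^sub>F x in F. x \<in> S"
      using bnd by (simp add: S_def)
  qed simp
qed simp

text \<open>The mean value inequality bounds every difference quotient by \<open>M i\<close>, so the
  remainder quotients \<open>D\<close> are dominated by \<open>M i + M i\<close> and tend to 0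
  termwise. Dominated convergence does the rest.\<close>

lemma has_vector_derivative_infsum:
  fixes f :: "'a \<Rightarrow> real \<Rightarrow> 'c::banach"
  assumes "e > 0"
    and der: "\<And>i t. i \<in> A \<Longrightarrow> \<bar>t - t0\<bar> < e \<Longrightarrow> (f i has_vector_derivative f' i t) (at t)"
    and bnd: "\<And>i t. i \<in> A \<Longrightarrow> \<bar>t - t0\<bar> < e \<Longrightarrow> norm (f' i t) \<le> M i"
    and M: "M summable_on A"
    and f0: "(\<lambda>i. f i t0) summable_on A"
  shows "((\<lambda>t. \<Sum>\<^sub>\<infinity>i\<in>A. f i t) has_vector_derivative (\<Sum>\<^sub>\<infinity>i\<in>A. f' i t0)) (at t0)"
proof -
  have lip: "norm (f i t - f i t0) \<le> M i * \<bar>t - t0\<bar>" if "i \<in> A" "\<bar>t - t0\<bar> < e" for i t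
  proof -
    have "norm (f i t - f i t0) \<le> M i * norm (t - t0)"
    proof (rule differentiable_bound[where S = "ball t0 e" and f' = "\<lambda>x h. h *\<^sub>R f' i x"])
      show "(f i has_derivative (\<lambda>h. h *\<^sub>R f' i x)) (at x within ball t0 e)" if "x \<in> ball t0 e" for x
        using der[OF \<open>i \<in> A\<close>, of x] that
        by (auto simp: has_vector_derivative_def dist_real_def abs_minus_commute intro: has_derivative_at_withinI)
      show "onorm (\<lambda>h. h *\<^sub>R f' i x) \<le> M i" if "x \<in> ball t0 e" for x
      proof (rule onorm_le)
        show "norm (h *\<^sub>R f' i x) \<le> M i * norm h" for h
          using mult_right_mono[OF bnd[OF \<open>i \<in> A\<close>, of x], of "\<bar>h\<bar>"] that
          by (simp add: dist_real_def abs_minus_commute mult.commute)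
      qed
    qed (use that assms in \<open>auto simp: dist_real_def abs_minus_commute\<close>)
    thus ?thesis by simp
  qed
  have f's: "(\<lambda>i. f' i t0) summable_on A"
    by (rule abs_summable_summable, rule Infinite_Sum.abs_summable_on_comparison_test'[OF M])
       (use bnd[of _ t0] assms(1) in auto)
  have fs: "(\<lambda>i. f i t) summable_on A" if "\<bar>t - t0\<bar> < e" for t
  proof -
    have "(\<lambda>i. f i t - f i t0) summable_on A"
      by (rule abs_summable_summable, rule Infinite_Sum.abs_summable_on_comparison_test'[where g = "\<lambda>i. M i * \<bar>t - t0\<bar>"])
         (use lip that M in \<open>auto intro: summable_on_cmult_left\<close>)
    from summable_on_add[OF this f0] show ?thesis by simp
  qed
  define D where "D = (\<lambda>t i. (f i t - f i t0 - (t - t0) *\<^sub>R f' i t0) /\<^sub>R norm (t - t0))"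
  have "((\<lambda>t. \<Sum>\<^sub>\<infinity>i\<in>A. D t i) \<longlongrightarrow> (\<Sum>\<^sub>\<infinity>i\<in>A. 0)) (at t0)"
  proof (rule tendsto_infsum_dominated[where M = "\<lambda>i. M i + M i"])
    show "((\<lambda>t. D t i) \<longlongrightarrow> 0) (at t0)" if "i \<in> A" for i
      using der[OF that, of t0] assms(1)
      unfolding has_vector_derivative_def has_derivative_def D_def by (auto simp: Lim_ident_at)
    show "(\<lambda>i. M i + M i) summable_on A" by (intro summable_on_add M)
    have "\<forall>\<^sub>F t in at t0. \<bar>t - t0\<bar> < e"
      using assms(1) by (auto simp: eventually_at dist_real_def)
    thus "\<forall>\<^sub>F t in at t0. \<forall>i\<in>A. norm (D t i) \<le> M i + M i"
    proof eventually_elim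
      case (elim t)
      show ?case
      proof
        fix i assume i: "i \<in> A"
        have M0: "M i \<ge> 0" using order.trans[OF norm_ge_zero bnd[OF i, of t0]] assms(1) by simp
        show "norm (D t i) \<le> M i + M i"
        proof (cases "t = t0")
          case False
          have "norm (f i t - f i t0 - (t - t0) *\<^sub>R f' i t0) \<le> norm (f i t - f i t0) + norm ((t - t0) *\<^sub>R f' i t0)"
            by (rule norm_triangle_ineq4)
          also have "\<dots> \<le> M i * \<bar>t - t0\<bar> + \<bar>t - t0\<bar> * M i"
            using lip[OF i elim] mult_left_mono[OF bnd[OF i, of t0], of "\<bar>t - t0\<bar>"] assms(1) by (simp add: mult.commute)
          also have "\<dots> = (M i + M i) * \<bar>t - t0\<bar>" by (simp add: algebra_simps)
          finally have "norm (f i t - f i t0 - (t - t0) *\<^sub>R f' i t0) / \<bar>t - t0\<bar> \<le> M i + M i"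
            using False by (simp add: pos_divide_le_eq)
          thus ?thesis by (simp add: D_def divide_inverse mult.commute)
        qed (use M0 in \<open>simp add: D_def\<close>)
      qed
    qed
  qed
  moreover have "\<forall>\<^sub>F t in at t0. (\<Sum>\<^sub>\<infinity>i\<in>A. D t i) =
      ((\<Sum>\<^sub>\<infinity>i\<in>A. f i t) - (\<Sum>\<^sub>\<infinity>i\<in>A. f i t0) - (t - t0) *\<^sub>R (\<Sum>\<^sub>\<infinity>i\<in>A. f' i t0)) /\<^sub>R norm (t - t0)"
  proof -
    have "\<forall>\<^sub>F t in at t0. \<bar>t - t0\<bar> < e"
      using assms(1) by (auto simp: eventually_at dist_real_def)
    thus ?thesis
    proof eventually_elim
      case (elim t)
      have "((\<lambda>i. D t i) has_sum (((\<Sum>\<^sub>\<infinity>i\<in>A. f i t) - (\<Sum>\<^sub>\<infinity>i\<in>A. f i t0) - (t - t0) *\<^sub>R (\<Sum>\<^sub>\<infinity>i\<in>A. f' i t0)) /\<^sub>R norm (t - t0))) A"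
        unfolding D_def diff_conv_add_uminus
        using f0 f's fs[OF elim] has_sum_scaleR[OF has_sum_infsum[OF f's], of "t - t0"]
        by (intro has_sum_scaleR has_sum_add has_sum_uminus[THEN iffD2]) auto
      thus ?case by (rule infsumI)
    qed
  qed
  ultimately have "((\<lambda>t. ((\<Sum>\<^sub>\<infinity>i\<in>A. f i t) - (\<Sum>\<^sub>\<infinity>i\<in>A. f i t0) - (t - t0) *\<^sub>R (\<Sum>\<^sub>\<infinity>i\<in>A. f' i t0)) /\<^sub>R norm (t - t0)) \<longlongrightarrow> 0) (at t0)"
    by (subst (asm) tendsto_cong) auto
  thus ?thesis
    unfolding has_vector_derivative_def has_derivative_def
    by (auto simp: Lim_ident_at intro: bounded_linear_scaleR_left)
qed

lemma has_sum_int_split: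
  fixes f :: "int \<Rightarrow> 'a::{topological_comm_monoid_add, t2_space}"
  assumes "((\<lambda>n::nat. f (int n)) has_sum a) UNIV" "((\<lambda>n::nat. f (- int n - 1)) has_sum b) UNIV"
  shows "(f has_sum (a + b)) UNIV"
proof -
  have 1: "(f has_sum a) {0..}"
    using assms(1) by (rule has_sum_reindex_bij_witness[of _ nat int, THEN iffD1, rotated -1]) auto
  have 2: "(f has_sum b) {..<0}"
    using assms(2) by (rule has_sum_reindex_bij_witness[of _ "\<lambda>n. nat (- n - 1)" "\<lambda>n. - int n - 1", THEN iffD1, rotated -1]) auto
  have "(f has_sum (a + b)) ({0..} \<union> {..<0})"
    by (rule has_sum_Un_disjoint[OF 1 2]) auto
  moreover have "{0..} \<union> {..<0} = (UNIV :: int set)" by auto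
  ultimately show ?thesis by simp
qed

lemma summable_on_int_split:
  fixes f :: "int \<Rightarrow> real"
  assumes "\<And>n. f n \<ge> 0" "summable (\<lambda>n::nat. f (int n))" "summable (\<lambda>n::nat. f (- int n - 1))"
  shows "f summable_on UNIV"
  using assms has_sum_int_split[of f] unfolding summable_on_UNIV_nonneg_real_iff[OF assms(1), symmetric]
  by (metis (no_types, lifting) has_sum_imp_summable has_sum_infsum summable_on_UNIV_nonneg_real_iff)

lemma summable_on_int_power:
  assumes "0 \<le> r" "r < (1::real)"
  shows "(\<lambda>n::int. r ^ nat \<bar>n\<bar>) summable_on UNIV"
proof (rule summable_on_int_split)
  have "(\<lambda>n. r ^ nat \<bar>- int n - 1\<bar>) = (\<lambda>n. r ^ Suc n)"
    by (auto simp: fun_eq_iff nat_add_distrib simp flip: of_nat_Suc intro!: arg_cong[where f = "\<lambda>k. r ^ k"])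
  thus "summable (\<lambda>n. r ^ nat \<bar>- int n - 1\<bar>)"
    using assms by (simp only: summable_Suc_iff) (auto intro!: summable_geometric)
qed (use assms in \<open>auto intro!: summable_geometric\<close>)

lemma summable_on_int_exp:
  assumes "a > 0"
  shows "(\<lambda>n::int. exp (- a * \<bar>real_of_int n\<bar>)) summable_on UNIV"
proof -
  have "exp (- a * \<bar>real_of_int n\<bar>) = exp (- a) ^ nat \<bar>n\<bar>" for n
    by (simp add: exp_of_nat_mult[symmetric] mult.commute)
  thus ?thesis using summable_on_int_power[of "exp (- a)"] assms by simp
qed

lemma summable_on_int_gauss:
  assumes "a > 0"
  shows "(\<lambda>n::int. exp (b * \<bar>real_of_int n\<bar> - a * (real_of_int n)\<^sup>2)) summable_on UNIV"
proof (rule summable_on_comparison_test)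
  show "(\<lambda>n::int. exp ((b + 1)\<^sup>2 / (4 * a)) * exp (- 1 * \<bar>real_of_int n\<bar>)) summable_on UNIV"
    by (intro summable_on_cmult_right summable_on_int_exp) simp
  fix n :: int
  \<comment> \<open>Completing the square with b + 1 in place of b leaves a spare factor exp(-|n|)
    for the comparison.\<close>
  have "0 \<le> a * (\<bar>real_of_int n\<bar> - (b + 1) / (2 * a))\<^sup>2" using assms by simp
  also have "\<dots> = a * (real_of_int n)\<^sup>2 - (b + 1) * \<bar>real_of_int n\<bar> + (b + 1)\<^sup>2 / (4 * a)"
    using assms by (simp add: power2_diff field_simps power2_eq_square)
  finally show "exp (b * \<bar>real_of_int n\<bar> - a * (real_of_int n)\<^sup>2) \<le> exp ((b + 1)\<^sup>2 / (4 * a)) * exp (- 1 * \<bar>real_of_int n\<bar>)"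
    unfolding exp_add[symmetric] by (simp add: algebra_simps)
qed simp

lemma summable_on_int_inverse_square:
  "(\<lambda>n::int. 1 / (1 + (real_of_int n)\<^sup>2)) summable_on UNIV"
proof (rule summable_on_int_split)
  have *: "summable (\<lambda>n. 1 / (1 + (real n)\<^sup>2))"
  proof (rule summable_comparison_test')
    show "summable (\<lambda>n. inverse (real n ^ 2))" by (rule inverse_power_summable) simp
    show "norm (1 / (1 + (real n)\<^sup>2)) \<le> inverse (real n ^ 2)" if "n \<ge> 1" for n
      using that by (auto simp: field_simps add_pos_nonneg)
  qed
  show "summable (\<lambda>n. 1 / (1 + (real_of_int (int n))\<^sup>2))" using * by simp
  have "(real_of_int (- int n - 1))\<^sup>2 = (real (Suc n))\<^sup>2" for n
    by (simp add: power2_eq_square algebra_simps)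
  thus "summable (\<lambda>n. 1 / (1 + (real_of_int (- int n - 1))\<^sup>2))"
    using * summable_Suc_iff[of "\<lambda>n. 1 / (1 + (real n)\<^sup>2)"] by simp
qed (simp add: add_nonneg_nonneg)

lemma norm_add_int_sq_bound:
  fixes z :: complex
  assumes "z \<notin> \<int>"
  obtains K where "K > 0" "\<And>n::int. 1 / (norm (z + of_int n))\<^sup>2 \<le> K * (1 / (1 + (real_of_int n)\<^sup>2))"
proof -
  obtain d where d: "d > 0" "\<And>x. x \<in> \<int> \<Longrightarrow> d \<le> dist z x"
    using separate_point_closed[OF closed_Ints assms] by blast
  have dn: "norm (z + of_int n) \<ge> d" for n
    using d(2)[of "- of_int n"] by (simp add: dist_norm)
  \<comment> \<open>With w = z + n, n^2 <= 2 |w|^2 + 2 |z|^2. The summand 2 covers the term in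
    |w|^2, and |w| >= d turns the constant 1 + 2 |z|^2 into a multiple of |w|^2.\<close>
  define K where "K = 2 + (1 + 2 * (norm z)\<^sup>2) / d\<^sup>2"
  have "1 / (norm (z + of_int n))\<^sup>2 \<le> K * (1 / (1 + (real_of_int n)\<^sup>2))" for n
  proof -
    define w where "w = norm (z + of_int n)"
    have w: "w \<ge> d" "w > 0" using dn[of n] d by (auto simp: w_def)
    have "norm (of_int n :: complex) \<le> w + norm z"
      using norm_triangle_ineq4[of "z + of_int n" z] by (simp add: w_def)
    hence "\<bar>real_of_int n\<bar> \<le> w + norm z" by simp
    hence "\<bar>real_of_int n\<bar>\<^sup>2 \<le> (w + norm z)\<^sup>2" by (intro power_mono) auto
    also have "\<dots> \<le> 2 * w\<^sup>2 + 2 * (norm z)\<^sup>2"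
      using zero_le_power2[of "w - norm z"] by (simp add: power2_eq_square algebra_simps)
    finally have "(real_of_int n)\<^sup>2 \<le> 2 * w\<^sup>2 + 2 * (norm z)\<^sup>2" by simp
    moreover have "(1 + 2 * (norm z)\<^sup>2) * 1 \<le> (1 + 2 * (norm z)\<^sup>2) * (w\<^sup>2 / d\<^sup>2)"
      using w d by (intro mult_left_mono) (auto simp: power_mono add_nonneg_nonneg)
    ultimately have "1 + (real_of_int n)\<^sup>2 \<le> K * w\<^sup>2"
      using d by (simp add: K_def algebra_simps add_divide_distrib)
    moreover have "1 + (real_of_int n)\<^sup>2 > 0" by (simp add: add_pos_nonneg)
    ultimately show ?thesis using w by (simp add: w_def[symmetric] divide_simps mult.commute)
  qed
  moreover have "K > 0" using d by (auto simp: K_def intro!: add_pos_nonneg)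
  ultimately show ?thesis using that by blast
qed

subsection \<open>The Poisson kernel and Poisson summation\<close>

text \<open>The nonnegative and the negative indices give geometric series in w = r e^(-2 pi i s)
  and in its conjugate v; their sum is the Poisson kernel.\<close>

lemma cis_int_sum:
  assumes "\<bar>r\<bar> < 1"
  shows "((\<lambda>n::int. of_real (r ^ nat \<bar>n\<bar>) * cis (- 2 * pi * of_int n * s)) has_sum
           of_real ((1 - r\<^sup>2) / (1 - 2 * r * cos (2 * pi * s) + r\<^sup>2))) UNIV"
proof -
  define w where "w = of_real r * cis (- 2 * pi * s)"
  define v where "v = of_real r * cis (2 * pi * s)"
  have nw: "norm w < 1" "norm v < 1" using assms by (auto simp: w_def v_def norm_mult)
  hence ne: "w \<noteq> 1" "v \<noteq> 1" by auto
  have vw: "v * w = of_real (r\<^sup>2)" "v + w = of_real (2 * r * cos (2 * pi * s))"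
  proof -
    have "v * w = of_real (r * r) * (cis (2 * pi * s) * cis (- 2 * pi * s))"
      by (simp add: v_def w_def)
    thus "v * w = of_real (r\<^sup>2)" by (simp add: cis_mult power2_eq_square)
  qed (auto simp: v_def w_def complex_eq_iff)
  have 1: "((\<lambda>n. w ^ n) has_sum (1 / (1 - w))) UNIV"
    using nw by (intro norm_summable_imp_has_sum geometric_sums) (auto simp: norm_power intro!: summable_geometric)
  have 2: "((\<lambda>n. v * v ^ n) has_sum (v * (1 / (1 - v)))) UNIV"
    using nw by (intro has_sum_cmult_right norm_summable_imp_has_sum geometric_sums) (auto simp: norm_power intro!: summable_geometric)
  have e1: "of_real (r ^ nat \<bar>int n\<bar>) * cis (- 2 * pi * of_int (int n) * s) = w ^ n" for n
  proof -
    have "- 2 * pi * of_int (int n) * s = real n * (- 2 * pi * s)" by simp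
    thus ?thesis by (simp only: w_def power_mult_distrib Complex.DeMoivre of_real_power abs_of_nat nat_int)
  qed
  have e2: "of_real (r ^ nat \<bar>- int n - 1\<bar>) * cis (- 2 * pi * of_int (- int n - 1) * s) = v * v ^ n" for n
  proof -
    have "nat \<bar>- int n - 1\<bar> = Suc n" by simp
    moreover have "- 2 * pi * of_int (- int n - 1) * s = real (Suc n) * (2 * pi * s)"
      by (simp add: algebra_simps)
    moreover have "v * v ^ n = of_real r ^ Suc n * cis (2 * pi * s) ^ Suc n"
      by (simp add: v_def power_mult_distrib)
    ultimately show ?thesis by (simp only: Complex.DeMoivre of_real_power)
  qed
  have "1 / (1 - w) + v * (1 / (1 - v)) = (1 - v * w) / (1 - (v + w) + v * w)"
  proof -
    have "1 - (v + w) + v * w = (1 - w) * (1 - v)" by (simp add: algebra_simps)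
    thus ?thesis using ne by (simp add: divide_simps) (simp add: algebra_simps)
  qed
  also have "\<dots> = of_real ((1 - r\<^sup>2) / (1 - 2 * r * cos (2 * pi * s) + r\<^sup>2))"
    by (simp add: vw)
  finally show ?thesis
    using has_sum_int_split[of "\<lambda>n. of_real (r ^ nat \<bar>n\<bar>) * cis (- 2 * pi * of_int n * s)", OF 1[folded e1] 2[folded e2]]
    by simp
qed

text \<open>In this form the denominator is visibly positive for 0 < r < 1 and at least 2 r (1 - cos
  theta), which controls the kernel away from its peak.\<close>

lemma poisson_kernel_denominator:
  fixes r \<theta> :: real
  shows "1 - 2 * r * cos \<theta> + r\<^sup>2 = (1 - r)\<^sup>2 + 2 * r * (1 - cos \<theta>)"
  by (simp add: power2_eq_square algebra_simps)

text \<open>Abel means of a Fourier series are Poisson integrals: the factors r^|n| make the series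
  converge uniformly in s, so it may be integrated term by term.\<close>

lemma has_sum_poisson_kernel_integral:
  fixes \<phi> :: "real \<Rightarrow> complex"
  assumes cont: "continuous_on {0..1} \<phi>" and r: "0 < r" "r < 1"
  shows "((\<lambda>n::int. of_real (r ^ nat \<bar>n\<bar>) * integral {0..1} (\<lambda>s. \<phi> s * cis (- 2 * pi * of_int n * s))) has_sum
           integral {0..1} (\<lambda>s. \<phi> s * of_real ((1 - r\<^sup>2) / (1 - 2 * r * cos (2 * pi * s) + r\<^sup>2)))) UNIV"
proof -
  have "bounded (\<phi> ` {0..1})"
    by (intro compact_imp_bounded compact_continuous_image cont) auto
  then obtain B where "\<forall>x\<in>\<phi> ` {0..1}. norm x \<le> B"
    unfolding bounded_iff by blast
  hence B: "\<And>s. s \<in> {0..1} \<Longrightarrow> norm (\<phi> s) \<le> B" by blast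
  have ul: "uniform_limit {0..1} (\<lambda>K s. \<Sum>n\<in>K. \<phi> s * (of_real (r ^ nat \<bar>n\<bar>) * cis (- 2 * pi * of_int n * s)))
     (\<lambda>s. \<Sum>\<^sub>\<infinity>n. \<phi> s * (of_real (r ^ nat \<bar>n\<bar>) * cis (- 2 * pi * of_int n * s))) (finite_subsets_at_top (UNIV::int set))"
  proof (rule Weierstrass_m_test_general)
    show "(\<lambda>n::int. B * r ^ nat \<bar>n\<bar>) summable_on UNIV"
      using r by (intro summable_on_cmult_right summable_on_int_power) auto
    show "norm (\<phi> s * (of_real (r ^ nat \<bar>n\<bar>) * cis (- 2 * pi * of_int n * s))) \<le> B * r ^ nat \<bar>n\<bar>"
      if "s \<in> {0..1}" for s and n :: int
      using B[OF that] r by (simp add: norm_mult norm_power mult_right_mono)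
  qed
  have lim: "(\<lambda>s. \<Sum>\<^sub>\<infinity>n. \<phi> s * (of_real (r ^ nat \<bar>n\<bar>) * cis (- 2 * pi * of_int n * s))) =
     (\<lambda>s. \<phi> s * of_real ((1 - r\<^sup>2) / (1 - 2 * r * cos (2 * pi * s) + r\<^sup>2)))"
    using r by (intro ext infsumI has_sum_cmult_right cis_int_sum) auto
  have contn: "continuous_on {0..1} (\<lambda>s. \<Sum>n\<in>K. \<phi> s * (of_real (r ^ nat \<bar>n\<bar>) * cis (- 2 * pi * of_int n * s)))"
    for K :: "int set"
    by (intro continuous_intros cont)
  obtain I J where I: "\<And>K. ((\<lambda>s. \<Sum>n\<in>K. \<phi> s * (of_real (r ^ nat \<bar>n\<bar>) * cis (- 2 * pi * of_int n * s))) has_integral I K) {0..1}"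
    and J: "((\<lambda>s. \<phi> s * of_real ((1 - r\<^sup>2) / (1 - 2 * r * cos (2 * pi * s) + r\<^sup>2))) has_integral J) {0..1}"
    and IJ: "(I \<longlongrightarrow> J) (finite_subsets_at_top (UNIV::int set))"
    by (rule uniform_limit_integral[OF ul[unfolded lim] contn finite_subsets_at_top_neq_bot]) blast
  have io: "(\<lambda>s. \<phi> s * cis (- 2 * pi * of_int n * s)) integrable_on {0..1}" for n
    by (intro integrable_continuous_interval continuous_intros cont)
  have "I K = (\<Sum>n\<in>K. of_real (r ^ nat \<bar>n\<bar>) * integral {0..1} (\<lambda>s. \<phi> s * cis (- 2 * pi * of_int n * s)))" for K
  proof (cases "finite K")
    case True
    have "((\<lambda>s. \<Sum>n\<in>K. of_real (r ^ nat \<bar>n\<bar>) * (\<phi> s * cis (- 2 * pi * of_int n * s))) has_integral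
       (\<Sum>n\<in>K. of_real (r ^ nat \<bar>n\<bar>) * integral {0..1} (\<lambda>s. \<phi> s * cis (- 2 * pi * of_int n * s)))) {0..1}"
      using True io by (intro has_integral_sum has_integral_mult_right) (auto simp: has_integral_integral)
    with I[of K] show ?thesis by (auto simp: mult_ac dest: has_integral_unique)
  next
    \<comment> \<open>A sum over an infinite set is 0 by convention, so both sides are 0; with this
      case included \<open>I\<close> can be rewritten as a function of all sets.\<close>
    case False
    with I[of K] show ?thesis by (auto dest: has_integral_unique[OF _ has_integral_0])
  qed
  hence "I = sum (\<lambda>n. of_real (r ^ nat \<bar>n\<bar>) * integral {0..1} (\<lambda>s. \<phi> s * cis (- 2 * pi * of_int n * s)))"
    by (rule ext)
  with IJ integral_unique[OF J] show ?thesis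
    unfolding has_sum_def by (simp only:)
qed

lemma integral_cis_int:
  "integral {0..1} (\<lambda>s. cis (- 2 * pi * of_int n * s)) = (if n = 0 then 1 else 0)"
proof (cases "n = 0")
  case False
  define c where "c = - 2 * pi * of_int n * \<i>"
  have c: "c \<noteq> 0" using False by (auto simp: c_def)
  have "((\<lambda>s. cis (- 2 * pi * of_int n * s)) has_integral (exp (c * of_real 1) / c - exp (c * of_real 0) / c)) {0..1}"
  proof (rule fundamental_theorem_of_calculus)
    show "((\<lambda>s. exp (c * of_real s) / c) has_vector_derivative cis (- 2 * pi * of_int n * s)) (at s within {0..1})" for s
    proof -
      have "((\<lambda>s. exp (c * s) / c) has_field_derivative exp (c * of_real s)) (at (of_real s))"
        using c by (auto intro!: derivative_eq_intros)
      from has_vector_derivative_real_field[OF this]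
      have "((\<lambda>s. exp (c * of_real s) / c) has_vector_derivative exp (c * of_real s)) (at s within {0..1})" .
      moreover have "exp (c * of_real s) = cis (- 2 * pi * of_int n * s)"
        by (simp add: cis_conv_exp c_def mult_ac)
      ultimately show ?thesis by simp
    qed
  qed simp
  moreover have "exp c = 1"
    unfolding c_def exp_eq_1 by (auto intro!: exI[of _ "-n"])
  ultimately show ?thesis using False by (auto simp: integral_unique)
qed simp

text \<open>Abel summation: absolute summability of the coefficients lets r tend to 1 inside the
  series, while the Poisson integrals tend to phi(0). The second limit needs no splitting of the
  integral: |phi(s) - phi(0)| is bounded everywhere by e + K (1 - cos 2 pi s), and the Poisson
  kernel times 1 - cos 2 pi s is at most (1 - r^2)/(2r).\<close>

theorem fourier_series_at_0:
  fixes \<phi> :: "real \<Rightarrow> complex"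
  defines "c \<equiv> \<lambda>n::int. integral {0..1} (\<lambda>s. \<phi> s * cis (- 2 * pi * of_int n * s))"
  assumes cont: "continuous_on {0..1} \<phi>" and per: "\<phi> 0 = \<phi> 1"
    and summ: "(\<lambda>n. norm (c n)) summable_on UNIV"
  shows "(\<Sum>\<^sub>\<infinity>n. c n) = \<phi> 0"
proof -
  define P where "P = (\<lambda>r s. (1 - r\<^sup>2) / (1 - 2 * r * cos (2 * pi * s) + r\<^sup>2) :: real)"
  define A where "A = (\<lambda>r. \<Sum>\<^sub>\<infinity>n. of_real (r ^ nat \<bar>n\<bar>) * c n)"
  have Ppos: "1 - 2 * r * cos (2 * pi * s) + r\<^sup>2 > 0" if "0 < r" "r < 1" for r s
    using that by (subst poisson_kernel_denominator) (auto intro!: add_pos_nonneg)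
  have P0: "P r s \<ge> 0" if "0 < r" "r < 1" for r s
    using Ppos[OF that, of s] that by (auto simp: P_def power_le_one)
  have Pc: "continuous_on {0..1} (P r)" if "0 < r" "r < 1" for r
    unfolding P_def using Ppos[OF that] by (intro continuous_intros) (auto simp: less_le)
  have P1: "integral {0..1} (P r) = 1" if r: "0 < r" "r < 1" for r
  proof -
    have "((\<lambda>n::int. of_real (r ^ nat \<bar>n\<bar>) * (if n = 0 then 1 else 0)) has_sum
            integral {0..1} (\<lambda>s. of_real (P r s) :: complex)) UNIV"
      using has_sum_poisson_kernel_integral[of "\<lambda>_. 1", OF _ r] by (simp add: integral_cis_int[simplified] P_def)
    moreover have "((\<lambda>n::int. of_real (r ^ nat \<bar>n\<bar>) * (if n = 0 then 1 else 0)) has_sum (1::complex)) UNIV"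
      by (rule has_sum_finite_neutralI[where B = "{0}"]) auto
    ultimately have "integral {0..1} (\<lambda>s. of_real (P r s) :: complex) = 1"
      using has_sum_unique by blast
    thus ?thesis using integral_unique[OF has_integral_of_real[OF integrable_integral[OF integrable_continuous_interval[OF Pc[OF r]]]]]
      by (metis of_real_eq_1_iff)
  qed
  have lim: "(A \<longlongrightarrow> (\<Sum>\<^sub>\<infinity>n. c n)) (at_left 1)"
    unfolding A_def
  proof (rule tendsto_infsum_dominated[OF _ _ summ])
    show "((\<lambda>r. of_real (r ^ nat \<bar>i\<bar>) * c i) \<longlongrightarrow> c i) (at_left 1)" for i
      by (rule tendsto_eq_intros refl | simp)+
    have "\<forall>\<^sub>F r::real in at_left 1. r \<in> {0<..<1}" by (rule eventually_at_left_real) simp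
    thus "\<forall>\<^sub>F r in at_left 1. \<forall>i\<in>UNIV. norm (of_real (r ^ nat \<bar>i\<bar>) * c i) \<le> norm (c i)"
      by eventually_elim (auto simp: norm_mult norm_power power_le_one intro!: mult_left_le_one_le)
  qed
  have "norm ((\<Sum>\<^sub>\<infinity>n. c n) - \<phi> 0) \<le> e" if e: "e > 0" for e
  proof -
    have "bounded (\<phi> ` {0..1})"
      by (intro compact_imp_bounded compact_continuous_image cont) auto
    then obtain B where "\<forall>x\<in>\<phi> ` {0..1}. norm x \<le> B"
      unfolding bounded_iff by blast
    hence B: "\<And>s. s \<in> {0..1} \<Longrightarrow> norm (\<phi> s) \<le> B" by blast
    have B0: "B \<ge> 0" using order.trans[OF norm_ge_zero B[of 0]] by simp
    obtain d0 where d0: "d0 > 0" "\<And>s. s \<in> {0..1} \<Longrightarrow> s < d0 \<Longrightarrow> norm (\<phi> s - \<phi> 0) < e"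
      using cont e unfolding continuous_on_iff by (force simp: dist_norm)
    obtain d1 where d1: "d1 > 0" "\<And>s. s \<in> {0..1} \<Longrightarrow> 1 - s < d1 \<Longrightarrow> norm (\<phi> s - \<phi> 1) < e"
      using cont e unfolding continuous_on_iff by (force simp: dist_norm)
    define d where "d = min (min d0 d1) (1/2)"
    have d: "d > 0" "d \<le> 1/2" using d0 d1 by (auto simp: d_def)
    \<comment> \<open>Chosen so that K (1 - cos 2 pi s) is at least 2B, the trivial bound for
      |phi(s) - phi(0)|, as soon as s has distance at least d from both endpoints.\<close>
    define K where "K = 2 * B / (1 - cos (2 * pi * d))"
    have cd: "cos (2 * pi * d) < 1"
    proof -
      have "cos (2 * pi * d) < cos 0" using d by (intro cos_monotone_0_pi) auto
      thus ?thesis by simp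
    qed
    have K0: "K \<ge> 0" using B0 cd by (auto simp: K_def)
    have bound: "norm (\<phi> s - \<phi> 0) \<le> e + K * (1 - cos (2 * pi * s))" if s: "s \<in> {0..1}" for s
    proof (cases "s < d \<or> 1 - s < d")
      case True
      hence "norm (\<phi> s - \<phi> 0) < e"
        using d0(2)[OF s] d1(2)[OF s] per by (auto simp: d_def)
      moreover have "K * (1 - cos (2 * pi * s)) \<ge> 0" using K0 by simp
      ultimately show ?thesis by linarith
    next
      case False
      have "cos (2 * pi * s) \<le> cos (2 * pi * d)"
      proof (cases "s \<le> 1/2")
        case True
        thus ?thesis using False d by (intro cos_monotone_0_pi_le) auto
      next
        case F2: False
        have "cos (2 * pi * s) = cos (2 * pi * (1 - s))"
          using cos_minus[of "2 * pi * s"] by (simp add: right_diff_distrib cos_diff)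
        also have "\<dots> \<le> cos (2 * pi * d)" using False F2 d by (intro cos_monotone_0_pi_le) auto
        finally show ?thesis .
      qed
      hence "K * (1 - cos (2 * pi * d)) \<le> K * (1 - cos (2 * pi * s))" using K0 by (intro mult_left_mono) auto
      moreover have "K * (1 - cos (2 * pi * d)) = 2 * B" using cd by (auto simp: K_def)
      moreover have "norm (\<phi> s - \<phi> 0) \<le> 2 * B"
        using norm_triangle_ineq4[of "\<phi> s" "\<phi> 0"] B[OF s] B[of 0] by simp
      ultimately show ?thesis using e by linarith
    qed
    have step: "norm (A r - \<phi> 0) \<le> e + K * ((1 - r\<^sup>2) / (2 * r))" if r: "0 < r" "r < 1" for r
    proof -
      have i1: "(\<lambda>s. \<phi> s * of_real (P r s)) integrable_on {0..1}"
        by (intro integrable_continuous_interval continuous_intros cont Pc[OF r])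
      have i2: "(\<lambda>s. \<phi> 0 * of_real (P r s)) integrable_on {0..1}"
        by (intro integrable_continuous_interval continuous_intros cont Pc[OF r])
      have "A r = integral {0..1} (\<lambda>s. \<phi> s * of_real (P r s))"
        using has_sum_poisson_kernel_integral[OF cont r] by (simp add: A_def c_def P_def infsumI)
      moreover have "integral {0..1} (\<lambda>s. \<phi> 0 * of_real (P r s)) = \<phi> 0"
        using has_integral_mult_right[OF has_integral_of_real[OF integrable_integral[OF integrable_continuous_interval[OF Pc[OF r]]]], of "\<phi> 0"] P1[OF r]
        by (intro integral_unique) auto
      ultimately have "A r - \<phi> 0 = integral {0..1} (\<lambda>s. \<phi> s * of_real (P r s) - \<phi> 0 * of_real (P r s))"
        using Henstock_Kurzweil_Integration.integral_diff[OF i1 i2] by simp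
      also have "norm \<dots> \<le> integral {0..1} (\<lambda>s. e * P r s + K * ((1 - r\<^sup>2) / (2 * r)))"
      proof (rule integral_norm_bound_integral)
        show "(\<lambda>s. \<phi> s * of_real (P r s) - \<phi> 0 * of_real (P r s)) integrable_on {0..1}"
          by (intro Henstock_Kurzweil_Integration.integrable_diff i1 i2)
        show "(\<lambda>s. e * P r s + K * ((1 - r\<^sup>2) / (2 * r))) integrable_on {0..1}"
          by (intro integrable_continuous_interval continuous_intros Pc[OF r])
        fix s :: real assume s: "s \<in> {0..1}"
        have "norm (\<phi> s * of_real (P r s) - \<phi> 0 * of_real (P r s)) = norm (\<phi> s - \<phi> 0) * P r s"
          using P0[OF r, of s] by (simp add: left_diff_distrib[symmetric] norm_mult)
        also have "\<dots> \<le> (e + K * (1 - cos (2 * pi * s))) * P r s"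
          using bound[OF s] P0[OF r] by (intro mult_right_mono) auto
        also have "\<dots> = e * P r s + K * ((1 - cos (2 * pi * s)) * P r s)" by (simp add: algebra_simps)
        also have "(1 - cos (2 * pi * s)) * P r s \<le> (1 - r\<^sup>2) / (2 * r)"
        proof -
          have "2 * r * (1 - cos (2 * pi * s)) \<le> 1 - 2 * r * cos (2 * pi * s) + r\<^sup>2"
            by (subst poisson_kernel_denominator) simp
          hence "(1 - r\<^sup>2) * (2 * r * (1 - cos (2 * pi * s))) \<le> (1 - r\<^sup>2) * (1 - 2 * r * cos (2 * pi * s) + r\<^sup>2)"
            using r by (intro mult_left_mono) (auto simp: power_le_one)
          thus ?thesis using Ppos[OF r, of s] r unfolding P_def by (simp add: field_simps)
        qed
        finally show "norm (\<phi> s * of_real (P r s) - \<phi> 0 * of_real (P r s)) \<le> e * P r s + K * ((1 - r\<^sup>2) / (2 * r))"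
          using K0 by (simp add: mult_left_mono)
      qed
      also have "\<dots> = e + K * ((1 - r\<^sup>2) / (2 * r))"
      proof -
        have "((\<lambda>s. e * P r s + K * ((1 - r\<^sup>2) / (2 * r))) has_integral (e * 1 + K * ((1 - r\<^sup>2) / (2 * r)))) {0..1}"
          using has_integral_add[OF has_integral_mult_right[OF integrable_integral[OF integrable_continuous_interval[OF Pc[OF r]]], of e]
            has_integral_const_real[of "K * ((1 - r\<^sup>2) / (2 * r))" 0 1]] P1[OF r]
          by simp
        thus ?thesis by (simp add: integral_unique)
      qed
      finally show ?thesis .
    qed
    have "((\<lambda>r. e + K * ((1 - r\<^sup>2) / (2 * r))) \<longlongrightarrow> e) (at_left 1)"
      by (rule tendsto_eq_intros refl | simp)+
    moreover have "((\<lambda>r. norm (A r - \<phi> 0)) \<longlongrightarrow> norm ((\<Sum>\<^sub>\<infinity>n. c n) - \<phi> 0)) (at_left 1)"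
      by (intro tendsto_intros lim)
    moreover have "\<forall>\<^sub>F r::real in at_left 1. r \<in> {0<..<1}" by (rule eventually_at_left_real) simp
    hence "\<forall>\<^sub>F r in at_left 1. norm (A r - \<phi> 0) \<le> e + K * ((1 - r\<^sup>2) / (2 * r))"
      by eventually_elim (use step in auto)
    ultimately show ?thesis
      by (intro tendsto_le[of "at_left (1::real)"]) auto
  qed
  hence "norm ((\<Sum>\<^sub>\<infinity>n. c n) - \<phi> 0) \<le> 0" by (rule field_le_epsilon) simp
  thus ?thesis by simp
qed

text \<open>Rotating the circle by theta moves the point of evaluation to 0. As g is only controlled
  on [0, 1], the translate \<open>\<phi>\<close> has to wrap around at 1 - theta, where g 0 = g 1
  makes it continuous.\<close>

lemma fourier_series_at:
  fixes g :: "real \<Rightarrow> complex"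
  defines "c \<equiv> \<lambda>n::int. integral {0..1} (\<lambda>s. g s * cis (- 2 * pi * of_int n * s))"
  assumes cont: "continuous_on {0..1} g" and per: "g 0 = g 1"
    and summ: "(\<lambda>n. norm (c n)) summable_on UNIV" and \<theta>: "0 \<le> \<theta>" "\<theta> \<le> 1"
  shows "(\<Sum>\<^sub>\<infinity>n. c n * cis (2 * pi * of_int n * \<theta>)) = g \<theta>"
proof -
  define \<phi> where "\<phi> = (\<lambda>s. if s \<le> 1 - \<theta> then g (s + \<theta>) else g (s + \<theta> - 1))"
  have c\<phi>: "continuous_on {0..1} \<phi>"
    unfolding \<phi>_def using \<theta> per
    by (intro continuous_on_cases_le[where h = "\<lambda>s. s"] continuous_on_compose2[OF cont] continuous_intros) auto
  have \<phi>0: "\<phi> 0 = g \<theta>" "\<phi> 0 = \<phi> 1" using \<theta> per by (auto simp: \<phi>_def)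
  have coeff: "integral {0..1} (\<lambda>s. \<phi> s * cis (- 2 * pi * of_int n * s)) = c n * cis (2 * pi * of_int n * \<theta>)" for n
  proof -
    define G where "G = (\<lambda>u. g u * cis (- 2 * pi * of_int n * u) * cis (2 * pi * of_int n * \<theta>))"
    have cG: "continuous_on {a..b} G" if "0 \<le> a" "b \<le> 1" for a b
      unfolding G_def using that by (intro continuous_intros continuous_on_subset[OF cont]) auto
    have i\<phi>: "(\<lambda>s. \<phi> s * cis (- 2 * pi * of_int n * s)) integrable_on {0..1}"
      by (intro integrable_continuous_interval continuous_intros c\<phi>)
    have iG: "G integrable_on {0..1}"
      by (intro integrable_continuous_interval cG) auto
    have "integral {0..1 - \<theta>} (\<lambda>s. \<phi> s * cis (- 2 * pi * of_int n * s)) = integral {0..1 - \<theta>} (G \<circ> (\<lambda>s. s + \<theta>))"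
    proof (intro Henstock_Kurzweil_Integration.integral_cong)
      fix s assume s: "s \<in> {0..1 - \<theta>}"
      have "cis (- 2 * pi * of_int n * (s + \<theta>)) * cis (2 * pi * of_int n * \<theta>) = cis (- 2 * pi * of_int n * s)"
        by (simp add: cis_mult algebra_simps)
      thus "\<phi> s * cis (- 2 * pi * of_int n * s) = (G \<circ> (\<lambda>s. s + \<theta>)) s"
        using s by (simp add: \<phi>_def G_def mult.assoc)
    qed
    also have "\<dots> = integral {\<theta>..1} G"
      using integral_shift[of 0 \<theta> "1 - \<theta>" G] cG[of \<theta> 1] \<theta> by simp
    finally have 1: "integral {0..1 - \<theta>} (\<lambda>s. \<phi> s * cis (- 2 * pi * of_int n * s)) = integral {\<theta>..1} G" .
    have "integral {1 - \<theta>..1} (\<lambda>s. \<phi> s * cis (- 2 * pi * of_int n * s)) = integral {1 - \<theta>..1} (G \<circ> (\<lambda>s. s + (\<theta> - 1)))"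
    proof (intro Henstock_Kurzweil_Integration.integral_cong)
      fix s assume s: "s \<in> {1 - \<theta>..1}"
      have "cis (- 2 * pi * of_int n * (s + (\<theta> - 1))) * cis (2 * pi * of_int n * \<theta>) = cis (- 2 * pi * of_int n * s) * cis (2 * pi * of_int n)"
        by (simp add: cis_mult algebra_simps)
      also have "cis (2 * pi * of_int n) = 1" by (rule cis_multiple_2pi) simp
      finally have e: "cis (- 2 * pi * of_int n * (s + (\<theta> - 1))) * cis (2 * pi * of_int n * \<theta>) = cis (- 2 * pi * of_int n * s)"
        by simp
      have "\<phi> s = g (s + (\<theta> - 1))"
        using s per by (cases "s = 1 - \<theta>") (auto simp: \<phi>_def algebra_simps)
      thus "\<phi> s * cis (- 2 * pi * of_int n * s) = (G \<circ> (\<lambda>s. s + (\<theta> - 1))) s"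
        by (simp only: G_def o_def mult.assoc[of "g (s + (\<theta> - 1))"] e)
    qed
    also have "\<dots> = integral {0..\<theta>} G"
      using integral_shift[of "1 - \<theta>" "\<theta> - 1" 1 G] cG[of 0 \<theta>] \<theta> by simp
    finally have 2: "integral {1 - \<theta>..1} (\<lambda>s. \<phi> s * cis (- 2 * pi * of_int n * s)) = integral {0..\<theta>} G" .
    have "integral {0..1} (\<lambda>s. \<phi> s * cis (- 2 * pi * of_int n * s)) = integral {0..\<theta>} G + integral {\<theta>..1} G"
      using Henstock_Kurzweil_Integration.integral_combine[OF _ _ i\<phi>, of "1 - \<theta>"] 1 2 \<theta> by (simp add: add.commute)
    also have "\<dots> = integral {0..1} G"
      using Henstock_Kurzweil_Integration.integral_combine[OF _ _ iG, of \<theta>] \<theta> by simp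
    also have "\<dots> = c n * cis (2 * pi * of_int n * \<theta>)"
      unfolding G_def c_def by (rule integral_mult_left)
    finally show ?thesis .
  qed
  have "(\<lambda>n. norm (integral {0..1} (\<lambda>s. \<phi> s * cis (- 2 * pi * of_int n * s)))) summable_on UNIV"
    using summ by (simp only: coeff norm_mult norm_cis mult_1_right)
  from fourier_series_at_0[OF c\<phi> \<phi>0(2) this] show ?thesis
    by (simp only: coeff \<phi>0(1))
qed

text \<open>The bound \<open>B\<close> makes the periodisation of \<open>F\<close> converge
  uniformly on [0, 1], and its n-th Fourier coefficient unfolds to the transform of
  \<open>F\<close>. The transform enters as a limit of integrals over [-N, N] because explicit
  antiderivatives and dominated convergence deliver it in that form.\<close>

theorem poisson_summation:
  fixes F :: "real \<Rightarrow> complex" and Fh :: "int \<Rightarrow> complex"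
  assumes cont: "continuous_on UNIV F"
    and bnd: "\<And>k s. s \<in> {0..1} \<Longrightarrow> norm (F (of_int k + s)) \<le> B k"
    and B: "B summable_on (UNIV :: int set)"
    and ft: "\<And>n. (\<lambda>N::nat. integral {- real N..real N} (\<lambda>s. F s * cis (- 2 * pi * of_int n * s))) \<longlonglongrightarrow> Fh n"
    and Fh: "(\<lambda>n. norm (Fh n)) summable_on UNIV"
  shows "(\<Sum>\<^sub>\<infinity>k::int. F (of_int k + \<theta>)) = (\<Sum>\<^sub>\<infinity>n. Fh n * cis (2 * pi * of_int n * \<theta>))"
proof -
  define \<phi> where "\<phi> = (\<lambda>s. \<Sum>\<^sub>\<infinity>k::int. F (of_int k + s))"
  define c where "c = (\<lambda>n::int. integral {0..1} (\<lambda>s. \<phi> s * cis (- 2 * pi * of_int n * s)))"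
  have cF: "continuous_on S F" for S using cont continuous_on_subset by blast
  have cFk: "continuous_on S (\<lambda>s. F (a + s))" for S a
    by (rule continuous_on_compose2[OF cont]) (auto intro!: continuous_intros)
  have ul: "uniform_limit {0..1} (\<lambda>K s. \<Sum>k\<in>K. F (of_int k + s)) \<phi> (finite_subsets_at_top (UNIV::int set))"
    unfolding \<phi>_def by (rule Weierstrass_m_test_general[OF bnd B]) auto
  have cphi: "continuous_on {0..1} \<phi>"
    by (rule uniform_limit_theorem[OF _ ul]) (auto intro!: always_eventually continuous_intros cFk)
  have per: "\<phi> 0 = \<phi> 1"
    unfolding \<phi>_def
    by (rule infsum_reindex_bij_witness[of _ "\<lambda>k. k + 1" "\<lambda>k. k - 1"]) (auto simp: add_ac)
  have c_eq: "c n = Fh n" for n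
  proof -
    define i where "i = (\<lambda>k::int. integral {0..1} (\<lambda>s. F (of_int k + s) * cis (- 2 * pi * of_int n * s)))"
    have ul': "uniform_limit {0..1} (\<lambda>K s. \<Sum>k\<in>K. F (of_int k + s) * cis (- 2 * pi * of_int n * s))
       (\<lambda>s. \<Sum>\<^sub>\<infinity>k. F (of_int k + s) * cis (- 2 * pi * of_int n * s)) (finite_subsets_at_top (UNIV::int set))"
      by (rule Weierstrass_m_test_general[OF _ B]) (use bnd in \<open>auto simp: norm_mult\<close>)
    have lim: "(\<lambda>s. \<Sum>\<^sub>\<infinity>k. F (of_int k + s) * cis (- 2 * pi * of_int n * s)) = (\<lambda>s. \<phi> s * cis (- 2 * pi * of_int n * s))"
      by (simp add: \<phi>_def infsum_cmult_left')
    have contn: "continuous_on {0..1} (\<lambda>s. \<Sum>k\<in>K. F (of_int k + s) * cis (- 2 * pi * of_int n * s))" for K :: "int set"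
      by (intro continuous_intros cFk)
    obtain I J where I: "\<And>K. ((\<lambda>s. \<Sum>k\<in>K. F (of_int k + s) * cis (- 2 * pi * of_int n * s)) has_integral I K) {0..1}"
      and J: "((\<lambda>s. \<phi> s * cis (- 2 * pi * of_int n * s)) has_integral J) {0..1}"
      and IJ: "(I \<longlongrightarrow> J) (finite_subsets_at_top (UNIV::int set))"
      by (rule uniform_limit_integral[OF ul'[unfolded lim] contn finite_subsets_at_top_neq_bot]) blast
    have "I K = sum i K" if "finite K" for K
    proof -
      have "((\<lambda>s. \<Sum>k\<in>K. F (of_int k + s) * cis (- 2 * pi * of_int n * s)) has_integral sum i K) {0..1}"
        unfolding i_def
        by (intro has_integral_sum[OF that] integrable_integral integrable_continuous_interval continuous_intros cFk)
      with I[of K] show ?thesis by (rule has_integral_unique)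
    qed
    hence "\<forall>\<^sub>F K in finite_subsets_at_top UNIV. I K = sum i K"
      by (auto intro: eventually_finite_subsets_at_top_weakI)
    with IJ have "(sum i \<longlongrightarrow> J) (finite_subsets_at_top UNIV)" by (rule Lim_transform_eventually)
    moreover have "J = c n" using J by (simp add: c_def integral_unique)
    \<comment> \<open>The unconditional sum of the integrals over unit intervals is evaluated along
      the index sets \<open>{- int N..<int N}\<close>, whose unit intervals fill [-N, N]
      exactly.\<close>
    moreover have "filterlim (\<lambda>N. {- int N..<int N}) (finite_subsets_at_top UNIV) sequentially"
      unfolding filterlim_finite_subsets_at_top
    proof safe
      fix X :: "int set" assume X: "finite X"
      have "X \<subseteq> {- int N..<int N}" if "N \<ge> nat (Max (insert 0 (abs ` X))) + 1" for N
      proof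
        fix x assume "x \<in> X"
        hence "\<bar>x\<bar> \<le> Max (insert 0 (abs ` X))" using X by (intro Max_ge) auto
        thus "x \<in> {- int N..<int N}" using that by auto
      qed
      thus "\<forall>\<^sub>F N in sequentially. finite {- int N..<int N} \<and> X \<subseteq> {- int N..<int N} \<and> {- int N..<int N} \<subseteq> UNIV"
        unfolding eventually_sequentially by (metis finite_atLeastLessThan_int subset_UNIV)
    qed
    ultimately have l1: "(\<lambda>N. sum i {- int N..<int N}) \<longlonglongrightarrow> c n"
      by (auto intro: filterlim_compose)
    define g where "g = (\<lambda>s. F s * cis (- 2 * pi * of_int n * s))"
    have gc: "continuous_on S g" for S
      unfolding g_def by (intro continuous_intros cF)
    have gi: "g integrable_on {a..b}" for a b
      unfolding g_def by (intro integrable_continuous_interval continuous_intros cF)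
    have ik: "i k = integral {of_int k..of_int k + 1} g" for k
    proof -
      have "integral {of_int k..of_int k + 1} g = integral {0..1} (g \<circ> (\<lambda>s. s + of_int k))"
        using integral_shift[of 0 "of_int k" 1 g] gc by (simp add: add.commute)
      also have "g \<circ> (\<lambda>s. s + of_int k) = (\<lambda>s. F (of_int k + s) * cis (- 2 * pi * of_int n * s))"
      proof
        fix s
        have "cis (- 2 * pi * of_int n * (s + of_int k)) = cis (- 2 * pi * of_int n * s) * cis (2 * pi * of_int (- n * k))"
          by (simp add: cis_mult algebra_simps)
        also have "cis (2 * pi * of_int (- n * k)) = 1" by (rule cis_multiple_2pi) simp
        finally show "(g \<circ> (\<lambda>s. s + of_int k)) s = F (of_int k + s) * cis (- 2 * pi * of_int n * s)"
          by (simp add: g_def add.commute)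
      qed
      finally show ?thesis by (simp add: i_def)
    qed
    have "sum i {- int N..<int N} = integral {- real N..real N} g" for N
    proof (induction N)
      case (Suc N)
      have "{- int (Suc N)..<int (Suc N)} = insert (- int N - 1) (insert (int N) {- int N..<int N})" by auto
      hence "sum i {- int (Suc N)..<int (Suc N)} = i (- int N - 1) + (i (int N) + integral {- real N..real N} g)"
        using Suc by simp
      also have "i (int N) + integral {- real N..real N} g = integral {- real N..real N + 1} g"
        using Henstock_Kurzweil_Integration.integral_combine[of "- real N" "real N" "real N + 1" g] gi by (simp add: ik add.commute)
      also have "i (- int N - 1) + \<dots> = integral {- real N - 1..real N + 1} g"
        using Henstock_Kurzweil_Integration.integral_combine[of "- real N - 1" "- real N" "real N + 1" g] gi by (simp add: ik)
      also have "- real N - 1 = - real (Suc N)" by simp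
      also have "real N + 1 = real (Suc N)" by simp
      finally show ?case .
    qed simp
    with l1 have "(\<lambda>N. integral {- real N..real N} g) \<longlonglongrightarrow> c n" by simp
    with ft[of n] show ?thesis unfolding g_def by (auto dest: LIMSEQ_unique)
  qed
  have "(\<lambda>n. norm (c n)) summable_on UNIV" using Fh by (simp add: c_eq)
  note summ = this[unfolded c_def]
  \<comment> \<open>Both sides of the formula have period 1 in theta, so only its fractional part
    matters.\<close>
  define r where "r = \<theta> - of_int \<lfloor>\<theta>\<rfloor>"
  have r: "0 \<le> r" "r \<le> 1" unfolding r_def by linarith+
  have A: "(\<Sum>\<^sub>\<infinity>k::int. F (of_int k + \<theta>)) = \<phi> r"
    unfolding \<phi>_def
    by (rule infsum_reindex_bij_witness[of _ "\<lambda>k. k - \<lfloor>\<theta>\<rfloor>" "\<lambda>k. k + \<lfloor>\<theta>\<rfloor>"]) (auto simp: r_def)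
  have B: "(\<Sum>\<^sub>\<infinity>n. Fh n * cis (2 * pi * of_int n * r)) = \<phi> r"
    using fourier_series_at[OF cphi per summ r] by (simp only: c_eq[unfolded c_def])
  have "(\<lambda>n::int. cis (2 * pi * of_int n * r)) = (\<lambda>n. cis (2 * pi * of_int n * \<theta>))"
  proof
    fix n :: int
    have "cis (2 * pi * of_int n * \<theta>) = cis (2 * pi * of_int n * r) * cis (2 * pi * of_int (n * \<lfloor>\<theta>\<rfloor>))"
      by (simp add: cis_mult r_def algebra_simps)
    also have "cis (2 * pi * of_int (n * \<lfloor>\<theta>\<rfloor>)) = 1" by (rule cis_multiple_2pi) simp
    finally show "cis (2 * pi * of_int n * r) = cis (2 * pi * of_int n * \<theta>)" by simp
  qed
  hence "(\<lambda>n. Fh n * cis (2 * pi * of_int n * r)) = (\<lambda>n. Fh n * cis (2 * pi * of_int n * \<theta>))"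
    by (simp add: fun_eq_iff)
  with A B show ?thesis by simp
qed

subsection \<open>Gaussian integrals\<close>

lemma integrable_gauss_std: "integrable lborel (\<lambda>x::real. exp (- x\<^sup>2 / 2))"
proof -
  have "integrable lborel (\<lambda>x. sqrt (2 * pi) * std_normal_density x)"
    by (intro integrable_mult_right) simp
  thus ?thesis by (simp add: std_normal_density_def)
qed

text \<open>This is the characteristic function of the standard normal distribution, freed of the
  normalising factor.\<close>

lemma has_bochner_integral_gauss_fourier_std:
  "has_bochner_integral lborel (\<lambda>x::real. of_real (exp (- x\<^sup>2 / 2)) * cis (\<xi> * x)) (of_real (sqrt (2 * pi) * exp (- \<xi>\<^sup>2 / 2)) :: complex)"
proof -
  have int: "integrable lborel (\<lambda>x::real. of_real (exp (- x\<^sup>2 / 2)) * cis (\<xi> * x))"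
    by (rule Bochner_Integration.integrable_bound[OF integrable_gauss_std])
       (auto simp: norm_mult cis_conv_exp)
  have "of_real (exp (- \<xi>\<^sup>2 / 2)) = char std_normal_distribution \<xi>"
    by (simp add: char_std_normal_distribution)
  also have "\<dots> = (LINT x|lborel. std_normal_density x *\<^sub>R iexp (\<xi> * x))"
    unfolding char_def by (intro integral_density) auto
  also have "\<dots> = (LINT x|lborel. of_real (1 / sqrt (2 * pi)) * (of_real (exp (- x\<^sup>2 / 2)) * cis (\<xi> * x)))"
    by (intro Bochner_Integration.integral_cong refl)
       (simp add: std_normal_density_def scaleR_conv_of_real cis_conv_exp)
  also have "\<dots> = of_real (1 / sqrt (2 * pi)) * (LINT x|lborel. of_real (exp (- x\<^sup>2 / 2)) * cis (\<xi> * x))"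
    by (rule integral_mult_right_zero)
  finally have "(LINT x|lborel. of_real (exp (- x\<^sup>2 / 2)) * cis (\<xi> * x)) = of_real (sqrt (2 * pi) * exp (- \<xi>\<^sup>2 / 2))"
    by (simp add: field_simps)
  with int show ?thesis by (simp add: has_bochner_integral_iff)
qed

text \<open>The real part of \<open>c\<close> only moves the centre of the Gaussian to
  \<open>m\<close> and contributes a constant; the imaginary part then acts as a Fourier frequency.
  The substitution s = m + sigma x thus reduces everything to the standard normal density.\<close>

lemma has_bochner_integral_gauss_complex:
  fixes c :: complex
  assumes T: "T > 0"
  shows "has_bochner_integral lborel (\<lambda>s::real. exp (of_real (- pi * s\<^sup>2 / T) + c * of_real s))
           (of_real (sqrt T) * exp (of_real T * c\<^sup>2 / (4 * of_real pi)))"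
proof -
  define \<sigma> where "\<sigma> = sqrt (T / (2 * pi))"
  define m where "m = Re c * T / (2 * pi)"
  define f where "f = (\<lambda>s::real. exp (of_real (- pi * s\<^sup>2 / T) + c * of_real s))"
  define K where "K = exp (of_real ((Re c)\<^sup>2 * T / (4 * pi)) + \<i> * of_real (Im c * m))"
  have \<sigma>: "\<sigma> > 0" "\<sigma>\<^sup>2 = T / (2 * pi)" using T by (auto simp: \<sigma>_def)
  have fm: "f (m + \<sigma> * x) = K * (of_real (exp (- x\<^sup>2 / 2)) * cis (Im c * \<sigma> * x))" for x
  proof -
    have e1: "- pi * (m + \<sigma> * x)\<^sup>2 / T + Re c * (m + \<sigma> * x) = (Re c)\<^sup>2 * T / (4 * pi) - x\<^sup>2 / 2"
    proof -
      have "pi * (m + \<sigma> * x)\<^sup>2 / T = pi * m\<^sup>2 / T + 2 * pi * m * \<sigma> * x / T + pi * \<sigma>\<^sup>2 * x\<^sup>2 / T"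
        by (simp add: power2_eq_square algebra_simps add_divide_distrib)
      also have "pi * \<sigma>\<^sup>2 * x\<^sup>2 / T = x\<^sup>2 / 2" using T by (simp add: \<sigma>)
      also have "2 * pi * m * \<sigma> * x / T = Re c * \<sigma> * x" using T by (simp add: m_def)
      also have "pi * m\<^sup>2 / T = (Re c)\<^sup>2 * T / (4 * pi)" using T by (simp add: m_def power2_eq_square field_simps)
      finally have 1: "pi * (m + \<sigma> * x)\<^sup>2 / T = (Re c)\<^sup>2 * T / (4 * pi) + Re c * \<sigma> * x + x\<^sup>2 / 2" .
      have 2: "Re c * m = 2 * ((Re c)\<^sup>2 * T / (4 * pi))" by (simp add: m_def power2_eq_square)
      show ?thesis using 1 2 by (simp add: algebra_simps)
    qed
    have "of_real (- pi * (m + \<sigma> * x)\<^sup>2 / T) + c * of_real (m + \<sigma> * x) =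
       of_real (- pi * (m + \<sigma> * x)\<^sup>2 / T + Re c * (m + \<sigma> * x)) + \<i> * of_real (Im c * (m + \<sigma> * x))"
      by (simp add: complex_eq_iff)
    also have "\<dots> = (of_real ((Re c)\<^sup>2 * T / (4 * pi)) + \<i> * of_real (Im c * m)) + (of_real (- x\<^sup>2 / 2) + \<i> * of_real (Im c * \<sigma> * x))"
      unfolding e1 by (simp add: algebra_simps)
    finally show ?thesis
      unfolding f_def K_def by (simp only: exp_add exp_of_real[symmetric] cis_conv_exp of_real_add)
  qed
  have "has_bochner_integral lborel (\<lambda>x. f (m + \<sigma> * x)) (K * of_real (sqrt (2 * pi) * exp (- (Im c * \<sigma>)\<^sup>2 / 2)))"
    unfolding fm by (intro has_bochner_integral_mult_right has_bochner_integral_gauss_fourier_std)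
  hence "has_bochner_integral lborel f (\<sigma> *\<^sub>R (K * of_real (sqrt (2 * pi) * exp (- (Im c * \<sigma>)\<^sup>2 / 2))))"
    using \<sigma> by (subst lborel_has_bochner_integral_real_affine_iff[of \<sigma> f _ m]) auto
  also have "\<sigma> *\<^sub>R (K * of_real (sqrt (2 * pi) * exp (- (Im c * \<sigma>)\<^sup>2 / 2))) =
     of_real (sqrt T) * exp (of_real T * c\<^sup>2 / (4 * of_real pi))"
  proof -
    have "\<sigma> * sqrt (2 * pi) = sqrt T" using T by (simp add: \<sigma>_def flip: real_sqrt_mult)
    moreover have "K * of_real (exp (- (Im c * \<sigma>)\<^sup>2 / 2)) = exp (of_real T * c\<^sup>2 / (4 * of_real pi))"
    proof -
      have "of_real ((Re c)\<^sup>2 * T / (4 * pi)) + \<i> * of_real (Im c * m) + of_real (- (Im c * \<sigma>)\<^sup>2 / 2) = of_real T * c\<^sup>2 / (4 * of_real pi)"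
        unfolding power_mult_distrib \<sigma>
        by (simp add: complex_eq_iff m_def power2_eq_square field_simps)
      thus ?thesis unfolding K_def by (simp only: exp_of_real[symmetric] exp_add[symmetric])
    qed
    moreover have "\<sigma> *\<^sub>R (K * of_real (sqrt (2 * pi) * exp (- (Im c * \<sigma>)\<^sup>2 / 2))) =
        of_real (\<sigma> * sqrt (2 * pi)) * (K * of_real (exp (- (Im c * \<sigma>)\<^sup>2 / 2)))"
      by (simp add: scaleR_conv_of_real)
    ultimately show ?thesis by simp
  qed
  finally show ?thesis by (simp add: f_def)
qed

lemma tendsto_integral_gauss_complex:
  fixes c :: complex
  assumes T: "T > 0"
  shows "(\<lambda>N::nat. integral {- real N..real N} (\<lambda>s. exp (of_real (- pi * s\<^sup>2 / T) + c * of_real s)))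
     \<longlonglongrightarrow> of_real (sqrt T) * exp (of_real T * c\<^sup>2 / (4 * of_real pi))"
proof -
  define f where "f = (\<lambda>s::real. exp (of_real (- pi * s\<^sup>2 / T) + c * of_real s))"
  have hb: "has_bochner_integral lborel f (of_real (sqrt T) * exp (of_real T * c\<^sup>2 / (4 * of_real pi)))"
    unfolding f_def by (rule has_bochner_integral_gauss_complex[OF T])
  hence fi: "integrable lborel f" and fv: "integral\<^sup>L lborel f = of_real (sqrt T) * exp (of_real T * c\<^sup>2 / (4 * of_real pi))"
    by (auto simp: has_bochner_integral_iff)
  have "(\<lambda>N::nat. LINT s|lborel. indicator {- real N..real N} s *\<^sub>R f s) \<longlonglongrightarrow> integral\<^sup>L lborel f"
  proof (rule integral_dominated_convergence[where w = "\<lambda>s. norm (f s)"])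
    show "AE s in lborel. (\<lambda>N::nat. indicator {- real N..real N} s *\<^sub>R f s) \<longlonglongrightarrow> f s"
    proof (rule AE_I2)
      fix s :: real
      have "indicator {- real N..real N} s *\<^sub>R f s = f s" if "N \<ge> nat \<lceil>\<bar>s\<bar>\<rceil>" for N
        using that by (auto simp: indicator_def abs_le_iff nat_ceiling_le_eq)
      thus "(\<lambda>N::nat. indicator {- real N..real N} s *\<^sub>R f s) \<longlonglongrightarrow> f s"
        by (intro tendsto_eventually) (unfold eventually_sequentially, blast)
    qed
  qed (use fi in \<open>auto simp: indicator_def\<close>)
  moreover have "(LINT s|lborel. indicator {- real N..real N} s *\<^sub>R f s) = integral {- real N..real N} f" for N
  proof -
    have "set_integrable lborel {- real N..real N} f"
      unfolding set_integrable_def using fi by (intro integrable_mult_indicator) auto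
    from set_borel_integral_eq_integral(2)[OF this] show ?thesis by (simp add: set_lebesgue_integral_def)
  qed
  ultimately show ?thesis using fv unfolding f_def by simp
qed

section \<open>The error function \<open>E_fun\<close> and the incomplete gamma function
  \<open>beta_fun\<close>\<close>

lemma E_fun_has_derivative [derivative_intros]:
  assumes "(g has_field_derivative g') (at x within S)"
  shows "((\<lambda>x. E_fun (g x)) has_field_derivative (2 * exp (- pi * (g x)\<^sup>2) * g')) (at x within S)"
proof -
  have "(E_fun has_field_derivative 2 * exp (- pi * z\<^sup>2)) (at z)" for z
  proof -
    define a where "a = min z 0 - 1"
    define b where "b = max z 0 + 1"
    have ab: "a < z" "z < b" "a < 0" "0 < b" by (auto simp: a_def b_def)
    have "((\<lambda>u. LBINT y=ereal 0..ereal u. exp (- pi * y\<^sup>2)) has_vector_derivative exp (- pi * z\<^sup>2)) (at z within {a..b})"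
      using ab by (intro interval_integral_FTC2) (auto intro!: continuous_intros)
    hence "((\<lambda>u. LBINT y=ereal 0..ereal u. exp (- pi * y\<^sup>2)) has_vector_derivative exp (- pi * z\<^sup>2)) (at z)"
      using ab by (subst (asm) at_within_Icc_at) auto
    hence "((\<lambda>u. LBINT y=ereal 0..ereal u. exp (- pi * y\<^sup>2)) has_field_derivative exp (- pi * z\<^sup>2)) (at z)"
      by (simp add: has_real_derivative_iff_has_vector_derivative)
    from DERIV_cmult[OF this, of 2] show ?thesis unfolding E_fun_def[abs_def] .
  qed
  from DERIV_chain2[OF this assms] show ?thesis .
qed

lemma E_fun_0 [simp]: "E_fun 0 = 0"
  by (simp add: E_fun_def)

lemma E_fun_minus: "E_fun (- z) = - E_fun z"
proof -
  have "((\<lambda>z. E_fun (- z) + E_fun z) has_field_derivative 0) (at z)" for z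
    by (auto intro!: derivative_eq_intros)
  hence "E_fun (- z) + E_fun z = E_fun (- 0) + E_fun 0"
    by (intro DERIV_isconst_all) auto
  thus ?thesis by simp
qed

lemma continuous_E_fun [continuous_intros]: "continuous_on S g \<Longrightarrow> continuous_on S (\<lambda>x. E_fun (g x))"
proof -
  have "continuous_on UNIV E_fun"
    by (intro continuous_at_imp_continuous_on) (auto intro!: DERIV_isCont derivative_eq_intros E_fun_has_derivative[OF DERIV_ident])
  thus "continuous_on S g \<Longrightarrow> continuous_on S (\<lambda>x. E_fun (g x))"
    by (rule continuous_on_compose2) auto
qed

lemma E_fun_mono: "x \<le> y \<Longrightarrow> E_fun x \<le> E_fun y"
  by (rule DERIV_nonneg_imp_nondecreasing[of x y E_fun])
     (auto intro!: exI[of _ "2 * exp (- pi * _\<^sup>2)"] derivative_eq_intros)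

text \<open>Along the integers this is the Gaussian integral with T = 1 and c = 0; monotonicity
  extends the limit to real arguments.\<close>

lemma E_fun_tendsto_1: "(E_fun \<longlongrightarrow> 1) at_top"
proof -
  have E: "integral {- real N..real N} (\<lambda>s. exp (- pi * s\<^sup>2)) = E_fun (real N)" for N
  proof -
    have "((\<lambda>s. exp (- pi * s\<^sup>2)) has_integral (E_fun (real N) / 2 - E_fun (- real N) / 2)) {- real N..real N}"
      by (rule fundamental_theorem_of_calculus)
         (auto intro!: derivative_eq_intros simp flip: has_real_derivative_iff_has_vector_derivative)
    thus ?thesis by (simp add: integral_unique E_fun_minus)
  qed
  have "integral {- real N..real N} (\<lambda>s. exp (of_real (- pi * s\<^sup>2 / 1) + 0 * of_real s)) = (of_real (E_fun (real N)) :: complex)" for N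
  proof -
    have "((\<lambda>s. of_real (exp (- pi * s\<^sup>2)) :: complex) has_integral of_real (E_fun (real N))) {- real N..real N}"
      unfolding E[symmetric] by (intro has_integral_of_real integrable_integral integrable_continuous_interval continuous_intros)
    thus ?thesis by (simp add: integral_unique exp_of_real[symmetric])
  qed
  with tendsto_integral_gauss_complex[of 1 0] have "(\<lambda>N. of_real (E_fun (real N)) :: complex) \<longlonglongrightarrow> of_real 1"
    by simp
  hence lim: "(\<lambda>N. E_fun (real N)) \<longlonglongrightarrow> 1" by (subst (asm) tendsto_of_real_iff)
  have le1: "E_fun x \<le> 1" for x
  proof -
    have "\<forall>\<^sub>F N in sequentially. E_fun x \<le> E_fun (real N)"
      unfolding eventually_sequentially
      by (auto intro!: exI[of _ "nat \<lceil>x\<rceil>"] E_fun_mono simp: nat_ceiling_le_eq)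
    thus ?thesis by (intro tendsto_lowerbound[OF lim]) auto
  qed
  show ?thesis
  proof (rule order_tendstoI)
    fix a :: real assume "a < 1"
    with lim have "\<forall>\<^sub>F N in sequentially. a < E_fun (real N)" by (rule order_tendstoD)
    then obtain N where "a < E_fun (real N)" by (auto simp: eventually_sequentially)
    hence "\<forall>x\<ge>real N. a < E_fun x" using E_fun_mono by (meson less_le_trans)
    thus "\<forall>\<^sub>F x in at_top. a < E_fun x" unfolding eventually_at_top_linorder by blast
  next
    fix a :: real assume "1 < a"
    thus "\<forall>\<^sub>F x in at_top. E_fun x < a" using le1 by (intro always_eventually allI) (meson le_less_trans)
  qed
qed

lemma E_fun_le_1: "E_fun x \<le> 1"
proof (rule tendsto_lowerbound[OF E_fun_tendsto_1])
  show "\<forall>\<^sub>F y in at_top. E_fun x \<le> E_fun y"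
    using eventually_ge_at_top[of x] by eventually_elim (rule E_fun_mono)
qed simp

text \<open>The difference g of the two sides vanishes at 0 and at infinity, and g' = 2 exp(-pi z^2)
  (1 - pi z). So g rises up to 1/pi and falls afterwards, hence stays nonnegative.\<close>

lemma one_minus_E_fun_le:
  assumes "z \<ge> 0"
  shows "1 - E_fun z \<le> exp (- pi * z\<^sup>2)"
proof -
  define g where "g = (\<lambda>z. exp (- pi * z\<^sup>2) + E_fun z - 1)"
  have der: "(g has_field_derivative 2 * exp (- pi * z\<^sup>2) * (1 - pi * z)) (at z)" for z
    unfolding g_def by (auto intro!: derivative_eq_intros simp: algebra_simps)
  show ?thesis
  proof (cases "z \<le> 1 / pi")
    case True
    have "g 0 \<le> g z"
    proof (rule DERIV_nonneg_imp_nondecreasing[OF assms])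
      fix x assume "0 \<le> x" "x \<le> z"
      hence "pi * x \<le> 1" using True by (simp add: field_simps) (meson mult_left_mono order.trans pi_ge_zero)
      thus "\<exists>y. DERIV g x :> y \<and> 0 \<le> y" using der[of x] by (intro exI conjI) auto
    qed
    thus ?thesis by (simp add: g_def)
  next
    case False
    have "(g \<longlongrightarrow> 0 + 1 - 1) at_top"
      unfolding g_def
      by (intro tendsto_intros E_fun_tendsto_1) real_asymp
    hence lim: "(g \<longlongrightarrow> 0) at_top" by simp
    have "\<forall>\<^sub>F y in at_top. g y \<le> g z"
      using eventually_ge_at_top[of z]
    proof eventually_elim
      case (elim y)
      show ?case
      proof (rule DERIV_nonpos_imp_nonincreasing[OF elim])
        fix x assume "z \<le> x" "x \<le> y"
        have "1 < pi * z" using False by (simp add: field_simps)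
        also have "pi * z \<le> pi * x" using \<open>z \<le> x\<close> by (intro mult_left_mono) auto
        finally have "pi * x \<ge> 1" by simp
        thus "\<exists>y. DERIV g x :> y \<and> y \<le> 0" using der[of x] by (intro exI conjI) (auto simp: mult_nonneg_nonpos)
      qed
    qed
    hence "0 \<le> g z" by (intro tendsto_upperbound[OF lim]) auto
    thus ?thesis by (simp add: g_def)
  qed
qed

text \<open>The substitution u = v^2 turns the integrand into a Gaussian, so E(sqrt u) is an
  antiderivative; its one-sided limits take care of the singularity at u = 0 and of the infinite
  endpoint.\<close>

lemma beta_fun_eq:
  assumes "y \<ge> 0"
  shows "beta_fun y = 1 - E_fun (sqrt y)"
  unfolding beta_fun_def
proof (rule interval_integral_FTC_nonneg(2)[where F = "\<lambda>u. E_fun (sqrt u)"])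
  fix u :: real assume "ereal y < ereal u"
  hence u: "u > 0" using assms by simp
  have "((\<lambda>u. E_fun (sqrt u)) has_real_derivative 2 * exp (- pi * (sqrt u)\<^sup>2) * (inverse (sqrt u) / 2)) (at u)"
    by (rule E_fun_has_derivative[OF DERIV_real_sqrt[OF u]])
  also have "2 * exp (- pi * (sqrt u)\<^sup>2) * (inverse (sqrt u) / 2) = u powr (- 1 / 2) * exp (- pi * u)"
    using u by (simp add: powr_minus powr_half_sqrt)
  finally show "((\<lambda>u. E_fun (sqrt u)) has_real_derivative u powr (- 1 / 2) * exp (- pi * u)) (at u)" .
  show "isCont (\<lambda>u. u powr (- 1 / 2) * exp (- pi * u)) u"
  proof -
    have "continuous_on {0<..} (\<lambda>u. u powr (- 1 / 2) * exp (- pi * u))"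
      by (intro continuous_intros) auto
    thus ?thesis using u continuous_on_eq_continuous_at[OF open_greaterThan, of 0] by blast
  qed
next
  have "((\<lambda>u. E_fun (sqrt u)) \<longlongrightarrow> E_fun (sqrt y)) (at_right y)"
    by (rule isCont_tendsto_compose[OF DERIV_isCont[OF E_fun_has_derivative[OF DERIV_ident]] tendsto_real_sqrt[OF tendsto_ident_at]])
  thus "(((\<lambda>u. E_fun (sqrt u)) \<circ> real_of_ereal) \<longlongrightarrow> E_fun (sqrt y)) (at_right (ereal y))"
    by (simp add: ereal_tendsto_simps)
next
  have "((\<lambda>u. E_fun (sqrt u)) \<longlongrightarrow> 1) at_top"
    by (rule filterlim_compose[OF E_fun_tendsto_1 sqrt_at_top])
  thus "(((\<lambda>u. E_fun (sqrt u)) \<circ> real_of_ereal) \<longlongrightarrow> 1) (at_left \<infinity>)"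
    by (simp add: ereal_tendsto_simps)
qed auto

section \<open>The function f of the theorem and its Fourier transform\<close>

definition nonhol_f :: "real \<Rightarrow> real \<Rightarrow> real" where
  "nonhol_f T s = pi * \<bar>s\<bar> * (1 - E_fun (\<bar>s\<bar> / sqrt T)) - sqrt T * exp (- pi * s\<^sup>2 / T)"

text \<open>T = l/(2 Im tau) is the single parameter that f shares with the Gaussians of the lattice
  sum, and \<open>E_fun\<close> in place of \<open>beta_fun\<close> provides derivatives.\<close>

lemma f_fun_eq:
  assumes "l \<ge> 1" "y > 0"
  shows "f_fun l t y = nonhol_f (real l / (2 * y)) t"
proof -
  have "sqrt (t\<^sup>2 * (2 * y / real l)) = \<bar>t\<bar> / sqrt (real l / (2 * y))"
    using assms by (simp add: real_sqrt_mult real_sqrt_divide)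
  moreover have "- pi * t\<^sup>2 * (2 * y / real l) = - pi * t\<^sup>2 / (real l / (2 * y))" by simp
  moreover have "t\<^sup>2 * (2 * y / real l) \<ge> 0" using assms by simp
  ultimately show ?thesis unfolding f_fun_def nonhol_f_def by (simp add: beta_fun_eq)
qed

lemma nonhol_f_minus [simp]: "nonhol_f T (- s) = nonhol_f T s"
  by (simp add: nonhol_f_def)

lemma abs_nonhol_f_le:
  assumes "T > 0"
  shows "\<bar>nonhol_f T s\<bar> \<le> (pi * \<bar>s\<bar> + sqrt T) * exp (- pi * s\<^sup>2 / T)"
proof -
  have "1 - E_fun (\<bar>s\<bar> / sqrt T) \<le> exp (- pi * s\<^sup>2 / T)"
    using one_minus_E_fun_le[of "\<bar>s\<bar> / sqrt T"] assms by (simp add: power_divide)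
  hence "pi * \<bar>s\<bar> * (1 - E_fun (\<bar>s\<bar> / sqrt T)) \<le> pi * \<bar>s\<bar> * exp (- pi * s\<^sup>2 / T)"
    by (intro mult_left_mono) auto
  moreover have "0 \<le> pi * \<bar>s\<bar> * (1 - E_fun (\<bar>s\<bar> / sqrt T))" using E_fun_le_1 by simp
  moreover have "0 \<le> sqrt T * exp (- pi * s\<^sup>2 / T)" using assms by simp
  moreover have "0 \<le> pi * \<bar>s\<bar> * exp (- pi * s\<^sup>2 / T)" by simp
  ultimately show ?thesis unfolding nonhol_f_def distrib_right by linarith
qed

lemma continuous_nonhol_f: "continuous_on S (nonhol_f T)"
  unfolding nonhol_f_def[abs_def]
  by (cases "T = 0") (auto intro!: continuous_intros simp: divide_inverse)

text \<open>Up to 2 pi, the transform of f is 1/c^2 minus its Gaussian-damped version, which is why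
  f measures the effect of the regularisation. On s >= 0 two integrations by parts lead from f to a
  Gaussian, because h' = h1 and h1' = h2. At 0 the terms h(0)/c of the two half-lines cancel, while
  the corner of pi |s| contributes 2 h1(0)/c^2 = 2 pi/c^2.\<close>

lemma tendsto_integral_nonhol_f:
  fixes c :: complex
  assumes T: "T > 0" and c: "c \<noteq> 0"
  shows "(\<lambda>N::nat. integral {- real N..real N} (\<lambda>s. of_real (nonhol_f T s) * exp (c * of_real s)))
     \<longlonglongrightarrow> 2 * of_real pi / c\<^sup>2 * (1 - exp (of_real T * c\<^sup>2 / (4 * of_real pi)))"
proof -
  define h where "h = (\<lambda>s. pi * s * (1 - E_fun (s / sqrt T)) - sqrt T * exp (- pi * s\<^sup>2 / T))"
  define h1 where "h1 = (\<lambda>s. pi * (1 - E_fun (s / sqrt T)))"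
  define h2 where "h2 = (\<lambda>s. - 2 * pi / sqrt T * exp (- pi * s\<^sup>2 / T))"
  have dh: "(h has_real_derivative h1 s) (at s within S)" for s S
    unfolding h_def h1_def using T
    by (auto intro!: derivative_eq_intros simp: power_divide field_simps power2_eq_square)
  have dh1: "(h1 has_real_derivative h2 s) (at s within S)" for s S
    unfolding h1_def h2_def using T
    by (auto intro!: derivative_eq_intros simp: power_divide field_simps)
  define \<Phi> where "\<Phi> = (\<lambda>(c :: complex) s. (of_real (h s) / c - of_real (h1 s) / c\<^sup>2) * exp (c * of_real s))"
  have ch: "continuous_on S h" "continuous_on S h1" "continuous_on S h2" for S
    using dh dh1 by (auto intro!: DERIV_continuous_on[of _ h] DERIV_continuous_on[of _ h1] continuous_intros simp: h2_def divide_inverse)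
  have half: "integral {0..real N} (\<lambda>s. of_real (h s) * exp (c * of_real s)) =
      \<Phi> c (real N) - \<Phi> c 0 + integral {0..real N} (\<lambda>s. of_real (h2 s) * exp (c * of_real s)) / c\<^sup>2"
    if c: "c \<noteq> 0" for c :: complex and N :: nat
  proof -
    have "((\<lambda>s. of_real (h s) * exp (c * of_real s) - of_real (h2 s) * exp (c * of_real s) / c\<^sup>2) has_integral (\<Phi> c (real N) - \<Phi> c 0)) {0..real N}"
    proof (rule fundamental_theorem_of_calculus)
      fix s assume "s \<in> {0..real N}"
      have d1: "((\<lambda>s. of_real (h s)) has_vector_derivative (of_real (h1 s) :: complex)) (at s within {0..real N})"
        using dh by (intro has_vector_derivative_of_real) (simp add: has_real_derivative_iff_has_vector_derivative)
      have d2: "((\<lambda>s. of_real (h1 s)) has_vector_derivative (of_real (h2 s) :: complex)) (at s within {0..real N})"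
        using dh1 by (intro has_vector_derivative_of_real) (simp add: has_real_derivative_iff_has_vector_derivative)
      have d3: "((\<lambda>s. exp (c * of_real s)) has_vector_derivative c * exp (c * of_real s)) (at s within {0..real N})"
      proof -
        have "((\<lambda>z. exp (c * z)) has_field_derivative c * exp (c * of_real s)) (at (of_real s))"
          by (auto intro!: derivative_eq_intros)
        thus ?thesis by (rule has_vector_derivative_real_field)
      qed
      show "(\<Phi> c has_vector_derivative of_real (h s) * exp (c * of_real s) - of_real (h2 s) * exp (c * of_real s) / c\<^sup>2) (at s within {0..real N})"
        unfolding \<Phi>_def
        by (rule has_vector_derivative_eq_rhs[OF has_vector_derivative_mult[OF has_vector_derivative_diff[OF has_vector_derivative_divide[OF d1] has_vector_derivative_divide[OF d2]] d3]])
           (use c in \<open>simp add: left_diff_distrib power2_eq_square\<close>)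
    qed simp
    moreover have "(\<lambda>s. of_real (h2 s) * exp (c * of_real s) / c\<^sup>2) integrable_on {0..real N}"
      using c by (intro integrable_continuous_interval continuous_intros ch) auto
    from has_integral_add[OF calculation integrable_integral[OF this]]
    have "((\<lambda>s. of_real (h s) * exp (c * of_real s)) has_integral (\<Phi> c (real N) - \<Phi> c 0 + integral {0..real N} (\<lambda>s. of_real (h2 s) * exp (c * of_real s) / c\<^sup>2))) {0..real N}"
      by simp
    thus ?thesis by (simp add: integral_unique)
  qed
  have f_h: "nonhol_f T s = h s" if "s \<ge> 0" for s using that by (simp add: nonhol_f_def h_def)
  have split: "integral {- real N..real N} (\<lambda>s. of_real (g s) * exp (c * of_real s)) =
     integral {0..real N} (\<lambda>s. of_real (g (- s)) * exp (- c * of_real s)) + integral {0..real N} (\<lambda>s. of_real (g s) * exp (c * of_real s))"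
    if "continuous_on UNIV g" for g :: "real \<Rightarrow> real" and N
  proof -
    have cg: "continuous_on S g" for S using that continuous_on_subset by blast
    have io: "(\<lambda>s. of_real (g s) * exp (c * of_real s)) integrable_on {- real N..real N}"
      by (intro integrable_continuous_interval continuous_intros cg)
    have "integral {- real N..0} (\<lambda>s. of_real (g s) * exp (c * of_real s)) = integral {0..real N} (\<lambda>s. of_real (g (- s)) * exp (- c * of_real s))"
      using Henstock_Kurzweil_Integration.integral_reflect_real[of "real N" 0 "\<lambda>s. of_real (g (- s)) * exp (- c * of_real s)"] by simp
    thus ?thesis
      using Henstock_Kurzweil_Integration.integral_combine[OF _ _ io, of 0] by simp
  qed
  have eq: "integral {- real N..real N} (\<lambda>s. of_real (nonhol_f T s) * exp (c * of_real s)) =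
     \<Phi> c (real N) + \<Phi> (- c) (real N) + 2 * of_real pi / c\<^sup>2
     - 2 * of_real pi / (of_real (sqrt T) * c\<^sup>2) * integral {- real N..real N} (\<lambda>s. exp (of_real (- pi * s\<^sup>2 / T) + c * of_real s))" for N
  proof -
    have e2: "integral {- real N..real N} (\<lambda>s. of_real (h2 s) * exp (c * of_real s)) =
       - 2 * of_real pi / of_real (sqrt T) * integral {- real N..real N} (\<lambda>s. exp (of_real (- pi * s\<^sup>2 / T) + c * of_real s))"
    proof -
      have "(\<lambda>s. of_real (h2 s) * exp (c * of_real s)) = (\<lambda>s. (- 2 * of_real pi / of_real (sqrt T)) * exp (of_real (- pi * s\<^sup>2 / T) + c * of_real s))"
        unfolding h2_def exp_add by (intro ext) (simp add: exp_of_real[symmetric])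
      thus ?thesis by (simp only: integral_mult_right)
    qed
    have m1: "integral {0..real N} (\<lambda>s. of_real (nonhol_f T (- s)) * exp (- c * of_real s)) = integral {0..real N} (\<lambda>s. of_real (h s) * exp (- c * of_real s))"
      by (intro Henstock_Kurzweil_Integration.integral_cong) (simp add: f_h)
    have m2: "integral {0..real N} (\<lambda>s. of_real (nonhol_f T s) * exp (c * of_real s)) = integral {0..real N} (\<lambda>s. of_real (h s) * exp (c * of_real s))"
      by (intro Henstock_Kurzweil_Integration.integral_cong) (simp add: f_h)
    have m3: "h2 (- s) = h2 s" for s by (simp add: h2_def)
    have "integral {- real N..real N} (\<lambda>s. of_real (nonhol_f T s) * exp (c * of_real s)) =
        (\<Phi> (- c) (real N) - \<Phi> (- c) 0 + integral {0..real N} (\<lambda>s. of_real (h2 s) * exp (- c * of_real s)) / c\<^sup>2) +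
        (\<Phi> c (real N) - \<Phi> c 0 + integral {0..real N} (\<lambda>s. of_real (h2 s) * exp (c * of_real s)) / c\<^sup>2)"
      using half[OF c, of N] half[of "- c" N] c
      unfolding split[OF continuous_nonhol_f, of N T] m1 m2 by (simp only: power2_minus neg_equal_0_iff_equal not_False_eq_True simp_thms)
    also have "\<dots> = \<Phi> c (real N) + \<Phi> (- c) (real N) - (\<Phi> c 0 + \<Phi> (- c) 0) +
        (integral {0..real N} (\<lambda>s. of_real (h2 (- s)) * exp (- c * of_real s)) + integral {0..real N} (\<lambda>s. of_real (h2 s) * exp (c * of_real s))) / c\<^sup>2"
      unfolding m3 by (simp add: add_divide_distrib)
    also have "integral {0..real N} (\<lambda>s. of_real (h2 (- s)) * exp (- c * of_real s)) + integral {0..real N} (\<lambda>s. of_real (h2 s) * exp (c * of_real s)) =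
        integral {- real N..real N} (\<lambda>s. of_real (h2 s) * exp (c * of_real s))"
      by (rule split[OF ch(3), symmetric])
    also have "\<Phi> c 0 + \<Phi> (- c) 0 = - 2 * of_real pi / c\<^sup>2"
      using c by (simp add: \<Phi>_def h1_def left_diff_distrib)
    finally show ?thesis unfolding e2 by (simp add: divide_inverse mult_ac)
  qed
  \<comment> \<open>At infinity h and h1 decay like exp(-pi s^2/T) up to an affine factor, which
    beats exp(|c| s): beyond s = (|c| + 1) T/pi the product of the two exponentials is at most
    exp(-s).\<close>
  have \<Phi>0: "(\<lambda>N. \<Phi> c (real N)) \<longlonglongrightarrow> 0" if c: "c \<noteq> 0" for c
  proof (rule Lim_null_comparison)
    show "(\<lambda>N::nat. (pi / norm c) * (real N * exp (- real N)) + (sqrt T / norm c + pi / (norm c)\<^sup>2) * exp (- real N)) \<longlonglongrightarrow> 0"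
    proof -
      have 1: "(\<lambda>N::nat. real N * exp (- real N)) \<longlonglongrightarrow> 0" by real_asymp
      have 2: "(\<lambda>N::nat. exp (- real N)) \<longlonglongrightarrow> 0" by real_asymp
      show ?thesis by (rule tendsto_add_zero[OF tendsto_mult_right_zero[OF 1] tendsto_mult_right_zero[OF 2]])
    qed
    have bnd: "norm (\<Phi> c s) \<le> ((pi * s + sqrt T) / norm c + pi / (norm c)\<^sup>2) * exp (- pi * s\<^sup>2 / T) * exp (norm c * s)" if s: "s \<ge> 0" for s
    proof -
      have 1: "\<bar>h s\<bar> \<le> (pi * s + sqrt T) * exp (- pi * s\<^sup>2 / T)"
        using abs_nonhol_f_le[OF T, of s] s by (simp add: f_h)
      have 2: "\<bar>h1 s\<bar> \<le> pi * exp (- pi * s\<^sup>2 / T)"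
        using one_minus_E_fun_le[of "s / sqrt T"] E_fun_le_1[of "s / sqrt T"] s T by (simp add: h1_def power_divide)
      have "norm (of_real (h s) / c - of_real (h1 s) / c\<^sup>2) \<le> \<bar>h s\<bar> / norm c + \<bar>h1 s\<bar> / (norm c)\<^sup>2"
        by (rule order.trans[OF norm_triangle_ineq4]) (simp add: norm_divide norm_power)
      also have "\<dots> \<le> ((pi * s + sqrt T) * exp (- pi * s\<^sup>2 / T)) / norm c + (pi * exp (- pi * s\<^sup>2 / T)) / (norm c)\<^sup>2"
        by (intro add_mono divide_right_mono 1 2) auto
      also have "\<dots> = ((pi * s + sqrt T) / norm c + pi / (norm c)\<^sup>2) * exp (- pi * s\<^sup>2 / T)"
        by (simp add: distrib_right)
      finally have 3: "norm (of_real (h s) / c - of_real (h1 s) / c\<^sup>2) \<le> \<dots>" .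
      have "Re c * s \<le> norm c * s" using s complex_Re_le_cmod by (intro mult_right_mono) auto
      hence "norm (exp (c * of_real s)) \<le> exp (norm c * s)" by simp
      from mult_mono[OF 3 this] T s show ?thesis by (simp add: \<Phi>_def norm_mult)
    qed
    have "\<forall>\<^sub>F N in sequentially. real N \<ge> (norm c + 1) * T / pi"
      by (rule eventually_at_top_linorder[THEN iffD2]) (auto intro!: exI[of _ "nat \<lceil>(norm c + 1) * T / pi\<rceil>"] simp: nat_ceiling_le_eq)
    thus "\<forall>\<^sub>F N in sequentially. norm (\<Phi> c (real N)) \<le> (pi / norm c) * (real N * exp (- real N)) + (sqrt T / norm c + pi / (norm c)\<^sup>2) * exp (- real N)"
    proof eventually_elim
      case (elim N)
      have "(norm c + 1) * real N \<le> (pi * real N / T) * real N"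
        using elim T by (intro mult_right_mono) (auto simp: field_simps)
      hence "- pi * (real N)\<^sup>2 / T + norm c * real N \<le> - real N" by (simp add: power2_eq_square algebra_simps)
      hence "exp (- pi * (real N)\<^sup>2 / T) * exp (norm c * real N) \<le> exp (- real N)" by (simp flip: exp_add)
      hence "((pi * real N + sqrt T) / norm c + pi / (norm c)\<^sup>2) * (exp (- pi * (real N)\<^sup>2 / T) * exp (norm c * real N))
         \<le> ((pi * real N + sqrt T) / norm c + pi / (norm c)\<^sup>2) * exp (- real N)"
        using T by (intro mult_left_mono) auto
      with bnd[of "real N"] show ?case by (simp add: algebra_simps add_divide_distrib)
    qed
  qed
  have "(\<lambda>N. integral {- real N..real N} (\<lambda>s. of_real (nonhol_f T s) * exp (c * of_real s))) \<longlonglongrightarrow>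
     0 + 0 + 2 * of_real pi / c\<^sup>2 - 2 * of_real pi / (of_real (sqrt T) * c\<^sup>2) * (of_real (sqrt T) * exp (of_real T * c\<^sup>2 / (4 * of_real pi)))"
    unfolding eq using c by (intro tendsto_intros \<Phi>0 tendsto_integral_gauss_complex[OF T]) auto
  moreover have "0 + 0 + 2 * of_real pi / c\<^sup>2 - 2 * of_real pi / (of_real (sqrt T) * c\<^sup>2) * (of_real (sqrt T) * exp (of_real T * c\<^sup>2 / (4 * of_real pi))) =
     2 * of_real pi / c\<^sup>2 * (1 - exp (of_real T * c\<^sup>2 / (4 * of_real pi)))"
    using T c by (simp add: field_simps)
  ultimately show ?thesis by simp
qed

lemma summable_on_int_gauss_shift:
  assumes "a > 0" "A \<ge> 0" "B \<ge> 0"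
  shows "(\<lambda>n::int. (A * \<bar>real_of_int n + c\<bar> + B) * exp (b * \<bar>real_of_int n + c\<bar> - a * (real_of_int n + c)\<^sup>2)) summable_on UNIV"
proof (rule summable_on_comparison_test)
  \<comment> \<open>The 1 pays for the affine factor, by |v| <= exp |v| and 1 <= exp |v|; the
    summand 2 a |c| pays for the cross term when (n + c)^2 is compared with n^2.\<close>
  define b' where "b' = \<bar>b\<bar> + 1 + 2 * a * \<bar>c\<bar>"
  show "(\<lambda>n::int. ((A + B) * exp (b' * \<bar>c\<bar>)) * exp (b' * \<bar>real_of_int n\<bar> - a * (real_of_int n)\<^sup>2)) summable_on UNIV"
    by (intro summable_on_cmult_right summable_on_int_gauss assms)
  fix n :: int
  define m where "m = real_of_int n"
  define C where "C = \<bar>c\<bar>"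
  have e: "\<bar>m + c\<bar> \<le> exp \<bar>m + c\<bar>" "1 \<le> exp \<bar>m + c\<bar>"
    using exp_ge_add_one_self[of "\<bar>m + c\<bar>"] by linarith+
  have "A * \<bar>m + c\<bar> + B \<le> A * exp \<bar>m + c\<bar> + B * exp \<bar>m + c\<bar>"
    using mult_left_mono[OF e(1) assms(2)] mult_left_mono[OF e(2) assms(3)] by simp
  hence "(A * \<bar>m + c\<bar> + B) * exp (b * \<bar>m + c\<bar> - a * (m + c)\<^sup>2) \<le> ((A + B) * exp \<bar>m + c\<bar>) * exp (b * \<bar>m + c\<bar> - a * (m + c)\<^sup>2)"
    by (intro mult_right_mono) (auto simp: distrib_right)
  also have "\<dots> = (A + B) * exp (\<bar>m + c\<bar> + b * \<bar>m + c\<bar> - a * (m + c)\<^sup>2)"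
    by (simp flip: exp_add add: algebra_simps)
  also have "\<dots> \<le> (A + B) * exp (b' * \<bar>c\<bar> + (b' * \<bar>m\<bar> - a * m\<^sup>2))"
  proof (intro mult_left_mono iffD2[OF exp_le_cancel_iff])
    have "(1 + b) * \<bar>m + c\<bar> \<le> (1 + \<bar>b\<bar>) * (\<bar>m\<bar> + C)"
      by (intro mult_mono) (auto simp: C_def)
    moreover have "- (a * (m + c)\<^sup>2) \<le> - a * m\<^sup>2 + 2 * a * C * \<bar>m\<bar>"
    proof -
      have "- (2 * a * (m * c)) \<le> 2 * a * (C * \<bar>m\<bar>)"
        using assms(1) mult_left_mono[of "- (m * c)" "C * \<bar>m\<bar>" "2 * a"] abs_ge_minus_self[of "m * c"] by (simp add: abs_mult mult_ac C_def)
      moreover have "0 \<le> a * c\<^sup>2" using assms by simp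
      ultimately show ?thesis by (simp add: power2_sum algebra_simps)
    qed
    moreover have "0 \<le> 2 * a * C * C" using assms by (simp add: C_def)
    ultimately show "\<bar>m + c\<bar> + b * \<bar>m + c\<bar> - a * (m + c)\<^sup>2 \<le> b' * \<bar>c\<bar> + (b' * \<bar>m\<bar> - a * m\<^sup>2)"
      by (simp add: b'_def algebra_simps flip: C_def)
  qed (use assms in auto)
  finally show "(A * \<bar>real_of_int n + c\<bar> + B) * exp (b * \<bar>real_of_int n + c\<bar> - a * (real_of_int n + c)\<^sup>2)
      \<le> ((A + B) * exp (b' * \<bar>c\<bar>)) * exp (b' * \<bar>real_of_int n\<bar> - a * (real_of_int n)\<^sup>2)"
    by (simp only: m_def exp_add mult.assoc)
qed (use assms in auto)

subsection \<open>A Gaussian-regularised Lipschitz formula\<close>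

lemma summable_on_inverse_square_int:
  fixes z :: complex
  assumes "z \<notin> \<int>"
  shows "(\<lambda>n::int. 1 / (norm (z + of_int n))\<^sup>2) summable_on UNIV"
proof -
  obtain K where "K > 0" "\<And>n::int. 1 / (norm (z + of_int n))\<^sup>2 \<le> K * (1 / (1 + (real_of_int n)\<^sup>2))"
    using norm_add_int_sq_bound[OF assms] by blast
  thus ?thesis
    by (intro summable_on_comparison_test[OF summable_on_cmult_right[OF summable_on_int_inverse_square, of K]]) auto
qed

lemma exp_eq_1_imp_Ints: "exp (2 * of_real pi * \<i> * z) = 1 \<Longrightarrow> z \<in> \<int>"
  by (auto simp: exp_eq_1 complex_is_Int_iff)

lemma exp_of_int_2pi_i [simp]: "exp (2 * of_real pi * \<i> * of_int n) = 1"
  by (auto simp: exp_eq_1)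

text \<open>The function g(s) = -4 pi^2 e^(-2 pi i s z) (alpha - s beta) on [0, 1] has the Fourier
  coefficients 1/(z + n)^2, so the sum is its Fourier series at theta. Since z may be any complex
  number that is not an integer, one formula serves both half-planes and also the real point z = -r
  of the row m = p.\<close>

lemma infsum_lipschitz_closed:
  fixes z :: complex
  assumes z: "z \<notin> \<int>" and \<theta>: "0 \<le> \<theta>" "\<theta> \<le> 1"
  defines "X \<equiv> exp (2 * of_real pi * \<i> * z)"
  shows "(\<Sum>\<^sub>\<infinity>n::int. cis (2 * pi * of_int n * \<theta>) / (z + of_int n)\<^sup>2) =
    - 4 * (of_real pi)\<^sup>2 * exp (- 2 * of_real pi * \<i> * of_real \<theta> * z) * (X / (1 - X)\<^sup>2 - of_real \<theta> * X / (1 - X))"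
proof -
  define \<alpha> where "\<alpha> = X / (1 - X)\<^sup>2"
  define \<beta> where "\<beta> = X / (1 - X)"
  define g where "g = (\<lambda>s. - 4 * (of_real pi)\<^sup>2 * (exp (- 2 * of_real pi * \<i> * of_real s * z) * (\<alpha> - of_real s * \<beta>)))"
  have X1: "X \<noteq> 1" using exp_eq_1_imp_Ints[of z] z by (auto simp: X_def)
  have X0: "X \<noteq> 0" by (simp add: X_def)
  \<comment> \<open>This is the matching condition g 0 = g 1. Together with beta (1 - X) = X it
    makes the boundary terms of the integration collapse to 1/c^2.\<close>
  have ab: "\<alpha> - \<beta> = X * \<alpha>"
    using X1 by (simp add: \<alpha>_def \<beta>_def divide_simps power2_eq_square) (simp add: algebra_simps)
  have bX: "\<beta> - X * \<beta> = X"
  proof -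
    have "\<beta> - X * \<beta> = (1 - X) * \<beta>" by (simp add: algebra_simps)
    thus ?thesis using X1 by (simp add: \<beta>_def)
  qed
  have zn: "z + of_int n \<noteq> 0" for n
    using z by (metis Ints_minus Ints_of_int add_eq_0_iff minus_minus)
  have coeff: "integral {0..1} (\<lambda>s. g s * cis (- 2 * pi * of_int n * s)) = 1 / (z + of_int n)\<^sup>2" for n
  proof -
    define c where "c = - 2 * of_real pi * \<i> * (z + of_int n)"
    have c0: "c \<noteq> 0" using zn by (simp add: c_def)
    have c2: "c\<^sup>2 = - 4 * (of_real pi)\<^sup>2 * (z + of_int n)\<^sup>2"
      unfolding c_def by (simp add: power_mult_distrib)
    have ec: "exp c = 1 / X"
    proof -
      have "c = - (2 * of_real pi * \<i> * z) + 2 * of_real pi * \<i> * of_int (- n)" by (simp add: c_def algebra_simps)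
      thus ?thesis unfolding X_def by (simp only: exp_add exp_of_int_2pi_i exp_minus inverse_eq_divide mult_1_right)
    qed
    define \<Phi> where "\<Phi> = (\<lambda>w. exp (c * w) * ((\<alpha> - w * \<beta>) / c + \<beta> / c\<^sup>2))"
    have "((\<lambda>s. exp (c * of_real s) * (\<alpha> - of_real s * \<beta>)) has_integral (\<Phi> (of_real 1) - \<Phi> (of_real 0))) {0..1}"
    proof (rule fundamental_theorem_of_calculus)
      fix s :: real
      have "(\<Phi> has_field_derivative exp (c * of_real s) * (\<alpha> - of_real s * \<beta>)) (at (of_real s))"
        unfolding \<Phi>_def using c0
        by (auto intro!: derivative_eq_intros simp: field_simps power2_eq_square)
      thus "((\<lambda>s. \<Phi> (of_real s)) has_vector_derivative exp (c * of_real s) * (\<alpha> - of_real s * \<beta>)) (at s within {0..1})"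
        by (rule has_vector_derivative_real_field)
    qed simp
    moreover have "\<Phi> (of_real 1) - \<Phi> (of_real 0) = 1 / c\<^sup>2"
    proof -
      have "\<Phi> (of_real 1) - \<Phi> (of_real 0) = 1 / X * ((X * \<alpha>) / c + \<beta> / c\<^sup>2) - (\<alpha> / c + \<beta> / c\<^sup>2)"
        by (simp add: \<Phi>_def ec ab)
      also have "\<dots> = (\<beta> - X * \<beta>) / X / c\<^sup>2"
        using X0 c0 by (simp add: field_simps)
      finally show ?thesis using X0 by (simp add: bX)
    qed
    ultimately have 1: "((\<lambda>s. exp (c * of_real s) * (\<alpha> - of_real s * \<beta>)) has_integral 1 / c\<^sup>2) {0..1}" by simp
    have "g s * cis (- 2 * pi * of_int n * s) = - 4 * (of_real pi)\<^sup>2 * (exp (c * of_real s) * (\<alpha> - of_real s * \<beta>))" for s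
    proof -
      have "exp (c * of_real s) = exp (- 2 * of_real pi * \<i> * of_real s * z) * cis (- 2 * pi * of_int n * s)"
        unfolding cis_conv_exp exp_add[symmetric] by (simp add: c_def algebra_simps)
      thus ?thesis by (simp add: g_def)
    qed
    hence "((\<lambda>s. g s * cis (- 2 * pi * of_int n * s)) has_integral - 4 * (of_real pi)\<^sup>2 * (1 / c\<^sup>2)) {0..1}"
      using has_integral_mult_right[OF 1, of "- 4 * (of_real pi)\<^sup>2"] by (simp only:)
    hence "integral {0..1} (\<lambda>s. g s * cis (- 2 * pi * of_int n * s)) = - 4 * (of_real pi)\<^sup>2 * (1 / c\<^sup>2)"
      by (rule integral_unique)
    thus ?thesis using zn[of n] by (simp add: c2)
  qed
  have cg: "continuous_on {0..1} g"
    unfolding g_def by (intro continuous_intros)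
  have per: "g 0 = g 1"
  proof -
    have "exp (- 2 * of_real pi * \<i> * of_real 1 * z) = 1 / X"
      by (simp add: X_def exp_minus inverse_eq_divide)
    thus ?thesis using X0 by (simp add: g_def ab)
  qed
  have summ: "(\<lambda>n. norm (integral {0..1} (\<lambda>s. g s * cis (- 2 * pi * of_int n * s)))) summable_on UNIV"
    using summable_on_inverse_square_int[OF z] by (simp only: coeff norm_divide norm_power norm_one)
  from fourier_series_at[OF cg per summ \<theta>] show ?thesis
    by (simp only: coeff) (simp add: g_def \<alpha>_def \<beta>_def mult.assoc)
qed

text \<open>In the upper half-plane |X| < 1, so the closed form expands into the series of (n + 1 -
  theta) X^(n + 1). As theta is the fractional part of kappa, the indices k = floor(kappa) + 1 + n
  are precisely the integers above kappa.\<close>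

lemma has_sum_lipschitz_upper:
  fixes z :: complex
  assumes z: "Im z > 0"
  shows "((\<lambda>k::int. of_real (of_int k - \<kappa>) * exp (2 * of_real pi * \<i> * of_real (of_int k - \<kappa>) * z)) has_sum
     (- 1 / (4 * (of_real pi)\<^sup>2) * (\<Sum>\<^sub>\<infinity>n::int. cis (2 * pi * of_int n * \<kappa>) / (z + of_int n)\<^sup>2))) {k. of_int k > \<kappa>}"
proof -
  define \<theta> where "\<theta> = \<kappa> - of_int \<lfloor>\<kappa>\<rfloor>"
  define X where "X = exp (2 * of_real pi * \<i> * z)"
  have \<theta>: "0 \<le> \<theta>" "\<theta> < 1" unfolding \<theta>_def by linarith+
  have zi: "z \<notin> \<int>" using z by (auto simp: complex_is_Int_iff)
  have nX: "norm X < 1" using z by (simp add: X_def)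
  hence X1: "X \<noteq> 1" by auto
  have "(\<lambda>n. of_nat n * X ^ n) sums (X / (1 - X)\<^sup>2)"
  proof -
    have "(\<lambda>n. of_nat (Suc n) * X ^ n) sums (1 / (1 - X)\<^sup>2)"
      by (rule geometric_deriv_sums[OF nX])
    from sums_mult[OF this, of X] have "(\<lambda>n. of_nat (Suc n) * X ^ Suc n) sums (X / (1 - X)\<^sup>2)"
      by (simp add: mult_ac)
    thus ?thesis by (subst (asm) sums_Suc_iff) simp
  qed
  hence s1: "(\<lambda>n. of_nat (Suc n) * X ^ Suc n) sums (X / (1 - X)\<^sup>2)"
    by (subst sums_Suc_iff) simp
  have s2: "(\<lambda>n. of_real \<theta> * X ^ Suc n) sums (of_real \<theta> * (X / (1 - X)))"
    using sums_mult[OF sums_mult[OF geometric_sums[OF nX], of X], of "of_real \<theta>"] by simp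
  have s3: "(\<lambda>n. of_real (real (Suc n) - \<theta>) * X ^ Suc n) sums (X / (1 - X)\<^sup>2 - of_real \<theta> * X / (1 - X))"
    using sums_diff[OF s1 s2] by (simp add: algebra_simps)
  have summ: "summable (\<lambda>n. norm (of_real (real (Suc n) - \<theta>) * X ^ Suc n))"
  proof (rule summable_comparison_test')
    show "summable (\<lambda>n. of_nat (Suc n) * norm X ^ n)"
      using geometric_deriv_sums[of "norm X"] nX by (auto simp: sums_iff)
    show "norm (norm (of_real (real (Suc n) - \<theta>) * X ^ Suc n)) \<le> of_nat (Suc n) * norm X ^ n" for n
    proof -
      have "\<bar>real (Suc n) - \<theta>\<bar> \<le> real (Suc n)" using \<theta> by simp
      moreover have "norm X ^ Suc n \<le> norm X ^ n" using nX by (intro power_decreasing) auto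
      ultimately have "norm (of_real (real (Suc n) - \<theta>) * X ^ Suc n) \<le> of_nat (Suc n) * norm X ^ n"
        unfolding norm_mult norm_power norm_of_real by (intro mult_mono) auto
      thus ?thesis by (simp only: real_norm_def abs_norm_cancel)
    qed
  qed
  have hs: "((\<lambda>n. of_real (real (Suc n) - \<theta>) * X ^ Suc n) has_sum (X / (1 - X)\<^sup>2 - of_real \<theta> * X / (1 - X))) UNIV"
    using summ s3 by (rule norm_summable_imp_has_sum)
  define E where "E = exp (- 2 * of_real pi * \<i> * of_real \<theta> * z)"
  have "((\<lambda>n. E * (of_real (real (Suc n) - \<theta>) * X ^ Suc n)) has_sum (E * (X / (1 - X)\<^sup>2 - of_real \<theta> * X / (1 - X)))) UNIV"
    by (rule has_sum_cmult_right[OF hs])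
  also have "E * (X / (1 - X)\<^sup>2 - of_real \<theta> * X / (1 - X)) = - 1 / (4 * (of_real pi)\<^sup>2) * (\<Sum>\<^sub>\<infinity>n::int. cis (2 * pi * of_int n * \<theta>) / (z + of_int n)\<^sup>2)"
    using infsum_lipschitz_closed[OF zi, of \<theta>] \<theta> by (simp add: E_def X_def)
  also have "(\<lambda>n::int. cis (2 * pi * of_int n * \<theta>) / (z + of_int n)\<^sup>2) = (\<lambda>n. cis (2 * pi * of_int n * \<kappa>) / (z + of_int n)\<^sup>2)"
  proof
    fix n :: int
    have "cis (2 * pi * of_int n * \<kappa>) = cis (2 * pi * of_int n * \<theta>) * cis (2 * pi * of_int (n * \<lfloor>\<kappa>\<rfloor>))"
      by (simp add: cis_mult \<theta>_def algebra_simps)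
    also have "cis (2 * pi * of_int (n * \<lfloor>\<kappa>\<rfloor>)) = 1" by (rule cis_multiple_2pi) simp
    finally show "cis (2 * pi * of_int n * \<theta>) / (z + of_int n)\<^sup>2 = cis (2 * pi * of_int n * \<kappa>) / (z + of_int n)\<^sup>2" by simp
  qed
  finally have fin: "((\<lambda>n. E * (of_real (real (Suc n) - \<theta>) * X ^ Suc n)) has_sum
    (- 1 / (4 * (of_real pi)\<^sup>2) * (\<Sum>\<^sub>\<infinity>n::int. cis (2 * pi * of_int n * \<kappa>) / (z + of_int n)\<^sup>2))) UNIV" .
  have tm: "E * (of_real (real (Suc n) - \<theta>) * X ^ Suc n) =
     of_real (of_int (\<lfloor>\<kappa>\<rfloor> + 1 + int n) - \<kappa>) * exp (2 * of_real pi * \<i> * of_real (of_int (\<lfloor>\<kappa>\<rfloor> + 1 + int n) - \<kappa>) * z)" for n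
  proof -
    have 1: "of_int (\<lfloor>\<kappa>\<rfloor> + 1 + int n) - \<kappa> = real (Suc n) - \<theta>" by (simp add: \<theta>_def)
    have "E * X ^ Suc n = exp (2 * of_real pi * \<i> * of_real (real (Suc n) - \<theta>) * z)"
      unfolding E_def X_def exp_of_nat_mult[symmetric] exp_add[symmetric] by (simp add: algebra_simps)
    moreover have "E * (of_real (real (Suc n) - \<theta>) * X ^ Suc n) = of_real (real (Suc n) - \<theta>) * (E * X ^ Suc n)"
      by (simp only: mult_ac)
    ultimately show ?thesis unfolding 1 by simp
  qed
  show ?thesis
    using fin unfolding tm
  proof (rule has_sum_reindex_bij_witness[of _ "\<lambda>k. nat (k - \<lfloor>\<kappa>\<rfloor> - 1)" "\<lambda>n. \<lfloor>\<kappa>\<rfloor> + 1 + int n", THEN iffD1, rotated -1])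
  qed (auto simp: floor_less_iff less_floor_iff, linarith+)
qed

text \<open>The reflection z -> -z, n -> -n, kappa -> -kappa leads back to the upper half-plane; the
  odd factor k - kappa accounts for the opposite sign.\<close>

lemma has_sum_lipschitz_lower:
  fixes z :: complex
  assumes z: "Im z < 0"
  shows "((\<lambda>k::int. of_real (of_int k - \<kappa>) * exp (2 * of_real pi * \<i> * of_real (of_int k - \<kappa>) * z)) has_sum
     (1 / (4 * (of_real pi)\<^sup>2) * (\<Sum>\<^sub>\<infinity>n::int. cis (2 * pi * of_int n * \<kappa>) / (z + of_int n)\<^sup>2))) {k. of_int k < \<kappa>}"
proof -
  have s: "(\<Sum>\<^sub>\<infinity>n::int. cis (2 * pi * of_int n * (- \<kappa>)) / (- z + of_int n)\<^sup>2) = (\<Sum>\<^sub>\<infinity>n::int. cis (2 * pi * of_int n * \<kappa>) / (z + of_int n)\<^sup>2)"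
  proof (rule infsum_reindex_bij_witness[of _ uminus uminus])
    fix n :: int
    have "(- z + of_int n)\<^sup>2 = (z + of_int (- n))\<^sup>2" by (simp add: power2_eq_square algebra_simps)
    thus "cis (2 * pi * of_int (- n) * \<kappa>) / (z + of_int (- n))\<^sup>2 = cis (2 * pi * of_int n * (- \<kappa>)) / (- z + of_int n)\<^sup>2" by simp
  qed auto
  have "((\<lambda>k::int. - (of_real (of_int k - - \<kappa>) * exp (2 * of_real pi * \<i> * of_real (of_int k - - \<kappa>) * - z))) has_sum
     - (- 1 / (4 * (of_real pi)\<^sup>2) * (\<Sum>\<^sub>\<infinity>n::int. cis (2 * pi * of_int n * (- \<kappa>)) / (- z + of_int n)\<^sup>2))) {k. of_int k > - \<kappa>}"
    using has_sum_lipschitz_upper[of "- z" "- \<kappa>"] z by (intro has_sum_uminus[THEN iffD2]) auto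
  thus ?thesis unfolding s
    by (rule has_sum_reindex_bij_witness[of _ uminus uminus, THEN iffD1, rotated -1]) (auto simp: algebra_simps)
qed

text \<open>Poisson summation at -kappa for F(s) = 2 pi f(s) e^(2 pi i s z): the transform at n is
  (exp(-pi T (z - n)^2) - 1)/(z - n)^2, the damped summand minus the plain one. Each of the two is
  summable by itself because z is not an integer.\<close>

lemma infsum_gauss_dual:
  fixes z :: complex
  assumes z: "z \<notin> \<int>" and T: "T > 0"
  shows "(\<Sum>\<^sub>\<infinity>n::int. cis (2 * pi * of_int n * \<kappa>) * exp (- of_real (pi * T) * (z + of_int n)\<^sup>2) / (z + of_int n)\<^sup>2) =
    (\<Sum>\<^sub>\<infinity>n::int. cis (2 * pi * of_int n * \<kappa>) / (z + of_int n)\<^sup>2) +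
    2 * of_real pi * (\<Sum>\<^sub>\<infinity>k::int. of_real (nonhol_f T (of_int k - \<kappa>)) * exp (2 * of_real pi * \<i> * of_real (of_int k - \<kappa>) * z))"
proof -
  define F where "F = (\<lambda>s. 2 * of_real pi * (of_real (nonhol_f T s) * exp (2 * of_real pi * \<i> * of_real s * z)))"
  define Fh where "Fh = (\<lambda>n::int. (exp (- of_real (pi * T) * (z - of_int n)\<^sup>2) - 1) / (z - of_int n)\<^sup>2)"
  have zn: "z - of_int n \<noteq> 0" for n using z by auto
  define v where "v = \<bar>Im z\<bar>"
  \<comment> \<open>For s in [0, 1], |k + s| <= |k| + 1 and (k + s)^2 >= k^2/2 - 1; the factor exp(2
    pi v + pi/T) collects what these two estimates lose in the exponent.\<close>
  define B where "B = (\<lambda>k::int. 2 * pi * exp (2 * pi * v + pi / T) * ((pi * \<bar>of_int k + 0\<bar> + (pi + sqrt T)) * exp ((2 * pi * v) * \<bar>of_int k + 0\<bar> - (pi / (2 * T)) * (of_int k + 0)\<^sup>2)))"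
  have "(\<Sum>\<^sub>\<infinity>k::int. F (of_int k + (- \<kappa>))) = (\<Sum>\<^sub>\<infinity>n. Fh n * cis (2 * pi * of_int n * (- \<kappa>)))"
  proof (rule poisson_summation)
    show "continuous_on UNIV F" unfolding F_def by (intro continuous_intros continuous_nonhol_f)
    show "B summable_on UNIV"
      unfolding B_def using T by (intro summable_on_cmult_right summable_on_int_gauss_shift) auto
    show "norm (F (of_int k + s)) \<le> B k" if s: "s \<in> {0..1}" for k :: int and s
    proof -
      define r where "r = real_of_int k + s"
      have r: "\<bar>r\<bar> \<le> \<bar>real_of_int k\<bar> + 1" using s by (auto simp: r_def)
      have r2: "(real_of_int k)\<^sup>2 / 2 - 1 \<le> r\<^sup>2"
      proof -
        have "0 \<le> (real_of_int k + 2 * s)\<^sup>2 / 2" by simp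
        moreover have "s\<^sup>2 \<le> 1" using s by (auto simp: power_le_one)
        ultimately show ?thesis by (simp add: r_def power2_eq_square algebra_simps)
      qed
      have "norm (F r) = 2 * pi * (\<bar>nonhol_f T r\<bar> * exp (- (2 * pi * r * Im z)))"
        by (simp add: F_def norm_mult)
      also have "\<dots> \<le> 2 * pi * (((pi * \<bar>r\<bar> + sqrt T) * exp (- pi * r\<^sup>2 / T)) * exp (2 * pi * v * \<bar>r\<bar>))"
      proof (intro mult_left_mono mult_mono abs_nonhol_f_le T iffD2[OF exp_le_cancel_iff])
        have "- (r * Im z) \<le> \<bar>r * Im z\<bar>" by linarith
        thus "- (2 * pi * r * Im z) \<le> 2 * pi * v * \<bar>r\<bar>"
          by (simp add: v_def abs_mult mult_ac) (metis mult.commute mult_left_mono mult_minus_right pi_ge_zero)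
      qed (use T in auto)
      also have "\<dots> = 2 * pi * ((pi * \<bar>r\<bar> + sqrt T) * exp (2 * pi * v * \<bar>r\<bar> - pi * r\<^sup>2 / T))"
        by (simp add: exp_diff exp_minus field_simps)
      also have "\<dots> \<le> 2 * pi * ((pi * (\<bar>real_of_int k\<bar> + 1) + sqrt T) * exp (2 * pi * v * (\<bar>real_of_int k\<bar> + 1) - pi * ((real_of_int k)\<^sup>2 / 2 - 1) / T))"
        using r r2 T by (intro mult_left_mono mult_mono iffD2[OF exp_le_cancel_iff] diff_mono add_mono divide_right_mono)
            (auto simp: v_def)
      also have "\<dots> = B k"
      proof -
        have "2 * pi * v * (\<bar>real_of_int k\<bar> + 1) - pi * ((real_of_int k)\<^sup>2 / 2 - 1) / T =
           (2 * pi * v + pi / T) + ((2 * pi * v) * \<bar>real_of_int k\<bar> - (pi / (2 * T)) * (real_of_int k)\<^sup>2)"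
          using T by (simp add: field_simps)
        thus ?thesis unfolding B_def by (simp only: exp_add) (simp add: algebra_simps)
      qed
      finally show ?thesis by (simp add: r_def)
    qed
    show "(\<lambda>N::nat. integral {- real N..real N} (\<lambda>s. F s * cis (- 2 * pi * of_int n * s))) \<longlonglongrightarrow> Fh n" for n
    proof -
      define c where "c = 2 * of_real pi * \<i> * (z - of_int n)"
      define w where "w = z - of_int n"
      have w0: "w \<noteq> 0" using zn by (simp add: w_def)
      have c0: "c \<noteq> 0" using zn by (simp add: c_def)
      have c2: "c\<^sup>2 = - 4 * (of_real pi)\<^sup>2 * w\<^sup>2" by (simp add: c_def w_def power_mult_distrib)
      have "F s * cis (- 2 * pi * of_int n * s) = 2 * of_real pi * (of_real (nonhol_f T s) * exp (c * of_real s))" for s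
      proof -
        have "exp (c * of_real s) = exp (2 * of_real pi * \<i> * of_real s * z) * cis (- 2 * pi * of_int n * s)"
          unfolding cis_conv_exp exp_add[symmetric] by (simp add: c_def algebra_simps)
        thus ?thesis by (simp add: F_def)
      qed
      moreover have "2 * of_real pi * (2 * of_real pi / c\<^sup>2 * (1 - exp (of_real T * c\<^sup>2 / (4 * of_real pi)))) = Fh n"
      proof -
        have "of_real T * c\<^sup>2 / (4 * of_real pi) = - of_real (pi * T) * w\<^sup>2"
          unfolding c2 by (simp add: power2_eq_square field_simps)
        moreover have "Fh n = (exp (- of_real (pi * T) * w\<^sup>2) - 1) / w\<^sup>2" by (simp add: Fh_def w_def)
        moreover have "2 * of_real pi * (2 * of_real pi / (- 4 * (of_real pi)\<^sup>2 * w\<^sup>2) * (1 - e)) = (e - 1) / w\<^sup>2" for e :: complex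
          using w0 by (simp add: power2_eq_square field_simps)
        ultimately show ?thesis by (simp only: c2)
      qed
      ultimately show ?thesis
        using tendsto_mult_left[OF tendsto_integral_nonhol_f[OF T c0], of "2 * of_real pi"]
        by (simp only: integral_mult_right)
    qed
    show "(\<lambda>n. norm (Fh n)) summable_on UNIV"
    proof -
      obtain K where K: "K > 0" "\<And>n::int. 1 / (norm (z + of_int n))\<^sup>2 \<le> K * (1 / (1 + (real_of_int n)\<^sup>2))"
        using norm_add_int_sq_bound[OF z] by blast
      show ?thesis
      proof (rule summable_on_comparison_test)
        show "(\<lambda>n::int. (exp (pi * T * v\<^sup>2) + 1) * (K * (1 / (1 + (real_of_int n)\<^sup>2)))) summable_on UNIV"
          by (intro summable_on_cmult_right summable_on_int_inverse_square)
        fix n :: int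
        have "norm (exp (- of_real (pi * T) * (z - of_int n)\<^sup>2)) \<le> exp (pi * T * v\<^sup>2)"
        proof -
          have m1: "Re ((z - of_int n)\<^sup>2) = (Re z - of_int n)\<^sup>2 - v\<^sup>2" by (simp add: power2_eq_square v_def)
          have m2: "Re (- of_real (pi * T) * (z - of_int n)\<^sup>2) = - (pi * T) * Re ((z - of_int n)\<^sup>2)" by simp
          have "Re (- of_real (pi * T) * (z - of_int n)\<^sup>2) = pi * T * v\<^sup>2 - pi * T * (Re z - of_int n)\<^sup>2"
            unfolding m2 m1 by (simp add: algebra_simps)
          thus ?thesis using T by simp
        qed
        hence "norm (exp (- of_real (pi * T) * (z - of_int n)\<^sup>2) - 1) \<le> exp (pi * T * v\<^sup>2) + 1"
          using norm_triangle_ineq4[of "exp (- of_real (pi * T) * (z - of_int n)\<^sup>2)" 1] unfolding norm_one by linarith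
        moreover have "1 / (norm (z - of_int n))\<^sup>2 \<le> K * (1 / (1 + (real_of_int n)\<^sup>2))"
          using K(2)[of "- n"] by simp
        ultimately have "norm (exp (- of_real (pi * T) * (z - of_int n)\<^sup>2) - 1) * (1 / (norm (z - of_int n))\<^sup>2) \<le> (exp (pi * T * v\<^sup>2) + 1) * (K * (1 / (1 + (real_of_int n)\<^sup>2)))"
          by (intro mult_mono) auto
        thus "norm (Fh n) \<le> (exp (pi * T * v\<^sup>2) + 1) * (K * (1 / (1 + (real_of_int n)\<^sup>2)))"
          by (simp add: Fh_def norm_divide norm_power)
      qed simp
    qed
  qed
  also have "(\<Sum>\<^sub>\<infinity>n. Fh n * cis (2 * pi * of_int n * (- \<kappa>))) =
     (\<Sum>\<^sub>\<infinity>n::int. cis (2 * pi * of_int n * \<kappa>) * exp (- of_real (pi * T) * (z + of_int n)\<^sup>2) / (z + of_int n)\<^sup>2 - cis (2 * pi * of_int n * \<kappa>) / (z + of_int n)\<^sup>2)"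
    by (rule infsum_reindex_bij_witness[of _ uminus uminus]) (auto simp: Fh_def field_simps diff_divide_distrib)
  also have "\<dots> = (\<Sum>\<^sub>\<infinity>n::int. cis (2 * pi * of_int n * \<kappa>) * exp (- of_real (pi * T) * (z + of_int n)\<^sup>2) / (z + of_int n)\<^sup>2) - (\<Sum>\<^sub>\<infinity>n::int. cis (2 * pi * of_int n * \<kappa>) / (z + of_int n)\<^sup>2)"
  proof -
    have s2: "(\<lambda>n::int. cis (2 * pi * of_int n * \<kappa>) / (z + of_int n)\<^sup>2) summable_on UNIV"
      by (rule abs_summable_summable) (use summable_on_inverse_square_int[OF z] in \<open>simp add: norm_divide norm_power\<close>)
    have s1: "(\<lambda>n::int. cis (2 * pi * of_int n * \<kappa>) * exp (- of_real (pi * T) * (z + of_int n)\<^sup>2) / (z + of_int n)\<^sup>2) summable_on UNIV"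
    proof (rule abs_summable_summable, rule Infinite_Sum.abs_summable_on_comparison_test')
      show "(\<lambda>n::int. exp (pi * T * v\<^sup>2) * (1 / (norm (z + of_int n))\<^sup>2)) summable_on UNIV"
        by (intro summable_on_cmult_right summable_on_inverse_square_int z)
      fix n :: int
          have m1: "Re ((z + of_int n)\<^sup>2) = (Re z + of_int n)\<^sup>2 - v\<^sup>2" by (simp add: power2_eq_square v_def)
          have m2: "Re (- of_real (pi * T) * (z + of_int n)\<^sup>2) = - (pi * T) * Re ((z + of_int n)\<^sup>2)" by simp
          have "Re (- of_real (pi * T) * (z + of_int n)\<^sup>2) = pi * T * v\<^sup>2 - pi * T * (Re z + of_int n)\<^sup>2"
            unfolding m2 m1 by (simp add: algebra_simps)
          hence "norm (exp (- of_real (pi * T) * (z + of_int n)\<^sup>2)) \<le> exp (pi * T * v\<^sup>2)" using T by simp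
      from mult_right_mono[OF this, of "1 / (norm (z + of_int n))\<^sup>2"]
      show "norm (cis (2 * pi * of_int n * \<kappa>) * exp (- of_real (pi * T) * (z + of_int n)\<^sup>2) / (z + of_int n)\<^sup>2) \<le> exp (pi * T * v\<^sup>2) * (1 / (norm (z + of_int n))\<^sup>2)"
        by (simp add: norm_mult norm_divide norm_power)
    qed
    show ?thesis
      unfolding diff_conv_add_uminus by (subst infsum_add[OF s1 summable_on_uminus[THEN iffD2, OF s2]]) (simp add: infsum_uminus)
  qed
  finally show ?thesis
    unfolding F_def by (simp add: infsum_cmult_right' algebra_simps)
qed

subsection \<open>The regularised lattice sum\<close>

text \<open>Written as values of \<open>cis\<close>, signs merge with the other phases, and the
  later identities between products reduce to comparing exponents.\<close>

lemma neg_one_powi: "(-1::complex) powi k = cis (pi * of_int k)"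
proof -
  have "(-1::complex) powi k = cis pi powi k" by (subst cis_pi) (rule refl)
  also have "\<dots> = cis (of_int k * pi)" by (rule cis_power_int)
  also have "of_int k * pi = pi * of_int k" by (rule mult.commute)
  finally show ?thesis .
qed

lemma cis_pi_of_int_neq: "cis (pi * of_int k) = cis (pi * of_int j)" if ev: "even (k - j)"
proof -
  obtain i where "k - j = 2 * i" using evenE[OF ev] by blast
  hence i: "k = j + 2 * i" by simp
  have "cis (pi * of_int k) = cis (pi * of_int j) * cis (2 * pi * of_int i)"
    by (simp add: i cis_mult algebra_simps)
  also have "cis (2 * pi * of_int i) = 1" by (rule cis_multiple_2pi) simp
  finally show ?thesis by simp
qed

lemma summable_on_product_nonneg:
  fixes f :: "'a \<Rightarrow> real" and g :: "'b \<Rightarrow> real"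
  assumes "f summable_on A" "g summable_on B" "\<And>x. f x \<ge> 0" "\<And>y. g y \<ge> 0"
  shows "(\<lambda>(x, y). f x * g y) summable_on (A \<times> B)"
proof (rule summable_on_SigmaI)
  fix x
  show "((\<lambda>y. (\<lambda>(x, y). f x * g y) (x, y)) has_sum f x * infsum g B) B"
    using has_sum_cmult_right[OF has_sum_infsum[OF assms(2)], of "f x"] by simp
next
  show "(\<lambda>x. f x * infsum g B) summable_on A"
    by (intro summable_on_cmult_left assms)
next
  fix x y
  show "0 \<le> (\<lambda>(x, y). f x * g y) (x, y)" using assms by simp
qed

lemma dist_int_lower_bound:
  fixes p :: real
  assumes "p \<notin> \<int>"
  obtains \<delta> where "\<delta> > 0" "\<And>m::int. \<bar>of_int m - p\<bar> \<ge> \<delta>"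
proof -
  obtain d where "d > 0" "\<And>x. x \<in> \<int> \<Longrightarrow> d \<le> dist p x"
    using separate_point_closed[OF closed_Ints assms] by blast
  hence "d > 0" "\<bar>of_int m - p\<bar> \<ge> d" for m :: int
    by (auto simp: dist_real_def abs_minus_commute[of _ p])
  thus ?thesis by (rule that)
qed

text \<open>The imaginary part of the vector controls a, and subtracting a tau from the vector then
  controls b.\<close>

lemma norm_lattice_lower_bound:
  assumes "Im \<tau> > 0"
  obtains \<delta> where "\<delta> > 0" "\<And>a b::real. \<delta> * (a\<^sup>2 + b\<^sup>2) \<le> (norm (of_real a * \<tau> + of_real b))\<^sup>2"
proof -
  define K where "K = 1 / Im \<tau> + 1 + norm \<tau> / Im \<tau>"
  have K: "K > 0" using assms by (auto simp: K_def intro!: add_pos_nonneg)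
  have "1 / K\<^sup>2 * (a\<^sup>2 + b\<^sup>2) \<le> (norm (of_real a * \<tau> + of_real b))\<^sup>2" for a b :: real
  proof -
    define w where "w = of_real a * \<tau> + of_real b"
    have "\<bar>a\<bar> * Im \<tau> = \<bar>Im w\<bar>" using assms by (simp add: w_def abs_mult)
    also have "\<dots> \<le> norm w" by (rule abs_Im_le_cmod)
    finally have 1: "\<bar>a\<bar> \<le> norm w / Im \<tau>" using assms by (simp add: field_simps)
    have "\<bar>b\<bar> = norm (w - of_real a * \<tau>)" by (simp add: w_def)
    also have "\<dots> \<le> norm w + \<bar>a\<bar> * norm \<tau>" by (rule order.trans[OF norm_triangle_ineq4]) (simp add: norm_mult)
    also have "\<dots> \<le> norm w + norm w / Im \<tau> * norm \<tau>" using 1 by (intro add_left_mono mult_right_mono) auto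
    finally have "\<bar>a\<bar> + \<bar>b\<bar> \<le> K * norm w" using 1 by (simp add: K_def algebra_simps)
    hence "(\<bar>a\<bar> + \<bar>b\<bar>)\<^sup>2 \<le> (K * norm w)\<^sup>2" by (intro power_mono) auto
    moreover have "a\<^sup>2 + b\<^sup>2 \<le> (\<bar>a\<bar> + \<bar>b\<bar>)\<^sup>2" by (simp add: power2_sum)
    ultimately have "a\<^sup>2 + b\<^sup>2 \<le> K\<^sup>2 * (norm w)\<^sup>2" by (simp add: power_mult_distrib)
    thus ?thesis using K by (simp add: w_def field_simps)
  qed
  with K show ?thesis by (intro that[of "1 / K\<^sup>2"]) auto
qed

text \<open>The phase consists of two invariants of SL_2(Z): the parity of mn + m + n records only
  whether m and n are both even, and m r - n p is the determinant of (m, n) and (p, r).\<close>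

definition eis_term :: "nat \<Rightarrow> real \<Rightarrow> real \<Rightarrow> complex \<Rightarrow> int \<times> int \<Rightarrow> complex" where
  "eis_term l p r \<tau> = (\<lambda>(m, n). let w = of_real (of_int m - p) * \<tau> + of_real (of_int n - r) in
     cis (pi * of_int (int l * (m * n + m + n)) + pi * real l * (of_int m * r - of_int n * p))
     * of_real (exp (- (pi * real l / (2 * Im \<tau>)) * (norm w)\<^sup>2)) / w\<^sup>2)"

definition eis :: "nat \<Rightarrow> real \<Rightarrow> real \<Rightarrow> complex \<Rightarrow> complex" where
  "eis l p r \<tau> = (\<Sum>\<^sub>\<infinity>mn. eis_term l p r \<tau> mn)"

text \<open>If one of p and r is not an integer, the corresponding coordinate of all vectors (m - p,
  n - r) stays away from 0, and the quadratic form is positive definite.\<close>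

lemma eis_denominator_bound:
  assumes "Im \<tau> > 0" "\<not> (p \<in> \<int> \<and> r \<in> \<int>)"
  obtains \<delta> d where "\<delta> > 0" "d > 0"
    "\<And>a b::real. \<delta> * (a\<^sup>2 + b\<^sup>2) \<le> (norm (of_real a * \<tau> + of_real b))\<^sup>2"
    "\<And>m n::int. d \<le> norm (of_real (of_int m - p) * \<tau> + of_real (of_int n - r))"
proof -
  obtain \<delta> where \<delta>: "\<delta> > 0" "\<And>a b::real. \<delta> * (a\<^sup>2 + b\<^sup>2) \<le> (norm (of_real a * \<tau> + of_real b))\<^sup>2"
    using norm_lattice_lower_bound[OF assms(1)] by blast
  obtain e where e: "e > 0" "\<And>m n::int. e\<^sup>2 \<le> (of_int m - p)\<^sup>2 + (of_int n - r)\<^sup>2"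
  proof (cases "p \<in> \<int>")
    case False
    then obtain e where e: "e > 0" "\<And>m::int. \<bar>of_int m - p\<bar> \<ge> e" using dist_int_lower_bound by blast
    have "e\<^sup>2 \<le> (of_int m - p)\<^sup>2 + (of_int n - r)\<^sup>2" for m n :: int
      using power_mono[OF e(2)[of m], of 2] e(1) by (simp add: add_increasing2)
    with e(1) show ?thesis by (rule that)
  next
    case True
    with assms(2) have "r \<notin> \<int>" by simp
    then obtain e where e: "e > 0" "\<And>m::int. \<bar>of_int m - r\<bar> \<ge> e" using dist_int_lower_bound by blast
    have "e\<^sup>2 \<le> (of_int m - p)\<^sup>2 + (of_int n - r)\<^sup>2" for m n :: int
      using power_mono[OF e(2)[of n], of 2] e(1) by (simp add: add_increasing)
    with e(1) show ?thesis by (rule that)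
  qed
  have "sqrt \<delta> * e \<le> norm (of_real (of_int m - p) * \<tau> + of_real (of_int n - r))" for m n :: int
  proof (rule power2_le_imp_le)
    have "(sqrt \<delta> * e)\<^sup>2 = \<delta> * e\<^sup>2" using \<delta> by (simp add: power_mult_distrib)
    also have "\<dots> \<le> \<delta> * ((of_int m - p)\<^sup>2 + (of_int n - r)\<^sup>2)" using \<delta> e by (intro mult_left_mono) auto
    also have "\<dots> \<le> (norm (of_real (of_int m - p) * \<tau> + of_real (of_int n - r)))\<^sup>2" by (rule \<delta>)
    finally show "(sqrt \<delta> * e)\<^sup>2 \<le> (norm (of_real (of_int m - p) * \<tau> + of_real (of_int n - r)))\<^sup>2" .
  qed simp
  thus ?thesis using \<delta> e by (intro that[of \<delta> "sqrt \<delta> * e"]) auto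
qed

lemma summable_on_gauss_2d:
  fixes a p r :: real
  assumes "a > 0"
  shows "(\<lambda>(m::int, n::int). exp (- a * ((of_int m - p)\<^sup>2 + (of_int n - r)\<^sup>2))) summable_on UNIV"
proof -
  have g: "(\<lambda>n::int. exp (- a * (of_int n - q)\<^sup>2)) summable_on UNIV" for q
    using summable_on_int_gauss_shift[of a 0 1 "- q" 0] assms by simp
  have "(\<lambda>(m::int, n::int). exp (- a * (of_int m - p)\<^sup>2) * exp (- a * (of_int n - r)\<^sup>2)) summable_on UNIV \<times> UNIV"
    by (intro summable_on_product_nonneg g) auto
  thus ?thesis by (simp add: distrib_left case_prod_beta' exp_diff exp_minus inverse_eq_divide)
qed

lemma eis_term_abs_summable:
  assumes "l \<ge> 1" "Im \<tau> > 0" "\<not> (p \<in> \<int> \<and> r \<in> \<int>)"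
  shows "(\<lambda>mn. norm (eis_term l p r \<tau> mn)) summable_on UNIV"
proof -
  obtain \<delta> d where \<delta>: "\<delta> > 0" "d > 0"
    "\<And>a b::real. \<delta> * (a\<^sup>2 + b\<^sup>2) \<le> (norm (of_real a * \<tau> + of_real b))\<^sup>2"
    "\<And>m n::int. d \<le> norm (of_real (of_int m - p) * \<tau> + of_real (of_int n - r))"
    using eis_denominator_bound[OF assms(2,3)] by metis
  define A where "A = pi * real l / (2 * Im \<tau>)"
  have A: "A > 0" using assms by (simp add: A_def)
  show ?thesis
  proof (rule Infinite_Sum.abs_summable_on_comparison_test')
    show "(\<lambda>mn::int \<times> int. 1 / d\<^sup>2 * (case mn of (m, n) \<Rightarrow> exp (- (A * \<delta>) * ((of_int m - p)\<^sup>2 + (of_int n - r)\<^sup>2)))) summable_on UNIV"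
      using A \<delta> by (intro summable_on_cmult_right summable_on_gauss_2d) auto
    fix mn :: "int \<times> int"
    obtain m n where mn: "mn = (m, n)" by force
    define w where "w = of_real (of_int m - p) * \<tau> + of_real (of_int n - r)"
    have "exp (- A * (norm w)\<^sup>2) \<le> exp (- (A * \<delta>) * ((of_int m - p)\<^sup>2 + (of_int n - r)\<^sup>2))"
      using \<delta>(3)[of "of_int m - p" "of_int n - r"] A by (simp add: w_def)
    moreover have "1 / (norm w)\<^sup>2 \<le> 1 / d\<^sup>2"
      using \<delta>(4)[of m n] \<delta>(2) by (intro divide_left_mono power_mono mult_pos_pos) (auto simp: w_def)
    ultimately have "exp (- A * (norm w)\<^sup>2) * (1 / (norm w)\<^sup>2) \<le> exp (- (A * \<delta>) * ((of_int m - p)\<^sup>2 + (of_int n - r)\<^sup>2)) * (1 / d\<^sup>2)"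
      by (intro mult_mono) auto
    thus "norm (eis_term l p r \<tau> mn) \<le> 1 / d\<^sup>2 * (case mn of (m, n) \<Rightarrow> exp (- (A * \<delta>) * ((of_int m - p)\<^sup>2 + (of_int n - r)\<^sup>2)))"
      unfolding mn eis_term_def Let_def prod.case w_def[symmetric] A_def[symmetric]
      by (simp add: norm_mult norm_divide norm_power mult.commute)
  qed
qed

section \<open>Majorants for the terms of \<open>H2\<close> and \<open>H1\<close>\<close>

definition H2_bound :: "nat \<Rightarrow> real \<Rightarrow> real \<Rightarrow> int \<times> int \<Rightarrow> real" where
  "H2_bound l p Y = (\<lambda>(n, m).
     ((pi * real l * \<bar>of_int n - p\<bar> + (sqrt (real l / (2 * Y)) + 1)) * exp (- (pi * Y * real l / 4) * (of_int n - p)\<^sup>2)) *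
     ((pi * \<bar>of_int m + real l / 2\<bar> + 1) * exp (- (pi * Y / (2 * real l)) * (of_int m + real l / 2)\<^sup>2)))"

lemma summable_on_H2_bound:
  assumes "l \<ge> 1" "Y > 0"
  shows "H2_bound l p Y summable_on UNIV"
proof -
  have "(\<lambda>n::int. (pi * real l * \<bar>of_int n - p\<bar> + (sqrt (real l / (2 * Y)) + 1)) * exp (- (pi * Y * real l / 4) * (of_int n - p)\<^sup>2)) summable_on UNIV"
    using summable_on_int_gauss_shift[of "pi * Y * real l / 4" "pi * real l" "sqrt (real l / (2 * Y)) + 1" "- p" 0] assms by simp
  moreover have "(\<lambda>m::int. (pi * \<bar>of_int m + real l / 2\<bar> + 1) * exp (- (pi * Y / (2 * real l)) * (of_int m + real l / 2)\<^sup>2)) summable_on UNIV"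
    using summable_on_int_gauss_shift[of "pi * Y / (2 * real l)" pi 1 "real l / 2" 0] assms by simp
  ultimately have "H2_bound l p Y summable_on UNIV \<times> UNIV"
    unfolding H2_bound_def using assms by (intro summable_on_product_nonneg) auto
  thus ?thesis by simp
qed

lemma norm_qpow: "norm (qpow r \<tau>) = exp (- 2 * pi * r * Im \<tau>)"
  by (simp add: qpow_def)

text \<open>The q-power alone is unbounded, but -l s^2/2 + s mu = (mu^2 - t^2)/(2l), and f brings
  exp(-2 pi y t^2/l), so together they give exp(-pi y (mu^2 + t^2)/l). As l s = t + mu, half of this
  positive definite form can be spent on s and half on mu, which separates n from m. The bound
  involves only Y, as uniform convergence on Im tau >= Y requires.\<close>

lemma norm_H2_term_le:
  assumes l: "l \<ge> 1" and Y: "Y > 0" "Y \<le> Im \<tau>"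
  shows "norm (H2_term l x c d \<tau> p) \<le> H2_bound l (of_int c * x) Y p"
proof -
  obtain n m where p: "p = (n, m)" by force
  define y where "y = Im \<tau>"
  define s where "s = of_int n - of_int c * x"
  define \<mu> where "\<mu> = of_int m + real l / 2"
  define t where "t = real l * s - \<mu>"
  have y: "y > 0" using Y by (simp add: y_def)
  have L: "real l > 0" using l by simp
  have "norm (H2_term l x c d \<tau> p) = \<bar>f_fun l t y\<bar> * exp (- 2 * pi * (- (real l / 2) * s\<^sup>2 + s * \<mu>) * y)"
    unfolding p H2_term_def Let_def s_def \<mu>_def t_def y_def
    by (simp add: norm_mult norm_power_int norm_qpow)
  also have "\<dots> \<le> ((pi * \<bar>t\<bar> + sqrt (real l / (2 * y))) * exp (- pi * t\<^sup>2 / (real l / (2 * y)))) * exp (- 2 * pi * (- (real l / 2) * s\<^sup>2 + s * \<mu>) * y)"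
    unfolding f_fun_eq[OF l y] using L y by (intro mult_right_mono abs_nonhol_f_le) auto
  also have "\<dots> = (pi * \<bar>t\<bar> + sqrt (real l / (2 * y))) * exp (- (pi * y / real l) * (\<mu>\<^sup>2 + t\<^sup>2))"
  proof -
    have "- pi * t\<^sup>2 / (real l / (2 * y)) + - 2 * pi * (- (real l / 2) * s\<^sup>2 + s * \<mu>) * y = - (pi * y / real l) * (\<mu>\<^sup>2 + t\<^sup>2)"
    proof -
      have e: "- (real l / 2) * s\<^sup>2 + s * \<mu> = (\<mu>\<^sup>2 - t\<^sup>2) / (2 * real l)"
        using L by (simp add: t_def power2_eq_square field_simps)
      show ?thesis unfolding e using L by (simp add: field_simps)
    qed
    thus ?thesis by (simp only: mult.assoc exp_add[symmetric])
  qed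
  also have "\<dots> \<le> ((pi * real l * \<bar>s\<bar> + (sqrt (real l / (2 * Y)) + 1)) * (pi * \<bar>\<mu>\<bar> + 1)) *
      (exp (- (pi * Y * real l / 4) * s\<^sup>2) * exp (- (pi * Y / (2 * real l)) * \<mu>\<^sup>2))"
  proof (rule mult_mono)
    have "\<bar>t\<bar> \<le> real l * \<bar>s\<bar> + \<bar>\<mu>\<bar>" using L by (simp add: t_def abs_mult order.trans[OF abs_triangle_ineq4])
    hence "pi * \<bar>t\<bar> \<le> pi * (real l * \<bar>s\<bar> + \<bar>\<mu>\<bar>)" by (intro mult_left_mono) auto
    hence "pi * \<bar>t\<bar> \<le> pi * real l * \<bar>s\<bar> + pi * \<bar>\<mu>\<bar>" by (simp add: algebra_simps)
    moreover have "sqrt (real l / (2 * y)) \<le> sqrt (real l / (2 * Y))"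
      using Y L by (intro real_sqrt_le_mono divide_left_mono) (auto simp: y_def)
    moreover have "0 \<le> pi * real l * \<bar>s\<bar> * (pi * \<bar>\<mu>\<bar>)" "0 \<le> sqrt (real l / (2 * Y)) * (pi * \<bar>\<mu>\<bar>)" using L Y by auto
    ultimately show "pi * \<bar>t\<bar> + sqrt (real l / (2 * y)) \<le> (pi * real l * \<bar>s\<bar> + (sqrt (real l / (2 * Y)) + 1)) * (pi * \<bar>\<mu>\<bar> + 1)"
      unfolding distrib_left distrib_right by linarith
    have "(real l * s)\<^sup>2 \<le> 2 * (\<mu>\<^sup>2 + t\<^sup>2)"
    proof -
      have "real l * s = t + \<mu>" by (simp add: t_def)
      moreover have "0 \<le> (t - \<mu>)\<^sup>2" by simp
      ultimately show ?thesis by (simp add: power2_eq_square algebra_simps)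
    qed
    hence "(real l)\<^sup>2 * s\<^sup>2 / 4 + \<mu>\<^sup>2 / 2 \<le> \<mu>\<^sup>2 + t\<^sup>2"
    proof -
      have "Q / 4 + A / 2 \<le> A + B" if "Q \<le> 2 * (A + B)" "B \<ge> 0" for Q A B :: real
        using that by (simp add: field_simps)
      from this[of "(real l)\<^sup>2 * s\<^sup>2" "\<mu>\<^sup>2" "t\<^sup>2"] show ?thesis
        using \<open>(real l * s)\<^sup>2 \<le> 2 * (\<mu>\<^sup>2 + t\<^sup>2)\<close> by (simp add: power_mult_distrib)
    qed
    hence "(pi * Y / real l) * ((real l)\<^sup>2 * s\<^sup>2 / 4 + \<mu>\<^sup>2 / 2) \<le> (pi * y / real l) * (\<mu>\<^sup>2 + t\<^sup>2)"
      using Y L by (intro mult_mono divide_right_mono mult_left_mono) (auto simp: y_def)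
    moreover have "(pi * Y / real l) * ((real l)\<^sup>2 * s\<^sup>2 / 4 + \<mu>\<^sup>2 / 2) = (pi * Y * real l / 4) * s\<^sup>2 + (pi * Y / (2 * real l)) * \<mu>\<^sup>2"
      using L by (simp add: field_simps power2_eq_square)
    ultimately show "exp (- (pi * y / real l) * (\<mu>\<^sup>2 + t\<^sup>2)) \<le> exp (- (pi * Y * real l / 4) * s\<^sup>2) * exp (- (pi * Y / (2 * real l)) * \<mu>\<^sup>2)"
      unfolding exp_add[symmetric] exp_le_cancel_iff by linarith
  qed (use L Y in auto)
  also have "\<dots> = H2_bound l (of_int c * x) Y p"
    unfolding p H2_bound_def s_def \<mu>_def prod.case by (simp only: mult_ac)
  finally show ?thesis .
qed

lemma H2_term_abs_summable:
  assumes "l \<ge> 1" "Im \<tau> > 0"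
  shows "(\<lambda>p. norm (H2_term l x c d \<tau> p)) summable_on UNIV"
proof (rule Infinite_Sum.abs_summable_on_comparison_test')
  show "H2_bound l (of_int c * x) (Im \<tau>) summable_on UNIV" by (rule summable_on_H2_bound[OF assms])
  show "norm (H2_term l x c d \<tau> p) \<le> H2_bound l (of_int c * x) (Im \<tau>) p" for p
    by (rule norm_H2_term_le[OF assms]) simp
qed

lemma summable_on_abs_exp_shift:
  fixes a M :: real
  assumes "a > 0"
  shows "(\<lambda>m::int. \<bar>of_int m - M\<bar> * exp (- a * \<bar>of_int m - M\<bar>)) summable_on UNIV"
proof (rule summable_on_comparison_test)
  show "(\<lambda>m::int. (2 / a * exp (a / 2 * \<bar>M\<bar>)) * exp (- (a / 2) * \<bar>of_int m\<bar>)) summable_on UNIV"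
    using assms by (intro summable_on_cmult_right summable_on_int_exp) auto
  fix m :: int
  define u where "u = \<bar>of_int m - M\<bar>"
  \<comment> \<open>Half of the exponential decay is given up to absorb the linear factor.\<close>
  have "a / 2 * u \<le> exp (a / 2 * u)" using exp_ge_add_one_self[of "a / 2 * u"] by linarith
  hence "u \<le> 2 / a * exp (a / 2 * u)" using assms by (simp add: field_simps)
  hence "u * exp (- a * u) \<le> 2 / a * exp (a / 2 * u) * exp (- a * u)" by (intro mult_right_mono) auto
  also have "\<dots> = 2 / a * exp (a / 2 * u + - a * u)" by (simp only: exp_add mult.assoc)
  also have "a / 2 * u + - a * u = - (a / 2) * u" by simp
  also have "2 / a * exp (- (a / 2) * u) \<le> 2 / a * exp (a / 2 * \<bar>M\<bar> + - (a / 2) * \<bar>of_int m\<bar>)"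
  proof -
    have "\<bar>real_of_int m\<bar> - \<bar>M\<bar> \<le> u" unfolding u_def by linarith
    hence "a / 2 * (\<bar>real_of_int m\<bar> - \<bar>M\<bar>) \<le> a / 2 * u" using assms by (intro mult_left_mono) auto
    hence "- (a / 2) * u \<le> a / 2 * \<bar>M\<bar> + - (a / 2) * \<bar>of_int m\<bar>" by (simp add: algebra_simps)
    hence "exp (- (a / 2) * u) \<le> exp (a / 2 * \<bar>M\<bar> + - (a / 2) * \<bar>of_int m\<bar>)" by (rule iffD2[OF exp_le_cancel_iff])
    thus ?thesis using assms by (intro mult_left_mono) auto
  qed
  finally show "\<bar>of_int m - M\<bar> * exp (- a * \<bar>of_int m - M\<bar>) \<le> (2 / a * exp (a / 2 * \<bar>M\<bar>)) * exp (- (a / 2) * \<bar>of_int m\<bar>)"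
    by (simp only: u_def exp_add mult.assoc)
qed simp

lemma norm_H1_term:
  "norm (H1_term l x c d \<tau> (n, m)) = \<bar>of_int m - M_const l x c\<bar> *
     exp (- 2 * pi * (real l / 2 * (of_int n + of_int c * x)\<^sup>2 + (of_int n + of_int c * x) * (of_int m - M_const l x c)) * Im \<tau>)"
proof -
  have "norm (of_real (of_int m - M_const l x c) :: complex) = \<bar>of_int m - M_const l x c\<bar>" by (rule norm_of_real)
  thus ?thesis
    unfolding H1_term_def Let_def prod.case norm_mult norm_power_int norm_qpow by simp
qed

text \<open>On both index ranges n + cx and m - M never have opposite signs, so their product is a
  nonnegative contribution to the exponent. As n + cx is nonzero there, it is bounded away from 0,
  and the decay in m is uniform in n.\<close>

lemma H1_term_abs_summable:
  assumes l: "l \<ge> 1" and \<tau>: "Im \<tau> > 0"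
  shows "(\<lambda>p. norm (H1_term l x c d \<tau> p)) summable_on (H1_index_pos l x c \<union> H1_index_neg l x c)"
proof -
  define p where "p = of_int c * x"
  define M where "M = M_const l x c"
  define y where "y = Im \<tau>"
  have y: "y > 0" using \<tau> by (simp add: y_def)
  \<comment> \<open>The distance from -p to the nearest integer other than -p itself; stepping floor
    and ceiling by one covers the case of an integer p.\<close>
  define e where "e = min (of_int (\<lfloor>- p\<rfloor> + 1) + p) (- p - of_int (\<lceil>- p\<rceil> - 1))"
  have e0: "e > 0" unfolding e_def by linarith
  have eb: "e \<le> \<bar>of_int n + p\<bar>" if "of_int n \<noteq> - p" for n :: int
  proof (cases "of_int n > - p")
    case True
    hence "n \<ge> \<lfloor>- p\<rfloor> + 1" by linarith
    hence "of_int (\<lfloor>- p\<rfloor> + 1) \<le> real_of_int n" by (rule of_int_le_iff[THEN iffD2])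
    thus ?thesis unfolding e_def by linarith
  next
    case False
    hence "of_int n < - p" using that by linarith
    hence "n \<le> \<lceil>- p\<rceil> - 1" by linarith
    hence "real_of_int n \<le> of_int (\<lceil>- p\<rceil> - 1)" by (rule of_int_le_iff[THEN iffD2])
    thus ?thesis unfolding e_def by linarith
  qed
  define G where "G = (\<lambda>(n::int, m::int). exp (- (pi * real l * y) * (of_int n + p)\<^sup>2) * (\<bar>of_int m - M\<bar> * exp (- (2 * pi * e * y) * \<bar>of_int m - M\<bar>)))"
  have "G summable_on UNIV \<times> UNIV"
    unfolding G_def
  proof (intro summable_on_product_nonneg summable_on_abs_exp_shift)
    show "(\<lambda>n::int. exp (- (pi * real l * y) * (of_int n + p)\<^sup>2)) summable_on UNIV"
      using summable_on_int_gauss_shift[of "pi * real l * y" 0 1 p 0] l y by simp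
  qed (use e0 y in auto)
  hence G: "G summable_on (H1_index_pos l x c \<union> H1_index_neg l x c)" by (rule summable_on_subset_banach) auto
  show ?thesis
  proof (rule Infinite_Sum.abs_summable_on_comparison_test'[OF G])
    fix nm assume nm: "nm \<in> H1_index_pos l x c \<union> H1_index_neg l x c"
    obtain n m where nmeq: "nm = (n, m)" by force
    have "of_int n + p > 0 \<and> of_int m - M \<ge> 0 \<or> of_int n + p < 0 \<and> of_int m - M < 0"
      using nm by (auto simp: nmeq H1_index_pos_def H1_index_neg_def p_def M_def)
    hence prod: "(of_int n + p) * (of_int m - M) = \<bar>of_int n + p\<bar> * \<bar>of_int m - M\<bar>" and ne: "of_int n \<noteq> - p"
      by (auto simp: abs_if algebra_simps)
    have "e * \<bar>of_int m - M\<bar> \<le> \<bar>of_int n + p\<bar> * \<bar>of_int m - M\<bar>"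
      by (intro mult_right_mono eb ne) auto
    hence "(2 * pi * y) * (e * \<bar>of_int m - M\<bar>) \<le> (2 * pi * y) * ((of_int n + p) * (of_int m - M))"
      unfolding prod using y by (intro mult_left_mono) auto
    hence "- 2 * pi * (real l / 2 * (of_int n + p)\<^sup>2 + (of_int n + p) * (of_int m - M)) * y
       \<le> - (pi * real l * y) * (of_int n + p)\<^sup>2 + - (2 * pi * e * y) * \<bar>of_int m - M\<bar>"
      by (simp add: algebra_simps)
    hence "exp (- 2 * pi * (real l / 2 * (of_int n + p)\<^sup>2 + (of_int n + p) * (of_int m - M)) * y)
       \<le> exp (- (pi * real l * y) * (of_int n + p)\<^sup>2) * exp (- (2 * pi * e * y) * \<bar>of_int m - M\<bar>)"
      unfolding exp_add[symmetric] exp_le_cancel_iff .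
    hence "\<bar>of_int m - M\<bar> * exp (- 2 * pi * (real l / 2 * (of_int n + p)\<^sup>2 + (of_int n + p) * (of_int m - M)) * y)
       \<le> \<bar>of_int m - M\<bar> * (exp (- (pi * real l * y) * (of_int n + p)\<^sup>2) * exp (- (2 * pi * e * y) * \<bar>of_int m - M\<bar>))"
      by (intro mult_left_mono) auto
    thus "norm (H1_term l x c d \<tau> nm) \<le> G nm"
      unfolding nmeq norm_H1_term G_def prod.case p_def[symmetric] M_def[symmetric] y_def[symmetric]
      by (simp only: mult.left_commute)
  qed
qed

lemma H1_term_summable:
  assumes l: "l \<ge> 1" and \<tau>: "Im \<tau> > 0"
  shows "H1_term l x c d \<tau> summable_on H1_index_pos l x c" "H1_term l x c d \<tau> summable_on H1_index_neg l x c"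
proof -
  note * = summable_on_subset_banach[OF H1_term_abs_summable[OF assms, of x c d]]
  show "H1_term l x c d \<tau> summable_on H1_index_pos l x c"
    by (rule abs_summable_summable, rule *) blast
  show "H1_term l x c d \<tau> summable_on H1_index_neg l x c"
    by (rule abs_summable_summable, rule *) blast
qed

text \<open>Along a row Im w = a Im tau is constant, so the conjugate of w is w - 2 i a Im tau and
  |w|^2 = w^2 - 2 i (a Im tau) w. The real Gaussian becomes the holomorphic Gaussian of
  \<open>infsum_gauss_dual\<close> with T = l/(2 Im tau), times an exponential linear in n, which
  joins the phase and yields kappa = l (2a + 1)/2.\<close>

lemma eis_term_row:
  fixes m n :: int and p r :: real and \<tau> :: complex and l :: nat
  assumes \<tau>: "Im \<tau> > 0"
  defines "a \<equiv> of_int m - p"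
  defines "z \<equiv> of_real a * \<tau> - of_real r"
  shows "eis_term l p r \<tau> (m, n) =
    (cis (pi * real l * (of_int m + of_int m * r)) * exp (of_real pi * \<i> * of_nat l * of_real a * z)) *
    (cis (2 * pi * of_int n * (real l * (2 * a + 1) / 2)) * exp (- of_real (pi * (real l / (2 * Im \<tau>))) * (z + of_int n)\<^sup>2) / (z + of_int n)\<^sup>2)"
proof -
  define w where "w = z + of_int n"
  define T where "T = real l / (2 * Im \<tau>)"
  have w: "of_real (of_int m - p) * \<tau> + of_real (of_int n - r) = w" by (simp add: w_def z_def a_def)
  have Imw: "Im w = a * Im \<tau>" by (simp add: w_def z_def)
  have "(of_real ((norm w)\<^sup>2) :: complex) = w * cnj w" by (rule complex_norm_square)
  also have "cnj w = w - 2 * \<i> * of_real (a * Im \<tau>)" using Imw by (simp add: complex_eq_iff)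
  also have "w * \<dots> = w\<^sup>2 - 2 * \<i> * of_real (a * Im \<tau>) * w" by (simp add: algebra_simps power2_eq_square)
  finally have nw: "(of_real ((norm w)\<^sup>2) :: complex) = w\<^sup>2 - 2 * \<i> * of_real (a * Im \<tau>) * w" .
  have "of_real (- (pi * T) * (norm w)\<^sup>2) = - of_real (pi * T) * (of_real ((norm w)\<^sup>2) :: complex)" by simp
  also have "\<dots> = - of_real (pi * T) * w\<^sup>2 + of_real (2 * pi * T * a * Im \<tau>) * \<i> * w"
    unfolding nw by (simp add: algebra_simps)
  also have "2 * pi * T * a * Im \<tau> = pi * real l * a" using \<tau> by (simp add: T_def)
  finally have g: "of_real (exp (- (pi * T) * (norm w)\<^sup>2)) = exp (- of_real (pi * T) * w\<^sup>2) * exp (of_real (pi * real l * a) * \<i> * w)"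
    by (simp only: exp_of_real[symmetric] exp_add)
  have phase: "cis (pi * of_int (int l * (m * n + m + n)) + pi * real l * (of_int m * r - of_int n * p)) * exp (of_real (pi * real l * a) * \<i> * w) =
     (cis (pi * real l * (of_int m + of_int m * r)) * exp (of_real pi * \<i> * of_nat l * of_real a * z)) * cis (2 * pi * of_int n * (real l * (2 * a + 1) / 2))"
  proof -
    have "2 * pi * of_int n * (real l * (2 * a + 1) / 2) = pi * of_int n * real l * (2 * a + 1)" by simp
    thus ?thesis
      unfolding cis_conv_exp exp_add[symmetric] w_def
      by (intro arg_cong[where f = exp]) (simp only:, simp add: a_def algebra_simps)
  qed
  have "pi * real l / (2 * Im \<tau>) = pi * T" by (simp add: T_def)
  thus ?thesis
    unfolding eis_term_def Let_def prod.case w w_def[symmetric] T_def[symmetric]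
    using phase by (simp only: g) (simp add: mult_ac)
qed

text \<open>The row prefactor times the exponential of frequency j completes a square: what results
  is the combination of sign, phase and q-power that \<open>H1_term\<close> and
  \<open>H2_term\<close> have in common.\<close>

lemma eis_row_phase:
  fixes m :: int and j p r :: real and \<tau> :: complex and l :: nat
  defines "a \<equiv> of_int m - p"
  defines "z \<equiv> of_real a * \<tau> - of_real r"
  shows "cis (- (pi * real l * p * r)) * (cis (pi * real l * (of_int m + of_int m * r)) * exp (of_real pi * \<i> * of_nat l * of_real a * z)) *
      exp (2 * of_real pi * \<i> * of_real j * z) =
    (-1) powi (int l * m) * cis (- 2 * pi * r * j) * qpow (real l / 2 * a\<^sup>2 + a * j) \<tau>"
  unfolding neg_one_powi cis_conv_exp exp_add[symmetric] qpow_def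
  by (rule arg_cong[where f = exp]) (simp add: z_def a_def algebra_simps power2_eq_square)

text \<open>This is the row m = p, where z = -r is real and the Lipschitz sum is only available in
  closed form. Its phase l/2 reduces modulo 1 to 0 for even l and to 1/2 for odd l, hence the two
  cases that the delta of (l + 1)/2 distinguishes.\<close>

lemma C_const_eq:
  fixes l :: nat and x :: real and c d :: int
  defines "p \<equiv> of_int c * x" and "r \<equiv> of_int d * x"
  assumes p: "p = of_int m" and r: "r \<notin> \<int>"
  shows "- 1 / (4 * (of_real pi)\<^sup>2) * cis (- (pi * real l * p * r)) * cis (pi * real l * (of_int m + of_int m * r)) *
     (\<Sum>\<^sub>\<infinity>n::int. cis (2 * pi * of_int n * (real l / 2)) / (- of_real r + of_int n)\<^sup>2) = of_real (C_const l x c d)"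
proof -
  define X where "X = exp (2 * of_real pi * \<i> * - of_real r)"
  have ri: "- of_real r \<notin> (\<int> :: complex set)"
    using r by (auto simp: complex_is_Int_iff) (metis Ints_minus Ints_of_int minus_minus)
  define S where "S = sin (pi * r)"
  have S0: "S \<noteq> 0"
    using r sin_times_pi_eq_0[of r] by (auto simp: S_def mult.commute)
  \<comment> \<open>In terms of this half-period exponential, X = 1/u^2, and u - 1/u and u + 1/u are
    the sine and cosine of pi r up to constants.\<close>
  define u where "u = exp (of_real pi * \<i> * of_real r)"
  have u0: "u \<noteq> 0" by (simp add: u_def)
  have Xu: "X = 1 / u\<^sup>2"
    unfolding X_def u_def exp_of_nat_mult[symmetric, of 2, simplified] by (simp add: exp_minus inverse_eq_divide mult_ac flip: exp_double)
  have uS: "u - 1 / u = 2 * \<i> * of_real S"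
    by (simp add: u_def S_def complex_eq_iff exp_minus[symmetric] inverse_eq_divide[symmetric] Re_exp Im_exp)
  have uC: "u + 1 / u = 2 * of_real (cos (pi * r))"
    by (simp add: u_def complex_eq_iff exp_minus[symmetric] inverse_eq_divide[symmetric] Re_exp Im_exp)
  have u2: "u\<^sup>2 - 1 = 2 * \<i> * of_real S * u"
    using uS u0 by (simp add: field_simps power2_eq_square)
  have X1: "1 - X = (u\<^sup>2 - 1) / u\<^sup>2" using u0 by (simp add: Xu field_simps)
  have XX: "X / (1 - X)\<^sup>2 = - 1 / (4 * of_real (S\<^sup>2))"
    using u0 S0 by (simp add: X1 u2) (simp add: Xu power2_eq_square field_simps)
  have cc: "cis (- (pi * real l * p * r)) * cis (pi * real l * (of_int m + of_int m * r)) = cis (pi * real l * of_int m)"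
    by (simp add: cis_mult p algebra_simps)
  have dp: "delta p = 1" by (simp add: delta_def p)
  show ?thesis
  proof (cases "even l")
    case True
    then obtain k where k: "l = 2 * k" by auto
    have "cis (2 * pi * of_int n * (real l / 2)) = cis (2 * pi * of_int n * 0)" for n
    proof -
      have "cis (2 * pi * of_int (n * int k)) = 1" by (rule cis_multiple_2pi) simp
      thus ?thesis by (simp add: k mult_ac)
    qed
    hence s: "(\<Sum>\<^sub>\<infinity>n::int. cis (2 * pi * of_int n * (real l / 2)) / (- of_real r + of_int n)\<^sup>2) = - 4 * (of_real pi)\<^sup>2 * (- 1 / (4 * of_real (S\<^sup>2)))"
      using infsum_lipschitz_closed[OF ri, of 0] unfolding X_def[symmetric] by (simp add: XX)
    have c1: "cis (pi * real l * of_int m) = 1"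
    proof -
      have "cis (2 * pi * of_int (int k * m)) = 1" by (rule cis_multiple_2pi) simp
      thus ?thesis by (simp add: k mult_ac)
    qed
    have dl: "delta ((real l + 1) / 2) = 0"
    proof -
      have "(real l + 1) / 2 \<notin> \<int>"
      proof
        assume "(real l + 1) / 2 \<in> \<int>"
        then obtain i where "(real l + 1) / 2 = of_int i" by (auto elim: Ints_cases)
        hence "2 * real k + 1 = 2 * of_int i" by (simp add: k)
        hence "2 * int k + 1 = 2 * i" by linarith
        thus False by presburger
      qed
      thus ?thesis by (simp add: delta_def)
    qed
    have C: "C_const l x c d = - 1 / (4 * S\<^sup>2)"
      unfolding C_const_def dl p_def[symmetric] dp by (simp add: S_def r_def mult.assoc)
    show ?thesis unfolding s C using cc c1 by (simp add: mult.assoc)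
  next
    case False
    then obtain k where k: "l = 2 * k + 1" by (elim oddE)
    have "cis (2 * pi * of_int n * (real l / 2)) = cis (2 * pi * of_int n * (1 / 2))" for n
    proof -
      have "2 * pi * of_int n * (real l / 2) = 2 * pi * of_int (n * int k) + 2 * pi * of_int n * (1 / 2)"
        by (simp add: k field_simps)
      hence "cis (2 * pi * of_int n * (real l / 2)) = cis (2 * pi * of_int (n * int k)) * cis (2 * pi * of_int n * (1 / 2))"
        by (simp only: cis_mult)
      also have "cis (2 * pi * of_int (n * int k)) = 1" by (rule cis_multiple_2pi) simp
      finally show ?thesis by simp
    qed
    moreover have "exp (- 2 * of_real pi * \<i> * of_real (1 / 2) * - of_real r) = u"
      by (simp add: u_def)
    moreover have "X / (1 - X)\<^sup>2 - of_real (1 / 2) * X / (1 - X) = - of_real (cos (pi * r)) / (4 * of_real (S\<^sup>2)) / u"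
    proof -
      have "X / (1 - X) = 1 / (u\<^sup>2 - 1)" unfolding X1 using u0 by (simp add: Xu)
      also have "\<dots> = 1 / (2 * \<i> * of_real S * u)" by (simp add: u2)
      finally have e: "X / (1 - X) = 1 / (2 * \<i> * of_real S * u)" .
      have cu: "of_real (cos (pi * r)) = u - \<i> * of_real S"
      proof -
        have "2 * of_real (cos (pi * r)) = 2 * u - (u - 1 / u)" using uC by (simp add: algebra_simps)
        hence "2 * of_real (cos (pi * r)) = 2 * (u - \<i> * of_real S)" unfolding uS by (simp add: right_diff_distrib)
        thus ?thesis by (simp only: mult_cancel_left) simp
      qed
      have "X / (1 - X)\<^sup>2 - of_real (1 / 2) * X / (1 - X) = X / (1 - X)\<^sup>2 - of_real (1 / 2) * (X / (1 - X))" by simp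
      also have "\<dots> = - of_real (cos (pi * r)) / (4 * of_real (S\<^sup>2)) / u"
        unfolding e XX cu using u0 S0 by (simp add: field_simps power2_eq_square)
      finally show ?thesis .
    qed
    ultimately have s: "(\<Sum>\<^sub>\<infinity>n::int. cis (2 * pi * of_int n * (real l / 2)) / (- of_real r + of_int n)\<^sup>2) = - 4 * (of_real pi)\<^sup>2 * u * (- of_real (cos (pi * r)) / (4 * of_real (S\<^sup>2)) / u)"
      using infsum_lipschitz_closed[OF ri, of "1 / 2"] unfolding X_def[symmetric] by simp
    have c1: "cis (pi * real l * of_int m) = (-1) powi m"
    proof -
      have "cis (pi * real l * of_int m) = cis (pi * of_int (int l * m))" by (simp add: mult.assoc)
      also have "\<dots> = cis (pi * of_int m)" by (rule cis_pi_of_int_neq) (auto simp: k algebra_simps)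
      finally show ?thesis by (simp add: neg_one_powi)
    qed
    have dl: "delta ((real l + 1) / 2) = 1"
    proof -
      have "(real l + 1) / 2 = of_int (int k + 1)" by (simp add: k)
      thus ?thesis unfolding delta_def using Ints_of_int by metis
    qed
    have C: "C_const l x c d = - ((-1) powi m * cos (pi * r)) / (4 * S\<^sup>2)"
      unfolding C_const_def dl p_def[symmetric] dp by (simp add: S_def r_def mult.assoc p)
    have pw: "of_real ((-1) powi m) = ((-1) powi m :: complex)"
      by (simp add: of_real_power_int)
    show ?thesis unfolding s C of_real_divide of_real_mult of_real_minus pw using cc c1 u0 by (simp add: mult.assoc)
  qed
qed

lemma has_sum_rows:
  fixes f :: "'a \<times> 'b \<Rightarrow> 'c::banach"
  assumes "f summable_on (Sigma A B)"
  shows "((\<lambda>x. \<Sum>\<^sub>\<infinity>y\<in>B x. f (x, y)) has_sum infsum f (Sigma A B)) A"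
  using summable_on_Sigma_banach[of "\<lambda>x y. f (x, y)" A B] infsum_Sigma_banach[OF assms] assms
  by (simp add: has_sum_iff case_prod_beta')

text \<open>In row m, \<open>X m\<close> is the share of the plain Lipschitz sum \<open>D m\<close>
  and assembles to \<open>H1\<close>, while \<open>Y m\<close> is the share of the dual sum over f
  and assembles to \<open>H2\<close>. The second conclusion keeps the rows of \<open>H1\<close>
  before their expansion in q, the form in which they are later compared with the derivative of
  \<open>A_fun\<close>.\<close>

theorem
  fixes l :: nat and x :: real and c d :: int and \<tau> :: complex
  assumes l: "l \<ge> 1" and \<tau>: "Im \<tau> > 0" and nz: "\<not> (of_int c * x \<in> \<int> \<and> of_int d * x \<in> \<int>)"
  defines "p \<equiv> of_int c * x" and "r \<equiv> of_int d * x"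
  shows H1_plus_H2_eq_eis: "H1 l x c d \<tau> + H2 l x c d \<tau> =
       - 1 / (4 * (of_real pi)\<^sup>2) * cis (- (pi * real l * p * r)) * eis l p r \<tau>"
    and has_sum_H1_rows: "((\<lambda>m::int. - 1 / (4 * (of_real pi)\<^sup>2) * cis (- (pi * real l * p * r)) *
       (cis (pi * real l * (of_int m + of_int m * r)) * exp (of_real pi * \<i> * of_nat l * of_real (of_int m - p) * (of_real (of_int m - p) * \<tau> - of_real r))) *
       (\<Sum>\<^sub>\<infinity>n::int. cis (2 * pi * of_int n * (real l * (2 * (of_int m - p) + 1) / 2)) / (of_real (of_int m - p) * \<tau> - of_real r + of_int n)\<^sup>2))
       has_sum H1 l x c d \<tau>) UNIV"
proof -
  define M where "M = M_const l x c"
  define T where "T = real l / (2 * Im \<tau>)"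
  define a where "a = (\<lambda>m::int. of_int m - p)"
  define z where "z = (\<lambda>m. of_real (a m) * \<tau> - of_real r)"
  define \<kappa> where "\<kappa> = (\<lambda>m. real l * (2 * a m + 1) / 2)"
  define P where "P = (\<lambda>m::int. cis (pi * real l * (of_int m + of_int m * r)) * exp (of_real pi * \<i> * of_nat l * of_real (a m) * z m))"
  define E where "E = cis (- (pi * real l * p * r))"
  define K where "K = (- 1 / (4 * (of_real pi)\<^sup>2) :: complex)"
  define D where "D = (\<lambda>m. \<Sum>\<^sub>\<infinity>n::int. cis (2 * pi * of_int n * \<kappa> m) / (z m + of_int n)\<^sup>2)"
  define ph where "ph = (\<lambda>m j. (-1) powi (int l * m) * cis (- 2 * pi * r * j) * qpow (real l / 2 * (a m)\<^sup>2 + a m * j) \<tau>)"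
  define X where "X = (\<lambda>m. K * E * P m * D m)"
  define Y where "Y = (\<lambda>m. - 1 / (2 * of_real pi) * (\<Sum>\<^sub>\<infinity>m'. H2_term l x c d \<tau> (m, m')))"
  have T: "T > 0" using l \<tau> by (simp add: T_def)
  have Imz: "Im (z m) = a m * Im \<tau>" for m by (simp add: z_def)
  have zi: "z m \<notin> \<int>" for m
  proof (cases "a m = 0")
    case True
    hence "p = of_int m" by (simp add: a_def)
    hence "p \<in> \<int>" by simp
    hence "r \<notin> \<int>" using nz by (simp add: p_def r_def)
    thus ?thesis using True by (auto simp: z_def complex_is_Int_iff) (metis Ints_minus Ints_of_int minus_minus)
  next
    case False
    thus ?thesis using Imz[of m] \<tau> by (auto simp: complex_is_Int_iff)
  qed
  have EP: "E * P m * exp (2 * of_real pi * \<i> * of_real j * z m) = ph m j" for m j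
    unfolding E_def P_def z_def a_def ph_def by (rule eis_row_phase)
  have row: "(\<Sum>\<^sub>\<infinity>n. eis_term l p r \<tau> (m, n)) = P m * (D m + 2 * of_real pi *
      (\<Sum>\<^sub>\<infinity>k::int. of_real (nonhol_f T (of_int k - \<kappa> m)) * exp (2 * of_real pi * \<i> * of_real (of_int k - \<kappa> m) * z m)))" for m
    unfolding eis_term_row[OF \<tau>] infsum_cmult_right' D_def infsum_gauss_dual[OF zi T, symmetric]
    unfolding P_def z_def a_def \<kappa>_def T_def by (rule refl)
  have Yeq: "K * E * (P m * (2 * of_real pi * (\<Sum>\<^sub>\<infinity>k::int. of_real (nonhol_f T (of_int k - \<kappa> m)) * exp (2 * of_real pi * \<i> * of_real (of_int k - \<kappa> m) * z m)))) = Y m" for m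
  proof -
    have "(\<Sum>\<^sub>\<infinity>k::int. of_real (nonhol_f T (of_int k - \<kappa> m)) * ph m (of_int k - \<kappa> m)) = (\<Sum>\<^sub>\<infinity>m'. H2_term l x c d \<tau> (m, m'))"
    \<comment> \<open>The shift by l stems from kappa: for m' = k - l, l (m - p) - (m' + l/2) = -(k
      - kappa), and f is even.\<close>
    proof (rule infsum_reindex_bij_witness[of _ "\<lambda>m'. m' + int l" "\<lambda>k. k - int l"])
      fix k :: int
      define j where "j = of_int k - \<kappa> m"
      have t: "real l * (of_int m - p) - (of_int (k - int l) + real l / 2) = - j"
        by (simp add: j_def \<kappa>_def a_def field_simps)
      have am: "of_int m - p = a m" by (simp add: a_def)
      have e: "- (real l / 2) * (a m)\<^sup>2 + a m * (of_int (k - int l) + real l / 2) = real l / 2 * (a m)\<^sup>2 + a m * j"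
        by (simp add: j_def \<kappa>_def field_simps power2_eq_square)
      have c1: "exp (2 * of_real pi * \<i> * of_real (of_int d * x * - j)) = cis (- 2 * pi * r * j)"
        unfolding cis_conv_exp by (rule arg_cong[where f = exp]) (simp add: r_def)
      have "H2_term l x c d \<tau> (m, k - int l) = (-1) powi (int l * m) * cis (- 2 * pi * r * j) * of_real (nonhol_f T j) * qpow (real l / 2 * (a m)\<^sup>2 + a m * j) \<tau>"
        unfolding H2_term_def Let_def prod.case p_def[symmetric] t f_fun_eq[OF l \<tau>] T_def[symmetric] nonhol_f_minus c1
        by (simp only: am e)
      thus "H2_term l x c d \<tau> (m, k - int l) = of_real (nonhol_f T (of_int k - \<kappa> m)) * ph m (of_int k - \<kappa> m)"
        unfolding ph_def j_def[symmetric] by (simp only: mult_ac)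
    qed auto
    moreover have "K * E * (P m * (2 * of_real pi * (\<Sum>\<^sub>\<infinity>k::int. of_real (nonhol_f T (of_int k - \<kappa> m)) * exp (2 * of_real pi * \<i> * of_real (of_int k - \<kappa> m) * z m)))) =
       (K * (2 * of_real pi)) * (\<Sum>\<^sub>\<infinity>k::int. of_real (nonhol_f T (of_int k - \<kappa> m)) * ph m (of_int k - \<kappa> m))"
      unfolding EP[symmetric] infsum_cmult_right'[symmetric] by (rule infsum_cong) (simp only: mult_ac)
    moreover have "K * (2 * of_real pi) = - 1 / (2 * of_real pi)" by (simp add: K_def power2_eq_square)
    ultimately show ?thesis by (simp only: Y_def)
  qed
  \<comment> \<open>\<open>H1\<close> numbers the rows by n = -m, and m' = l + l m - k gives m' - M
    = -(k - kappa). The odd factor m' - M produces the minus sign.\<close>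
  have H1pt: "H1_term l x c d \<tau> (- m, int l + int l * m - k) = - (of_real (of_int k - \<kappa> m) * ph m (of_int k - \<kappa> m))" for m k
  proof -
    define j where "j = of_int k - \<kappa> m"
    have t: "of_int (int l + int l * m - k) - M = - j"
      by (simp add: j_def \<kappa>_def a_def M_def M_const_def p_def field_simps)
    have e: "real l / 2 * (of_int (- m) + p)\<^sup>2 + (of_int (- m) + p) * - j = real l / 2 * (a m)\<^sup>2 + a m * j"
      by (simp add: a_def power2_eq_square algebra_simps)
    have c1: "exp (2 * of_real pi * \<i> * of_real (- j * of_int d * x)) = cis (- 2 * pi * r * j)"
      unfolding cis_conv_exp by (rule arg_cong[where f = exp]) (simp add: r_def)
    have s: "(-1) powi (int l * - m) = ((-1) powi (int l * m) :: complex)"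
      unfolding neg_one_powi by (rule cis_pi_of_int_neq) simp
    show ?thesis
      unfolding H1_term_def Let_def prod.case p_def[symmetric] M_def[symmetric] t e c1 s ph_def j_def[symmetric]
      by simp
  qed
  have Mk: "(of_int k < \<kappa> m) = (of_int (int l + int l * m - k) > M)" "(of_int k > \<kappa> m) = (of_int (int l + int l * m - k) < M)" for k m
    by (auto simp: \<kappa>_def a_def M_def M_const_def p_def field_simps)
  \<comment> \<open>For m < p the point z m lies in the lower half-plane, so the frequencies k <
    kappa occur, and these correspond to m' > M.\<close>
  have Xpos: "X m = (\<Sum>\<^sub>\<infinity>m'\<in>{m'. of_int m' \<ge> M}. H1_term l x c d \<tau> (- m, m'))" if "of_int m < p" for m
  proof -
    have "Im (z m) < 0" unfolding Imz using that \<tau> by (simp add: a_def mult_neg_pos)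
    from has_sum_cmult_right[OF has_sum_lipschitz_lower[OF this, of "\<kappa> m"], of "- (E * P m)"]
    have "((\<lambda>k. - (of_real (of_int k - \<kappa> m) * (E * P m * exp (2 * of_real pi * \<i> * of_real (of_int k - \<kappa> m) * z m)))) has_sum X m) {k. of_int k < \<kappa> m}"
      unfolding X_def K_def D_def by (simp add: mult_ac)
    hence "((\<lambda>k. H1_term l x c d \<tau> (- m, int l + int l * m - k)) has_sum X m) {k. of_int k < \<kappa> m}"
      by (simp only: EP H1pt)
    hence "((\<lambda>m'. H1_term l x c d \<tau> (- m, m')) has_sum X m) {m'. of_int m' > M}"
      by (rule has_sum_reindex_bij_witness[of _ "\<lambda>m'. int l + int l * m - m'" "\<lambda>k. int l + int l * m - k", THEN iffD1, rotated -1]) (auto simp: Mk)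
    \<comment> \<open>Adding the index m' = M changes nothing, because its term carries the factor
      m' - M.\<close>
    hence "((\<lambda>m'. H1_term l x c d \<tau> (- m, m')) has_sum X m) {m'. of_int m' \<ge> M}"
      by (rule has_sum_cong_neutral[THEN iffD1, rotated -1]) (auto simp: H1_term_def Let_def M_def[symmetric])
    thus ?thesis by (rule infsumI[symmetric])
  qed
  have Xneg: "X m = - (\<Sum>\<^sub>\<infinity>m'\<in>{m'. of_int m' < M}. H1_term l x c d \<tau> (- m, m'))" if "of_int m > p" for m
  proof -
    have "Im (z m) > 0" unfolding Imz using that \<tau> by (simp add: a_def)
    from has_sum_cmult_right[OF has_sum_lipschitz_upper[OF this, of "\<kappa> m"], of "- (E * P m)"]
    have "((\<lambda>k. - (of_real (of_int k - \<kappa> m) * (E * P m * exp (2 * of_real pi * \<i> * of_real (of_int k - \<kappa> m) * z m)))) has_sum - X m) {k. of_int k > \<kappa> m}"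
      unfolding X_def K_def D_def by (simp add: mult_ac)
    hence "((\<lambda>k. H1_term l x c d \<tau> (- m, int l + int l * m - k)) has_sum - X m) {k. of_int k > \<kappa> m}"
      by (simp only: EP H1pt)
    hence "((\<lambda>m'. H1_term l x c d \<tau> (- m, m')) has_sum - X m) {m'. of_int m' < M}"
      by (rule has_sum_reindex_bij_witness[of _ "\<lambda>m'. int l + int l * m - m'" "\<lambda>k. int l + int l * m - k", THEN iffD1, rotated -1]) (auto simp: Mk)
    thus ?thesis by (simp add: infsumI)
  qed
  have Xzero: "X m = of_real (C_const l x c d)" if m: "of_int m = p" for m
  proof -
    have am: "a m = 0" using m by (simp add: a_def)
    have "p \<in> \<int>" using m by (metis Ints_of_int)
    hence r: "r \<notin> \<int>" using nz by (simp add: p_def r_def)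
    have "X m = - 1 / (4 * (of_real pi)\<^sup>2) * cis (- (pi * real l * p * r)) * cis (pi * real l * (of_int m + of_int m * r)) *
       (\<Sum>\<^sub>\<infinity>n::int. cis (2 * pi * of_int n * (real l / 2)) / (- of_real r + of_int n)\<^sup>2)"
      by (simp add: X_def K_def E_def P_def D_def am \<kappa>_def z_def)
    also have "\<dots> = of_real (C_const l x c d)"
      using C_const_eq[of c x m d l] m r by (simp add: p_def r_def)
    finally show ?thesis .
  qed
  \<comment> \<open>There is at most one such row. If p is not an integer there is none, and then
    the delta in \<open>C_const\<close> vanishes as well.\<close>
  have hs0: "(X has_sum of_real (C_const l x c d)) {m. of_int m = p}"
  proof (cases "p \<in> \<int>")
    case True
    then obtain m0 where m0: "p = of_int m0" by (auto elim: Ints_cases)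
    have "{m. of_int m = p} = {m0}" by (auto simp: m0)
    thus ?thesis using Xzero[of m0] m0 by (intro has_sum_finiteI) auto
  next
    case False
    hence "{m. of_int m = p} = {}" by (auto simp: Ints_def)
    moreover have "C_const l x c d = 0" using False by (simp add: C_const_def delta_def p_def)
    ultimately show ?thesis by simp
  qed
  have pos_eq: "H1_index_pos l x c = Sigma {n. of_int n > - p} (\<lambda>_. {m'. of_int m' \<ge> M})"
    by (auto simp: H1_index_pos_def p_def M_def)
  have neg_eq: "H1_index_neg l x c = Sigma {n. of_int n < - p} (\<lambda>_. {m'. of_int m' < M})"
    by (auto simp: H1_index_neg_def p_def M_def)
  have "((\<lambda>n. \<Sum>\<^sub>\<infinity>m'\<in>{m'. of_int m' \<ge> M}. H1_term l x c d \<tau> (n, m')) has_sum infsum (H1_term l x c d \<tau>) (H1_index_pos l x c)) {n. of_int n > - p}"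
    using has_sum_rows[OF H1_term_summable(1)[OF l \<tau>, of x c d, unfolded pos_eq]] unfolding pos_eq .
  hence hs1: "(X has_sum infsum (H1_term l x c d \<tau>) (H1_index_pos l x c)) {m. of_int m < p}"
    by (rule has_sum_reindex_bij_witness[of _ uminus uminus, THEN iffD1, rotated -1]) (auto simp: Xpos)
  have "((\<lambda>n. \<Sum>\<^sub>\<infinity>m'\<in>{m'. of_int m' < M}. H1_term l x c d \<tau> (n, m')) has_sum infsum (H1_term l x c d \<tau>) (H1_index_neg l x c)) {n. of_int n < - p}"
    using has_sum_rows[OF H1_term_summable(2)[OF l \<tau>, of x c d, unfolded neg_eq]] unfolding neg_eq .
  hence "((\<lambda>n. - (\<Sum>\<^sub>\<infinity>m'\<in>{m'. of_int m' < M}. H1_term l x c d \<tau> (n, m'))) has_sum - infsum (H1_term l x c d \<tau>) (H1_index_neg l x c)) {n. of_int n < - p}"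
    by (rule has_sum_uminusI)
  hence hs2: "(X has_sum - infsum (H1_term l x c d \<tau>) (H1_index_neg l x c)) {m. of_int m > p}"
    by (rule has_sum_reindex_bij_witness[of _ uminus uminus, THEN iffD1, rotated -1]) (auto simp: Xneg)
  have "(X has_sum (of_real (C_const l x c d) + infsum (H1_term l x c d \<tau>) (H1_index_pos l x c) + - infsum (H1_term l x c d \<tau>) (H1_index_neg l x c)))
     ({m. of_int m = p} \<union> {m. of_int m < p} \<union> {m. of_int m > p})"
    by (intro has_sum_Un_disjoint hs0 hs1 hs2) auto
  moreover have "{m. of_int m = p} \<union> {m. of_int m < p} \<union> {m. of_int m > p} = (UNIV :: int set)" by auto
  ultimately have HX: "(X has_sum H1 l x c d \<tau>) UNIV" by (simp add: H1_def add_diff_eq)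
  have HY: "(Y has_sum H2 l x c d \<tau>) UNIV"
    unfolding Y_def H2_def
    using has_sum_rows[of "H2_term l x c d \<tau>" UNIV "\<lambda>_. UNIV"] abs_summable_summable[OF H2_term_abs_summable[OF l \<tau>, of x c d]]
    by (intro has_sum_cmult_right) (simp only: UNIV_Times_UNIV)
  have "eis_term l p r \<tau> summable_on UNIV"
    using abs_summable_summable[OF eis_term_abs_summable[OF l \<tau> nz]] unfolding p_def r_def .
  hence "((\<lambda>m. \<Sum>\<^sub>\<infinity>n. eis_term l p r \<tau> (m, n)) has_sum eis l p r \<tau>) UNIV"
    using has_sum_rows[of "eis_term l p r \<tau>" UNIV "\<lambda>_. UNIV"] unfolding eis_def by (simp only: UNIV_Times_UNIV)
  hence "((\<lambda>m. K * E * (\<Sum>\<^sub>\<infinity>n. eis_term l p r \<tau> (m, n))) has_sum K * E * eis l p r \<tau>) UNIV"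
    by (rule has_sum_cmult_right)
  also have "(\<lambda>m. K * E * (\<Sum>\<^sub>\<infinity>n. eis_term l p r \<tau> (m, n))) = (\<lambda>m. X m + Y m)"
    unfolding row Yeq[symmetric] X_def by (simp add: algebra_simps)
  finally have "((\<lambda>m. X m + Y m) has_sum K * E * eis l p r \<tau>) UNIV" .
  from has_sum_unique[OF has_sum_add[OF HX HY] this]
  have "H1 l x c d \<tau> + H2 l x c d \<tau> = K * E * eis l p r \<tau>" .
  thus "H1 l x c d \<tau> + H2 l x c d \<tau> = - 1 / (4 * (of_real pi)\<^sup>2) * cis (- (pi * real l * p * r)) * eis l p r \<tau>"
    unfolding K_def E_def .
  from HX show "((\<lambda>m::int. - 1 / (4 * (of_real pi)\<^sup>2) * cis (- (pi * real l * p * r)) *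
       (cis (pi * real l * (of_int m + of_int m * r)) * exp (of_real pi * \<i> * of_nat l * of_real (of_int m - p) * (of_real (of_int m - p) * \<tau> - of_real r))) *
       (\<Sum>\<^sub>\<infinity>n::int. cis (2 * pi * of_int n * (real l * (2 * (of_int m - p) + 1) / 2)) / (of_real (of_int m - p) * \<tau> - of_real r + of_int n)\<^sup>2))
       has_sum H1 l x c d \<tau>) UNIV"
    unfolding X_def K_def E_def P_def D_def z_def \<kappa>_def a_def .
qed

subsection \<open>The derivative of the completed Appell function\<close>

lemma wirtinger_eqI:
  assumes "((\<lambda>t::real. F (u + of_real t)) has_vector_derivative D1) (at 0)"
    and "((\<lambda>t::real. F (u + \<i> * of_real t)) has_vector_derivative D2) (at 0)"
  shows "wirtinger F u = 1/2 * (D1 - \<i> * D2)"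
  using assms by (simp add: wirtinger_def vector_derivative_at)

text \<open>The closed form of the series of (k - theta) W^k minus that of its tail. As a rational
  identity it also holds for |W| >= 1, which occurs in the rows n <= 0. It isolates the finite
  difference between a Lipschitz row and the corresponding term of the derivative of
  \<open>A_fun\<close>.\<close>

lemma geometric_deriv_partial:
  fixes W \<theta> :: "'a::field"
  assumes "W \<noteq> 1" "N \<ge> 1"
  shows "(\<Sum>k\<in>{1..<N}. (of_nat k - \<theta>) * W ^ k) =
    (W / (1 - W)\<^sup>2 - \<theta> * W / (1 - W)) - W ^ N * ((of_nat N - \<theta>) / (1 - W) + W / (1 - W)\<^sup>2)"
  using assms(2)
proof (induction N rule: dec_induct)
  case base
  define v where "v = 1 - W"
  have v: "v \<noteq> 0" "W = 1 - v" using assms by (auto simp: v_def)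
  have "W / v\<^sup>2 - \<theta> * W / v = W * ((1 - \<theta>) / v + W / v\<^sup>2)"
    using v(1) unfolding v(2) by (simp add: field_simps power2_eq_square)
  thus ?case by (simp add: v_def)
next
  case (step N)
  define v where "v = 1 - W"
  have v: "v \<noteq> 0" "W = 1 - v" using assms by (auto simp: v_def)
  have "(\<Sum>k\<in>{1..<Suc N}. (of_nat k - \<theta>) * W ^ k) = (\<Sum>k\<in>{1..<N}. (of_nat k - \<theta>) * W ^ k) + (of_nat N - \<theta>) * W ^ N"
    using step by simp
  also have "\<dots> = (W / v\<^sup>2 - \<theta> * W / v) - W ^ N * ((of_nat N - \<theta>) / v + W / v\<^sup>2 - (of_nat N - \<theta>))"
    unfolding step.IH v_def by (simp add: algebra_simps)
  also have "(of_nat N - \<theta>) / v + W / v\<^sup>2 - (of_nat N - \<theta>) = W * ((of_nat (Suc N) - \<theta>) / v + W / v\<^sup>2)"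
    using v(1) unfolding v(2) by (simp add: field_simps power2_eq_square)
  finally show ?case by (simp add: v_def mult_ac)
qed

text \<open>\<open>\<omega>\<close> is a direction: 1 and i give the two partial derivatives, and
  linearity in it reflects that \<open>A_fun\<close> is holomorphic in u. Termwise differentiation
  needs V/(1 - V)^2 bounded uniformly in n and in small t. For n = 0 this holds because x is not an
  integer, for the other n because V keeps away from the unit circle.\<close>

lemma has_vector_derivative_A_fun:
  fixes l :: nat and x :: real and \<omega> \<tau> :: complex
  assumes l: "l \<ge> 1" and \<tau>: "Im \<tau> > 0" and x: "x \<notin> \<int>" and \<omega>: "norm \<omega> \<le> 1"
  defines "W \<equiv> \<lambda>n::int. exp (2 * of_real pi * \<i> * (- of_real x)) * qpow (of_int n) \<tau>"
  defines "\<alpha> \<equiv> \<lambda>n::int. (-1) powi (int l * n) * qpow (real l * of_int n * (of_int n + 1) / 2) \<tau> * exp (of_real pi * \<i> * of_nat l * (- of_real x)) *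
     (of_real (real l / 2) / (1 - W n) + W n / (1 - W n)\<^sup>2)"
  shows "\<alpha> summable_on UNIV"
    and "((\<lambda>t. A_fun l (\<omega> * of_real t - of_real x) \<tau>) has_vector_derivative \<omega> * (2 * of_real pi * \<i> * (\<Sum>\<^sub>\<infinity>n. \<alpha> n))) (at 0)"
proof -
  define y where "y = Im \<tau>"
  have y: "y > 0" using \<tau> by (simp add: y_def)
  define U where "U = (\<lambda>t::real. exp (2 * of_real pi * \<i> * (\<omega> * of_real t - of_real x)))"
  define V where "V = (\<lambda>(n::int) t. U t * qpow (of_int n) \<tau>)"
  define Q where "Q = (\<lambda>n::int. (-1) powi (int l * n) * qpow (real l * of_int n * (of_int n + 1) / 2) \<tau>)"
  define b where "b = (\<lambda>n t. Q n / (1 - V n t))"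
  define b' where "b' = (\<lambda>n t. 2 * of_real pi * \<i> * \<omega> * Q n * (V n t / (1 - V n t)\<^sup>2))"
  \<comment> \<open>For |t| < y/2 the modulus of U lies between exp(-pi y) and exp(pi y), so |V n t|
    is at most q1 for n >= 1 and at least 1/q1 for n <= -1.\<close>
  define q1 where "q1 = exp (- pi * y)"
  have q1: "0 < q1" "q1 < 1" using y by (auto simp: q1_def)
  define C0 where "C0 = 1 / (1 - q1)\<^sup>2"
  have C0: "C0 \<ge> 1" using q1 by (auto simp: C0_def power_le_one)
  have normU: "exp (- 2 * pi * \<bar>t\<bar>) \<le> norm (U t)" "norm (U t) \<le> exp (2 * pi * \<bar>t\<bar>)" for t
  proof -
    have "\<bar>Im \<omega>\<bar> \<le> 1" using abs_Im_le_cmod[of \<omega>] \<omega> by linarith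
    hence "\<bar>Im \<omega> * t\<bar> \<le> \<bar>t\<bar>" by (simp add: abs_mult mult_left_le_one_le)
    hence "\<bar>2 * pi * (Im \<omega> * t)\<bar> \<le> 2 * pi * \<bar>t\<bar>" by (simp add: abs_mult)
    moreover have "norm (U t) = exp (- (2 * pi * (Im \<omega> * t)))" by (simp add: U_def)
    ultimately show "exp (- 2 * pi * \<bar>t\<bar>) \<le> norm (U t)" "norm (U t) \<le> exp (2 * pi * \<bar>t\<bar>)"
      unfolding abs_le_iff by (simp_all only: exp_le_cancel_iff) linarith+
  qed
  have small: "norm (v / (1 - v)\<^sup>2) \<le> C0 \<and> v \<noteq> 1 \<and> 1 / norm (1 - v) \<le> C0" if "norm v \<le> q1" for v :: complex
  proof -
    have nv: "1 - q1 \<le> norm (1 - v)" using norm_triangle_ineq2[of 1 v] that by simp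
    have "v \<noteq> 1" using that q1 by auto
    moreover have "norm (v / (1 - v)\<^sup>2) \<le> 1 / (1 - q1)\<^sup>2"
      unfolding norm_divide norm_power using nv q1 that by (intro frac_le power_mono) auto
    moreover have "1 / norm (1 - v) \<le> C0"
    proof -
      have "1 / norm (1 - v) \<le> 1 / (1 - q1)" using nv q1 by (intro divide_left_mono mult_pos_pos) auto
      also have "\<dots> \<le> 1 / (1 - q1)\<^sup>2" using q1 by (intro divide_left_mono) (auto simp: power2_eq_square mult_left_le)
      finally show ?thesis by (simp add: C0_def)
    qed
    ultimately show ?thesis by (simp add: C0_def)
  qed
  have Vbound: "norm (V n t / (1 - V n t)\<^sup>2) \<le> C0 \<and> V n t \<noteq> 1 \<and> 1 / norm (1 - V n t) \<le> C0" if "n \<noteq> 0" "\<bar>t\<bar> < y / 2" for n t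
  proof (cases "n > 0")
    case True
    have "norm (V n t) = norm (U t) * exp (- 2 * pi * of_int n * y)" by (simp add: V_def norm_mult norm_qpow y_def qpow_def)
    also have "\<dots> \<le> exp (2 * pi * \<bar>t\<bar>) * exp (- 2 * pi * of_int n * y)" by (intro mult_right_mono normU) auto
    also have "\<dots> \<le> q1"
    proof -
      have "1 * y \<le> of_int n * y" using True y by (intro mult_right_mono) auto
      hence "2 * \<bar>t\<bar> - 2 * (of_int n * y) \<le> - y" using that by linarith
      hence "pi * (2 * \<bar>t\<bar> - 2 * (of_int n * y)) \<le> pi * - y" by (intro mult_left_mono) auto
      thus ?thesis unfolding q1_def exp_add[symmetric] exp_le_cancel_iff by (simp add: algebra_simps)
    qed
    finally show ?thesis by (rule small)
  next
    case False
    have Vn: "norm (V n t) = norm (U t) * exp (- 2 * pi * of_int n * y)" by (simp add: V_def norm_mult y_def qpow_def)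
    have V0: "V n t \<noteq> 0" by (simp add: V_def U_def qpow_def)
    have "1 / q1 = exp (pi * y)" by (simp add: q1_def exp_minus inverse_eq_divide)
    also have "\<dots> \<le> exp (- 2 * pi * \<bar>t\<bar>) * exp (- 2 * pi * of_int n * y)"
    proof -
      have "of_int n \<le> (-1 :: real)" using False that by linarith
      hence "of_int n * y \<le> -1 * y" using y by (intro mult_right_mono) auto
      hence "y \<le> - 2 * \<bar>t\<bar> - 2 * (of_int n * y)" using that by linarith
      hence "pi * y \<le> pi * (- 2 * \<bar>t\<bar> - 2 * (of_int n * y))" by (intro mult_left_mono) auto
      thus ?thesis unfolding exp_add[symmetric] exp_le_cancel_iff by (simp add: algebra_simps)
    qed
    also have "\<dots> \<le> norm (V n t)" unfolding Vn by (intro mult_right_mono normU) auto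
    finally have big: "1 / q1 \<le> norm (V n t)" .
    \<comment> \<open>v/(1 - v)^2 is invariant under v -> 1/v, so negative n reduce to the estimate
      \<open>small\<close>.\<close>
    define v where "v = 1 / V n t"
    have nv: "norm v \<le> q1" using big q1 V0 by (simp add: v_def norm_divide field_simps)
    have Vv: "V n t = 1 / v" "v \<noteq> 0" using V0 by (auto simp: v_def)
    have v1: "v \<noteq> 1" using small[OF nv] by simp
    have "V n t / (1 - V n t)\<^sup>2 = v / (1 - v)\<^sup>2"
      unfolding Vv(1) using Vv(2) v1 by (simp add: field_simps power2_eq_square)
    moreover have "1 / norm (1 - V n t) \<le> C0"
    proof -
      have "1 - V n t = (v - 1) / v" unfolding Vv(1) using Vv(2) by (simp add: field_simps)
      hence "1 / norm (1 - V n t) = norm v * (1 / norm (1 - v))" by (simp add: norm_divide norm_minus_commute)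
      also have "\<dots> \<le> 1 * C0" using small[OF nv] nv q1 by (intro mult_mono) auto
      finally show ?thesis by simp
    qed
    ultimately show ?thesis using small[OF nv] v1 Vv by auto
  qed
  have V0t: "V 0 t = U t" for t by (simp add: V_def qpow_def)
  have U01: "U 0 \<noteq> 1"
    using exp_eq_1_imp_Ints[of "- of_real x"] x
    by (auto simp: U_def complex_is_Int_iff) (metis Ints_minus Ints_of_int minus_minus)
  have Uc: "isCont U 0" unfolding U_def by (intro continuous_intros)
  have "((\<lambda>t. norm (U t / (1 - U t)\<^sup>2)) \<longlongrightarrow> norm (U 0 / (1 - U 0)\<^sup>2)) (at 0)"
    using Uc U01 by (intro tendsto_intros) (auto simp: isCont_def)
  hence "\<forall>\<^sub>F t in at 0. norm (U t / (1 - U t)\<^sup>2) < norm (U 0 / (1 - U 0)\<^sup>2) + 1"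
    by (rule order_tendstoD) simp
  moreover have "\<forall>\<^sub>F t in at 0. U t \<noteq> 1"
    using Uc U01 unfolding isCont_def by (rule tendsto_imp_eventually_ne)
  ultimately have "\<forall>\<^sub>F t in at 0. norm (U t / (1 - U t)\<^sup>2) \<le> norm (U 0 / (1 - U 0)\<^sup>2) + 1 \<and> U t \<noteq> 1"
    by eventually_elim auto
  then obtain e0 where e0: "e0 > 0" "\<And>t. t \<noteq> 0 \<Longrightarrow> \<bar>t\<bar> < e0 \<Longrightarrow> norm (U t / (1 - U t)\<^sup>2) \<le> norm (U 0 / (1 - U 0)\<^sup>2) + 1 \<and> U t \<noteq> 1"
    unfolding eventually_at by (auto simp: dist_real_def)
  hence e0': "norm (U t / (1 - U t)\<^sup>2) \<le> norm (U 0 / (1 - U 0)\<^sup>2) + 1 \<and> U t \<noteq> 1" if "\<bar>t\<bar> < e0" for t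
    using U01 that by (cases "t = 0") auto
  define e where "e = min e0 (y / 2)"
  have e: "e > 0" using e0 y by (simp add: e_def)
  define C where "C = C0 + norm (U 0 / (1 - U 0)\<^sup>2) + 1 + 1 / norm (1 - U 0)"
  have C: "norm (V n t / (1 - V n t)\<^sup>2) \<le> C" "V n t \<noteq> 1" if "\<bar>t\<bar> < e" for n t
    using Vbound[of n t] e0'[of t] that C0 unfolding C_def e_def by (cases "n = 0"; force simp: V0t add_nonneg_nonneg add_increasing2)+
  have C': "1 / norm (1 - V n 0) \<le> C" for n
    using Vbound[of n 0] C0 y unfolding C_def by (cases "n = 0"; force simp: V0t add_nonneg_nonneg add_increasing2)+
  have Qs: "(\<lambda>n. norm (Q n)) summable_on UNIV"
  proof (rule summable_on_comparison_test)
    show "(\<lambda>n::int. exp ((pi * y * real l) * \<bar>real_of_int n\<bar> - (pi * y * real l) * (real_of_int n)\<^sup>2)) summable_on UNIV"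
      using l y by (intro summable_on_int_gauss) auto
    fix n :: int
    have "norm (Q n) = exp (- (pi * y * real l) * (of_int n + (of_int n)\<^sup>2))"
    proof -
      have "norm (Q n) = exp (- 2 * pi * (real l * of_int n * (of_int n + 1) / 2) * y)"
        by (simp add: Q_def norm_mult norm_power_int norm_qpow y_def)
      also have "- 2 * pi * (real l * of_int n * (of_int n + 1) / 2) * y = - (pi * y * real l) * (of_int n + (of_int n)\<^sup>2)"
        by (simp add: power2_eq_square field_simps)
      finally show ?thesis .
    qed
    also have "\<dots> \<le> exp ((pi * y * real l) * \<bar>real_of_int n\<bar> - (pi * y * real l) * (real_of_int n)\<^sup>2)"
    proof -
      have "(pi * y * real l) * - of_int n \<le> (pi * y * real l) * \<bar>real_of_int n\<bar>" using l y by (intro mult_left_mono) auto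
      thus ?thesis by (simp add: algebra_simps)
    qed
    finally show "norm (Q n) \<le> exp ((pi * y * real l) * \<bar>real_of_int n\<bar> - (pi * y * real l) * (real_of_int n)\<^sup>2)" .
  qed simp
  have b0s: "(\<lambda>n. b n 0) summable_on UNIV"
  proof (rule abs_summable_summable, rule Infinite_Sum.abs_summable_on_comparison_test')
    show "(\<lambda>n. norm (Q n) * C) summable_on UNIV" by (intro summable_on_cmult_left Qs)
    show "norm (b n 0) \<le> norm (Q n) * C" for n
      using mult_left_mono[OF C'[of n], of "norm (Q n)"] by (simp add: b_def norm_divide)
  qed
  have Vder: "(V n has_vector_derivative 2 * of_real pi * \<i> * \<omega> * V n t) (at t)" for n t
  proof -
    have "((\<lambda>s. exp (2 * of_real pi * \<i> * (\<omega> * s - of_real x)) * qpow (of_int n) \<tau>) has_field_derivative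
        2 * of_real pi * \<i> * \<omega> * V n t) (at (of_real t))"
      by (auto intro!: derivative_eq_intros simp: V_def U_def)
    from has_vector_derivative_real_field[OF this] show ?thesis by (simp add: V_def[abs_def] U_def)
  qed
  have bder: "(b n has_vector_derivative b' n t) (at t)" if "\<bar>t\<bar> < e" for n t
  proof -
    have ne: "1 - V n t \<noteq> 0" using C(2)[OF that, of n] by simp
    have "((\<lambda>v. Q n / (1 - v)) has_field_derivative (Q n / (1 - V n t)\<^sup>2)) (at (V n t))"
      using ne by (auto intro!: derivative_eq_intros simp: power2_eq_square)
    from field_vector_diff_chain_at[OF Vder this]
    show ?thesis by (simp add: b_def[abs_def] b'_def o_def mult_ac)
  qed
  have sumder: "((\<lambda>t. \<Sum>\<^sub>\<infinity>n. b n t) has_vector_derivative (\<Sum>\<^sub>\<infinity>n. b' n 0)) (at 0)"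
  proof (rule has_vector_derivative_infsum[OF e])
    show "(\<lambda>n. (2 * pi * C) * norm (Q n)) summable_on UNIV" by (intro summable_on_cmult_right Qs)
    show "norm (b' n t) \<le> (2 * pi * C) * norm (Q n)" if "\<bar>t - 0\<bar> < e" for n t
    proof -
      have "norm (b' n t) = (2 * pi * norm (Q n)) * (norm \<omega> * norm (V n t / (1 - V n t)\<^sup>2))"
        by (simp add: b'_def norm_mult norm_divide norm_power)
      also have "\<dots> \<le> (2 * pi * norm (Q n)) * (1 * C)"
        using that \<omega> C(1)[of t n] by (intro mult_left_mono mult_mono) auto
      finally show ?thesis by (simp add: mult_ac)
    qed
  qed (use bder b0s in auto)
  define X0 where "X0 = exp (of_real pi * \<i> * of_nat l * (- of_real x))"
  define g where "g = (\<lambda>t::real. exp (of_real pi * \<i> * of_nat l * (\<omega> * of_real t - of_real x)))"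
  have g0: "g 0 = X0" by (simp add: g_def X0_def)
  have gder: "(g has_vector_derivative of_real pi * \<i> * of_nat l * \<omega> * X0) (at 0)"
  proof -
    have "((\<lambda>s. exp (of_real pi * \<i> * of_nat l * (\<omega> * s - of_real x))) has_field_derivative
        of_real pi * \<i> * of_nat l * \<omega> * X0) (at (of_real 0))"
      by (auto intro!: derivative_eq_intros simp: X0_def)
    from has_vector_derivative_real_field[OF this] show ?thesis by (simp add: g_def[abs_def])
  qed
  have Aeq: "A_fun l (\<omega> * of_real t - of_real x) \<tau> = g t * (\<Sum>\<^sub>\<infinity>n. b n t)" for t
    by (simp add: A_fun_def g_def b_def Q_def V_def U_def)
  have b's: "(\<lambda>n. b' n 0) summable_on UNIV"
  proof (rule abs_summable_summable, rule Infinite_Sum.abs_summable_on_comparison_test')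
    show "(\<lambda>n. (2 * pi * C) * norm (Q n)) summable_on UNIV" by (intro summable_on_cmult_right Qs)
    show "norm (b' n 0) \<le> (2 * pi * C) * norm (Q n)" for n
    proof -
      have "norm (b' n 0) = (2 * pi * norm (Q n)) * (norm \<omega> * norm (V n 0 / (1 - V n 0)\<^sup>2))"
        by (simp add: b'_def norm_mult norm_divide norm_power)
      also have "\<dots> \<le> (2 * pi * norm (Q n)) * (1 * C)"
        using \<omega> C(1)[of 0 n] e by (intro mult_left_mono mult_mono) auto
      finally show ?thesis by (simp add: mult_ac)
    qed
  qed
  have WV: "W n = V n 0" for n by (simp add: W_def V_def U_def)
  have cs: "(\<lambda>n. Q n * (V n 0 / (1 - V n 0)\<^sup>2)) summable_on UNIV"
  proof (rule abs_summable_summable, rule Infinite_Sum.abs_summable_on_comparison_test')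
    show "(\<lambda>n. norm (Q n) * C) summable_on UNIV" by (intro summable_on_cmult_left Qs)
    fix n
    have "norm (V n 0 / (1 - V n 0)\<^sup>2) \<le> C" using C(1)[of 0 n] e by simp
    from mult_left_mono[OF this norm_ge_zero[of "Q n"]]
    show "norm (Q n * (V n 0 / (1 - V n 0)\<^sup>2)) \<le> norm (Q n) * C" by (simp only: norm_mult)
  qed
  \<comment> \<open>The coefficient l/2 is the ratio of pi i l, from differentiating the exponential
    prefactor, to the 2 pi i that comes from the denominators.\<close>
  have \<alpha>eq: "\<alpha> n = X0 * of_real (real l / 2) * b n 0 + X0 * (Q n * (V n 0 / (1 - V n 0)\<^sup>2))" for n
    by (simp add: \<alpha>_def WV X0_def b_def Q_def distrib_left mult_ac)
  have "((\<lambda>n. \<alpha> n) has_sum (X0 * of_real (real l / 2) * (\<Sum>\<^sub>\<infinity>n. b n 0) + X0 * (\<Sum>\<^sub>\<infinity>n. Q n * (V n 0 / (1 - V n 0)\<^sup>2)))) UNIV"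
    unfolding \<alpha>eq by (intro has_sum_add has_sum_cmult_right has_sum_infsum b0s cs)
  thus "\<alpha> summable_on UNIV" and
    "((\<lambda>t. A_fun l (\<omega> * of_real t - of_real x) \<tau>) has_vector_derivative \<omega> * (2 * of_real pi * \<i> * (\<Sum>\<^sub>\<infinity>n. \<alpha> n))) (at 0)"
  proof -
    assume hs: "((\<lambda>n. \<alpha> n) has_sum (X0 * of_real (real l / 2) * (\<Sum>\<^sub>\<infinity>n. b n 0) + X0 * (\<Sum>\<^sub>\<infinity>n. Q n * (V n 0 / (1 - V n 0)\<^sup>2)))) UNIV"
    show "\<alpha> summable_on UNIV" using hs by (rule has_sum_imp_summable)
    have "(\<Sum>\<^sub>\<infinity>n. b' n 0) = 2 * of_real pi * \<i> * \<omega> * (\<Sum>\<^sub>\<infinity>n. Q n * (V n 0 / (1 - V n 0)\<^sup>2))"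
      unfolding b'_def mult.assoc by (simp only: infsum_cmult_right')
    hence "\<omega> * (2 * of_real pi * \<i> * (\<Sum>\<^sub>\<infinity>n. \<alpha> n)) = g 0 * (\<Sum>\<^sub>\<infinity>n. b' n 0) + of_real pi * \<i> * of_nat l * \<omega> * X0 * (\<Sum>\<^sub>\<infinity>n. b n 0)"
      unfolding infsumI[OF hs] g0 by (simp add: algebra_simps)
    thus "((\<lambda>t. A_fun l (\<omega> * of_real t - of_real x) \<tau>) has_vector_derivative \<omega> * (2 * of_real pi * \<i> * (\<Sum>\<^sub>\<infinity>n. \<alpha> n))) (at 0)"
      unfolding Aeq using has_vector_derivative_mult[OF gder sumder] by simp
  qed
qed

section \<open>The derivative of the \<open>R_fun\<close> part\<close>

definition R_coeff :: "nat \<Rightarrow> nat \<Rightarrow> real \<Rightarrow> complex \<Rightarrow> int \<Rightarrow> complex" where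
  "R_coeff l m x \<tau> k = (let \<nu> = real_of_int k + 1/2 in
     exp (2 * of_real pi * \<i> * of_nat m * (- of_real x)) * (-1) powi k * qpow (- \<nu>\<^sup>2 / 2) (of_nat l * \<tau>)
     * exp (- 2 * of_real pi * \<i> * of_real \<nu> * (- of_nat l * of_real x - of_nat m * \<tau> - (of_nat l - 1) / 2)))"

text \<open>With nu = k + 1/2 the exponentials of the k-th term depend on u through exp(-2 pi i (l
  nu - m) u), and (l nu - m)/l is also the argument of E at real u up to the square root. This
  number becomes the argument t of f. \<open>R_coeff\<close> is the k-th term at u = -x without its
  factor sgn - E.\<close>

definition R_shift :: "nat \<Rightarrow> nat \<Rightarrow> int \<Rightarrow> real" where
  "R_shift l m k = real l * (of_int k + 1/2) - real m"

lemma norm_R_coeff_le: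
  assumes l: "l \<ge> 1" and \<tau>: "Im \<tau> > 0"
  shows "norm (R_coeff l m x \<tau> k) \<le> exp (pi * Im \<tau> * (R_shift l m k)\<^sup>2 / real l)"
proof -
  define \<nu> where "\<nu> = real_of_int k + 1/2"
  define y where "y = Im \<tau>"
  have L: "real l > 0" using l by simp
  have "norm (R_coeff l m x \<tau> k) = exp (- 2 * pi * (- \<nu>\<^sup>2 / 2) * (real l * y)) * exp (2 * pi * \<nu> * (- (real m * y)))"
    unfolding R_coeff_def Let_def \<nu>_def[symmetric]
    by (simp add: norm_mult norm_power_int norm_qpow y_def)
  also have "\<dots> = exp (pi * y * ((R_shift l m k)\<^sup>2 - (real m)\<^sup>2) / real l)"
    unfolding exp_add[symmetric] R_shift_def \<nu>_def[symmetric] using L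
    by (intro arg_cong[where f = exp]) (simp add: field_simps power2_eq_square)
  also have "\<dots> \<le> exp (pi * y * (R_shift l m k)\<^sup>2 / real l)"
    unfolding exp_le_cancel_iff using L \<tau> by (intro divide_right_mono mult_left_mono) (auto simp: y_def)
  finally show ?thesis by (simp add: y_def)
qed

lemma exp_times_R_fun:
  fixes l m :: nat and x t :: real and \<omega> \<tau> :: complex
  assumes l: "l \<ge> 1" and \<tau>: "Im \<tau> > 0"
  defines "u \<equiv> \<omega> * of_real t - of_real x"
  shows "exp (2 * of_real pi * \<i> * of_nat m * u) * R_fun (of_nat l * u - of_nat m * \<tau> - (of_nat l - 1) / 2) (of_nat l * \<tau>) =
    (\<Sum>\<^sub>\<infinity>k. of_real (sgn (real_of_int k + 1/2) - E_fun ((R_shift l m k / real l + t * Im \<omega> / Im \<tau>) * sqrt (2 * real l * Im \<tau>))) *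
       (R_coeff l m x \<tau> k * exp (- 2 * of_real pi * \<i> * of_real (R_shift l m k) * \<omega> * of_real t)))"
  unfolding R_fun_def infsum_cmult_right'[symmetric]
proof (rule infsum_cong)
  fix k :: int
  define \<nu> where "\<nu> = real_of_int k + 1/2"
  define u' where "u' = of_nat l * u - of_nat m * \<tau> - (of_nat l - 1) / 2"
  have L: "real l > 0" using l by simp
  have im: "Im (of_nat l * \<tau>) = real l * Im \<tau>" by simp
  have "Im u' = real l * (Im \<omega> * t) - real m * Im \<tau>" by (simp add: u'_def u_def)
  hence 1: "(\<nu> + Im u' / Im (of_nat l * \<tau>)) = R_shift l m k / real l + t * Im \<omega> / Im \<tau>"
    unfolding im R_shift_def \<nu>_def[symmetric] using L \<tau> by (simp add: field_simps)
  have 2: "2 * Im (of_nat l * \<tau>) = 2 * real l * Im \<tau>" by simp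
  have 3: "exp (2 * of_real pi * \<i> * of_nat m * u) * exp (- 2 * of_real pi * \<i> * of_real \<nu> * u') =
     exp (2 * of_real pi * \<i> * of_nat m * (- of_real x)) * exp (- 2 * of_real pi * \<i> * of_real \<nu> * (- of_nat l * of_real x - of_nat m * \<tau> - (of_nat l - 1) / 2)) *
     exp (- 2 * of_real pi * \<i> * of_real (R_shift l m k) * \<omega> * of_real t)"
    unfolding exp_add[symmetric] R_shift_def \<nu>_def[symmetric] u'_def u_def
    by (rule arg_cong[where f = exp]) (simp add: algebra_simps)
  show "exp (2 * of_real pi * \<i> * of_nat m * u) * (let \<nu> = real_of_int k + 1/2 in
     of_real (sgn \<nu> - E_fun ((\<nu> + Im (of_nat l * u - of_nat m * \<tau> - (of_nat l - 1) / 2) / Im (of_nat l * \<tau>)) * sqrt (2 * Im (of_nat l * \<tau>)))) * (-1) powi k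
       * qpow (- \<nu>\<^sup>2 / 2) (of_nat l * \<tau>) * exp (- 2 * of_real pi * \<i> * of_real \<nu> * (of_nat l * u - of_nat m * \<tau> - (of_nat l - 1) / 2))) =
    of_real (sgn (real_of_int k + 1/2) - E_fun ((R_shift l m k / real l + t * Im \<omega> / Im \<tau>) * sqrt (2 * real l * Im \<tau>))) *
       (R_coeff l m x \<tau> k * exp (- 2 * of_real pi * \<i> * of_real (R_shift l m k) * \<omega> * of_real t))"
    unfolding Let_def \<nu>_def[symmetric] u'_def[symmetric] 1 2 R_coeff_def using 3
    by (simp add: mult_ac)
qed

lemma abs_E_fun_le_1: "\<bar>E_fun z\<bar> \<le> 1"
  using E_fun_le_1[of z] E_fun_le_1[of "- z"] by (simp add: E_fun_minus)

text \<open>If s is the sign of a nonzero a, then |s - E(a)| = 1 - E(|a|) decays like a Gaussian.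
  Otherwise a lies in the bounded range |a| <= A, where the trivial bound 2 is absorbed by the
  factor exp(pi A^2).\<close>

lemma sgn_minus_E_fun_le:
  assumes "A \<ge> 0" "sgn a \<noteq> s \<Longrightarrow> \<bar>a\<bar> \<le> A" "\<bar>s\<bar> \<le> 1"
  shows "\<bar>s - E_fun a\<bar> \<le> 2 * exp (pi * A\<^sup>2) * exp (- pi * a\<^sup>2)"
proof (cases "sgn a = s \<and> a \<noteq> 0")
  case True
  have "\<bar>s - E_fun a\<bar> = 1 - E_fun \<bar>a\<bar>"
  proof (cases "a > 0")
    case True
    thus ?thesis using \<open>sgn a = s \<and> a \<noteq> 0\<close> E_fun_le_1[of a] by auto
  next
    case False
    hence "s = -1" "\<bar>a\<bar> = - a" using \<open>sgn a = s \<and> a \<noteq> 0\<close> by auto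
    thus ?thesis using E_fun_le_1[of "- a"] by (simp add: E_fun_minus)
  qed
  also have "\<dots> \<le> exp (- pi * a\<^sup>2) * 1" using one_minus_E_fun_le[of "\<bar>a\<bar>"] by simp
  also have "\<dots> \<le> exp (- pi * a\<^sup>2) * (2 * exp (pi * A\<^sup>2))"
  proof (intro mult_left_mono)
    have "1 \<le> exp (pi * A\<^sup>2)" by simp
    thus "1 \<le> 2 * exp (pi * A\<^sup>2)" by linarith
  qed simp
  finally show ?thesis by (simp only: mult_ac)
next
  case False
  hence "\<bar>a\<bar> \<le> A" using assms by auto
  hence "a\<^sup>2 \<le> A\<^sup>2" using assms(1) by (metis abs_le_square_iff abs_of_nonneg)
  hence "exp (pi * A\<^sup>2) * exp (- pi * a\<^sup>2) \<ge> 1"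
    unfolding exp_add[symmetric] one_le_exp_iff by simp
  moreover have "\<bar>s - E_fun a\<bar> \<le> 2" using assms(3) abs_E_fun_le_1[of a] by linarith
  ultimately show ?thesis by simp
qed

text \<open>Two kinds of dependence on u are kept apart: the exponential is holomorphic, so its
  derivative scales with omega (\<open>hol\<close>), whereas E depends on Im u alone and its
  derivative scales with Im omega (\<open>nonhol\<close>).\<close>

lemma has_vector_derivative_R_fun:
  fixes l m :: nat and x :: real and \<omega> \<tau> :: complex
  assumes l: "l \<ge> 1" and m: "m < l" and \<tau>: "Im \<tau> > 0" and \<omega>: "norm \<omega> \<le> 1"
  defines "hol \<equiv> \<lambda>k. - 2 * of_real pi * \<i> * of_real (R_shift l m k * (sgn (real_of_int k + 1/2) - E_fun (R_shift l m k / real l * sqrt (2 * real l * Im \<tau>)))) * R_coeff l m x \<tau> k"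
  defines "nonhol \<equiv> \<lambda>k. of_real (- 2 * exp (- pi * (R_shift l m k / real l * sqrt (2 * real l * Im \<tau>))\<^sup>2) * (sqrt (2 * real l * Im \<tau>) / Im \<tau>)) * R_coeff l m x \<tau> k"
  shows "hol summable_on UNIV" "nonhol summable_on UNIV"
    and "((\<lambda>t. exp (2 * of_real pi * \<i> * of_nat m * (\<omega> * of_real t - of_real x)) *
             R_fun (of_nat l * (\<omega> * of_real t - of_real x) - of_nat m * \<tau> - (of_nat l - 1) / 2) (of_nat l * \<tau>))
          has_vector_derivative \<omega> * (\<Sum>\<^sub>\<infinity>k. hol k) + of_real (Im \<omega>) * (\<Sum>\<^sub>\<infinity>k. nonhol k)) (at 0)"
proof -
  define y where "y = Im \<tau>"
  have y: "y > 0" using \<tau> by (simp add: y_def)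
  have L: "real l > 0" using l by simp
  define S where "S = sqrt (2 * real l * y)"
  have S: "S > 0" "S\<^sup>2 = 2 * real l * y" using L y by (auto simp: S_def)
  define r where "r = (\<lambda>k. R_shift l m k)"
  define cf where "cf = (\<lambda>k. R_coeff l m x \<tau> k)"
  define sg where "sg = (\<lambda>k. sgn (real_of_int k + 1/2))"
  define w where "w = Im \<omega>"
  have w: "\<bar>w\<bar> \<le> 1" unfolding w_def using abs_Im_le_cmod[of \<omega>] \<omega> by linarith
  define a where "a = (\<lambda>k t. (r k / real l + t * w / y) * S)"
  define f where "f = (\<lambda>k t. of_real (sg k - E_fun (a k t)) * (cf k * exp (- 2 * of_real pi * \<i> * of_real (r k) * \<omega> * of_real t)))"
  define g1 where "g1 = (\<lambda>k t. of_real (- 2 * exp (- pi * (a k t)\<^sup>2) * (w / y * S)) * (cf k * exp (- 2 * of_real pi * \<i> * of_real (r k) * \<omega> * of_real t)))"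
  define g2 where "g2 = (\<lambda>k t. of_real (sg k - E_fun (a k t)) * (cf k * (- 2 * of_real pi * \<i> * of_real (r k) * \<omega> * exp (- 2 * of_real pi * \<i> * of_real (r k) * \<omega> * of_real t))))"
  define f' where "f' = (\<lambda>k t. g2 k t + g1 k t)"
  \<comment> \<open>The signs of nu and of r/l + t w/y can differ only within distance 1 + 1/y of 0,
    since r/l = nu - m/l with 0 <= m/l < 1 and |t w| <= 1.\<close>
  define A where "A = (1 + 1 / y) * S"
  have A: "A \<ge> 0" using S y by (simp add: A_def)
  define C0 where "C0 = 2 * exp (pi * A\<^sup>2)"
  have C0: "C0 \<ge> 0" by (simp add: C0_def)
  \<comment> \<open>6 pi is 4 pi from the cross term in the square of \<open>a k t\<close> plus 2 pi
    from the exponential in omega t. Of the Gaussian exp(-2 pi y r^2/l), half is used up by the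
    growth exp(pi y r^2/l) of \<open>R_coeff\<close>.\<close>
  define B where "B = (\<lambda>k. exp (6 * pi * \<bar>r k\<bar> - pi * y / real l * (r k)\<^sup>2))"
  define Mb where "Mb = (\<lambda>k. (2 * pi * C0 * \<bar>r k\<bar> + (2 * (1 / y * S) + C0)) * B k)"
  have sgE: "\<bar>sg k - E_fun (a k t)\<bar> \<le> C0 * exp (- pi * (a k t)\<^sup>2)" if t: "\<bar>t\<bar> < 1" for k t
    unfolding C0_def
  proof (rule sgn_minus_E_fun_le[OF A])
    show "\<bar>sg k\<bar> \<le> 1" by (simp add: sg_def sgn_if)
    assume ne: "sgn (a k t) \<noteq> sg k"
    define q where "q = r k / real l + t * w / y"
    have tw: "\<bar>t * w / y\<bar> \<le> 1 / y"
    proof -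
      have "\<bar>t\<bar> * \<bar>w\<bar> \<le> 1 * 1" using t w by (intro mult_mono) auto
      thus ?thesis using y by (simp add: abs_mult divide_right_mono)
    qed
    have ak: "a k t = q * S" by (simp add: a_def q_def)
    have sq: "sgn (a k t) = sgn q" using S by (simp add: ak sgn_mult)
    have rk: "r k / real l = (of_int k + 1/2) - real m / real l" using L by (simp add: r_def R_shift_def field_simps)
    have ml: "0 \<le> real m / real l" "real m / real l < 1" using m L by auto
    have "\<bar>q\<bar> \<le> 1 + 1 / y"
    proof (cases "k \<ge> 0")
      case True
      hence k: "real_of_int k + 1/2 > 0" by simp
      hence "\<not> q > 0" using ne unfolding sq sg_def by auto
      moreover have "q \<ge> - 1 - 1 / y" using rk k ml tw unfolding q_def abs_le_iff by linarith
      ultimately show ?thesis using y by (auto simp: abs_le_iff)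
    next
      case False
      hence "real_of_int k \<le> -1" by linarith
      hence k: "real_of_int k + 1/2 < 0" by simp
      hence "\<not> q < 0" using ne unfolding sq sg_def by auto
      moreover have "q \<le> 1 / y" using rk k ml tw unfolding q_def abs_le_iff by linarith
      ultimately show ?thesis using y by (auto simp: abs_le_iff)
    qed
    thus "\<bar>a k t\<bar> \<le> A" unfolding ak A_def using S by (simp add: abs_mult mult_right_mono)
  qed
  have gauss: "exp (- pi * (a k t)\<^sup>2) * (norm (cf k) * norm (exp (- 2 * of_real pi * \<i> * of_real (r k) * \<omega> * of_real t))) \<le> B k" if t: "\<bar>t\<bar> < 1" for k t
  proof -
    have tw: "\<bar>t * w\<bar> \<le> 1" using t w mult_mono[of "\<bar>t\<bar>" 1 "\<bar>w\<bar>" 1] by (simp add: abs_mult)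
    have 1: "- pi * (a k t)\<^sup>2 \<le> - 2 * pi * y * (r k)\<^sup>2 / real l + 4 * pi * \<bar>r k\<bar>"
    proof -
      have "(a k t)\<^sup>2 = (r k / real l + t * w / y)\<^sup>2 * (2 * real l * y)" by (simp add: a_def power_mult_distrib S)
      also have "\<dots> = 2 * y * (r k)\<^sup>2 / real l + 4 * (r k * (t * w)) + 2 * real l * (t * w)\<^sup>2 / y"
        using L y by (simp add: power2_eq_square field_simps)
      also have "\<dots> \<ge> 2 * y * (r k)\<^sup>2 / real l + 4 * - \<bar>r k\<bar> + 0"
      proof (intro add_mono mult_left_mono order.refl)
        have "\<bar>r k * (t * w)\<bar> \<le> \<bar>r k\<bar> * 1" unfolding abs_mult[of "r k"] using tw by (intro mult_left_mono) auto
        thus "- \<bar>r k\<bar> \<le> r k * (t * w)" by linarith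
      qed (use L y in auto)
      finally have "2 * y * (r k)\<^sup>2 / real l - 4 * \<bar>r k\<bar> \<le> (a k t)\<^sup>2" by simp
      hence "pi * (2 * y * (r k)\<^sup>2 / real l - 4 * \<bar>r k\<bar>) \<le> pi * (a k t)\<^sup>2" by (intro mult_left_mono) auto
      thus ?thesis by (simp add: right_diff_distrib mult_ac)
    qed
    have 2: "norm (cf k) \<le> exp (pi * y * (r k)\<^sup>2 / real l)"
      unfolding cf_def r_def y_def by (rule norm_R_coeff_le[OF l \<tau>])
    have 3: "norm (exp (- 2 * of_real pi * \<i> * of_real (r k) * \<omega> * of_real t)) \<le> exp (2 * pi * \<bar>r k\<bar>)"
    proof -
      have "\<bar>r k * (t * w)\<bar> \<le> \<bar>r k\<bar> * 1" unfolding abs_mult[of "r k"] using tw by (intro mult_left_mono) auto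
      hence "2 * pi * (r k * (t * w)) \<le> 2 * pi * \<bar>r k\<bar>" by (intro mult_left_mono) auto
      moreover have "Re (- 2 * of_real pi * \<i> * of_real (r k) * \<omega> * of_real t) = 2 * pi * (r k * (t * w))" by (simp add: w_def)
      ultimately show ?thesis unfolding norm_exp_eq_Re exp_le_cancel_iff by (simp only:)
    qed
    have "exp (- pi * (a k t)\<^sup>2) * (norm (cf k) * norm (exp (- 2 * of_real pi * \<i> * of_real (r k) * \<omega> * of_real t))) \<le>
      exp (- 2 * pi * y * (r k)\<^sup>2 / real l + 4 * pi * \<bar>r k\<bar>) * (exp (pi * y * (r k)\<^sup>2 / real l) * exp (2 * pi * \<bar>r k\<bar>))"
      using 1 2 3 by (intro mult_mono) auto
    also have "\<dots> = B k"
      unfolding B_def exp_add[symmetric] using L by (intro arg_cong[where f = exp]) (simp add: field_simps)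
    finally show ?thesis .
  qed
  have Ms: "Mb summable_on UNIV"
  proof -
    have rk: "r k = real l * (of_int k + (1/2 - real m / real l))" for k
      using L by (simp add: r_def R_shift_def field_simps)
    have "Mb = (\<lambda>k::int. (2 * pi * C0 * real l * \<bar>of_int k + (1/2 - real m / real l)\<bar> + (2 * (1 / y * S) + C0)) *
       exp (6 * pi * real l * \<bar>of_int k + (1/2 - real m / real l)\<bar> - pi * y * real l * (of_int k + (1/2 - real m / real l))\<^sup>2))"
      unfolding Mb_def B_def rk abs_mult power_mult_distrib using L by (simp add: fun_eq_iff power2_eq_square mult.assoc)
    thus ?thesis
      using summable_on_int_gauss_shift[of "pi * y * real l" "2 * pi * C0 * real l" "2 * (1 / y * S) + C0" "1/2 - real m / real l" "6 * pi * real l"] y L S C0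
      by (simp add: mult.assoc)
  qed
  have B0: "B k \<ge> 0" for k by (simp add: B_def)
  have g1b: "norm (g1 k t) \<le> (2 * (1 / y * S)) * B k" if t: "\<bar>t\<bar> < 1" for k t
  proof -
    have "norm (g1 k t) = (2 * (\<bar>w\<bar> / y * S)) * (exp (- pi * (a k t)\<^sup>2) * (norm (cf k) * norm (exp (- 2 * of_real pi * \<i> * of_real (r k) * \<omega> * of_real t))))"
      unfolding g1_def norm_mult norm_of_real using y S by (simp add: abs_mult)
    also have "\<dots> \<le> (2 * (1 / y * S)) * B k"
      using w y S gauss[OF t, of k] by (intro mult_mono mult_left_mono mult_right_mono divide_right_mono) auto
    finally show ?thesis .
  qed
  have sgB: "\<bar>sg k - E_fun (a k t)\<bar> * (norm (cf k) * norm (exp (- 2 * of_real pi * \<i> * of_real (r k) * \<omega> * of_real t))) \<le> C0 * B k" if t: "\<bar>t\<bar> < 1" for k t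
  proof -
    have "\<bar>sg k - E_fun (a k t)\<bar> * (norm (cf k) * norm (exp (- 2 * of_real pi * \<i> * of_real (r k) * \<omega> * of_real t))) \<le>
       (C0 * exp (- pi * (a k t)\<^sup>2)) * (norm (cf k) * norm (exp (- 2 * of_real pi * \<i> * of_real (r k) * \<omega> * of_real t)))"
      by (intro mult_right_mono sgE[OF t]) auto
    also have "\<dots> = C0 * (exp (- pi * (a k t)\<^sup>2) * (norm (cf k) * norm (exp (- 2 * of_real pi * \<i> * of_real (r k) * \<omega> * of_real t))))"
      by (simp only: mult.assoc)
    also have "\<dots> \<le> C0 * B k" using gauss[OF t, of k] C0 by (intro mult_left_mono) auto
    finally show ?thesis .
  qed
  have g2b: "norm (g2 k t) \<le> (2 * pi * C0 * \<bar>r k\<bar>) * B k" if t: "\<bar>t\<bar> < 1" for k t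
  proof -
    have "norm (g2 k t) = (2 * pi * \<bar>r k\<bar>) * (norm \<omega> * (\<bar>sg k - E_fun (a k t)\<bar> * (norm (cf k) * norm (exp (- 2 * of_real pi * \<i> * of_real (r k) * \<omega> * of_real t)))))"
      unfolding g2_def norm_mult norm_of_real by simp
    also have "\<dots> \<le> (2 * pi * \<bar>r k\<bar>) * (1 * (C0 * B k))"
      by (rule mult_left_mono[OF mult_mono[OF \<omega> sgB[OF t, of k]]]) auto
    finally show ?thesis by (simp add: mult_ac)
  qed
  have f'b: "norm (f' k t) \<le> Mb k" if t: "\<bar>t\<bar> < 1" for k t
  proof -
    have "norm (f' k t) \<le> (2 * pi * C0 * \<bar>r k\<bar>) * B k + (2 * (1 / y * S)) * B k"
      unfolding f'_def by (rule norm_triangle_le) (intro add_mono g1b g2b t)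
    moreover have "0 \<le> C0 * B k" using C0 B0 by simp
    ultimately show ?thesis unfolding Mb_def distrib_right by linarith
  qed
  have f0s: "(\<lambda>k. f k 0) summable_on UNIV"
  proof (rule abs_summable_summable, rule Infinite_Sum.abs_summable_on_comparison_test'[OF Ms])
    fix k
    have "norm (f k 0) \<le> C0 * B k"
      unfolding f_def norm_mult norm_of_real by (rule sgB) simp
    moreover have "0 \<le> (2 * pi * C0 * \<bar>r k\<bar>) * B k" "0 \<le> (2 * (1 / y * S)) * B k" using C0 B0[of k] y S by auto
    ultimately show "norm (f k 0) \<le> Mb k" unfolding Mb_def distrib_right by linarith
  qed
  have fder: "(f k has_vector_derivative f' k t) (at t)" for k t
  proof -
    have "((\<lambda>t. sg k - E_fun (a k t)) has_real_derivative - 2 * exp (- pi * (a k t)\<^sup>2) * (w / y * S)) (at t)"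
      unfolding a_def using y by (auto intro!: derivative_eq_intros)
    hence 1: "((\<lambda>t. of_real (sg k - E_fun (a k t)) :: complex) has_vector_derivative of_real (- 2 * exp (- pi * (a k t)\<^sup>2) * (w / y * S))) (at t)"
      by (intro has_vector_derivative_of_real) (simp add: has_real_derivative_iff_has_vector_derivative)
    have "((\<lambda>s. cf k * exp (- 2 * of_real pi * \<i> * of_real (r k) * \<omega> * s)) has_field_derivative
        cf k * (- 2 * of_real pi * \<i> * of_real (r k) * \<omega> * exp (- 2 * of_real pi * \<i> * of_real (r k) * \<omega> * of_real t))) (at (of_real t))"
      by (auto intro!: derivative_eq_intros)
    from has_vector_derivative_mult[OF 1 has_vector_derivative_real_field[OF this]]
    show ?thesis unfolding f_def f'_def g1_def g2_def by simp
  qed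
  have main: "((\<lambda>t. \<Sum>\<^sub>\<infinity>k. f k t) has_vector_derivative (\<Sum>\<^sub>\<infinity>k. f' k 0)) (at 0)"
    by (rule has_vector_derivative_infsum[of 1, OF _ fder f'b Ms f0s]) auto
  have a0: "a k 0 = R_shift l m k / real l * sqrt (2 * real l * Im \<tau>)" for k
    by (simp add: a_def S_def r_def y_def)
  have hol_eq: "\<omega> * hol k = g2 k 0" for k
    unfolding hol_def g2_def a0 sg_def r_def cf_def by simp
  have nonhol_eq: "of_real w * nonhol k = g1 k 0" for k
    unfolding nonhol_def g1_def a0 cf_def S_def y_def by simp
  show hs: "hol summable_on UNIV"
  proof (rule abs_summable_summable, rule Infinite_Sum.abs_summable_on_comparison_test'[OF Ms])
    fix k
    have hk: "hol k = - 2 * of_real pi * \<i> * of_real (r k * (sg k - E_fun (a k 0))) * cf k"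
      by (simp only: hol_def r_def sg_def cf_def a0)
    have "norm (hol k) = (2 * pi * \<bar>r k\<bar>) * (\<bar>sg k - E_fun (a k 0)\<bar> * (norm (cf k) * norm (exp (- 2 * of_real pi * \<i> * of_real (r k) * \<omega> * of_real 0))))"
      unfolding hk norm_mult norm_of_real by (simp add: abs_mult)
    also have "\<dots> \<le> (2 * pi * \<bar>r k\<bar>) * (C0 * B k)"
      by (intro mult_left_mono sgB) auto
    finally have "norm (hol k) \<le> (2 * pi * C0 * \<bar>r k\<bar>) * B k" by (simp add: mult_ac)
    moreover have "0 \<le> C0 * B k" "0 \<le> (2 * (1 / y * S)) * B k" using C0 B0[of k] y S by auto
    ultimately show "norm (hol k) \<le> Mb k" unfolding Mb_def distrib_right by linarith
  qed
  show ns: "nonhol summable_on UNIV"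
  proof (rule abs_summable_summable, rule Infinite_Sum.abs_summable_on_comparison_test'[OF Ms])
    fix k
    have nk: "nonhol k = of_real (- 2 * exp (- pi * (a k 0)\<^sup>2) * (S / y)) * cf k"
      by (simp only: nonhol_def a0 cf_def S_def y_def)
    have "norm (nonhol k) = (2 * (1 / y * S)) * (exp (- pi * (a k 0)\<^sup>2) * (norm (cf k) * norm (exp (- 2 * of_real pi * \<i> * of_real (r k) * \<omega> * of_real 0))))"
      unfolding nk norm_mult norm_of_real using y S by (simp add: abs_mult)
    also have "\<dots> \<le> (2 * (1 / y * S)) * B k"
      using y S by (intro mult_left_mono gauss) auto
    finally have "norm (nonhol k) \<le> (2 * (1 / y * S)) * B k" .
    moreover have "0 \<le> C0 * B k" "0 \<le> (2 * pi * C0 * \<bar>r k\<bar>) * B k" using C0 B0[of k] y S by auto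
    ultimately show "norm (nonhol k) \<le> Mb k" unfolding Mb_def distrib_right by linarith
  qed
  have "(\<Sum>\<^sub>\<infinity>k. f' k 0) = \<omega> * (\<Sum>\<^sub>\<infinity>k. hol k) + of_real (Im \<omega>) * (\<Sum>\<^sub>\<infinity>k. nonhol k)"
  proof (rule infsumI)
    show "((\<lambda>k. f' k 0) has_sum (\<omega> * (\<Sum>\<^sub>\<infinity>k. hol k) + of_real (Im \<omega>) * (\<Sum>\<^sub>\<infinity>k. nonhol k))) UNIV"
      unfolding f'_def hol_eq[symmetric] nonhol_eq[symmetric] w_def
      by (intro has_sum_add has_sum_cmult_right has_sum_infsum hs ns)
  qed
  moreover have "exp (2 * of_real pi * \<i> * of_nat m * (\<omega> * of_real t - of_real x)) *
             R_fun (of_nat l * (\<omega> * of_real t - of_real x) - of_nat m * \<tau> - (of_nat l - 1) / 2) (of_nat l * \<tau>) = (\<Sum>\<^sub>\<infinity>k. f k t)" for t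
    unfolding exp_times_R_fun[OF l \<tau>] f_def a_def sg_def r_def w_def y_def S_def cf_def ..
  ultimately show "((\<lambda>t. exp (2 * of_real pi * \<i> * of_nat m * (\<omega> * of_real t - of_real x)) *
             R_fun (of_nat l * (\<omega> * of_real t - of_real x) - of_nat m * \<tau> - (of_nat l - 1) / 2) (of_nat l * \<tau>))
          has_vector_derivative \<omega> * (\<Sum>\<^sub>\<infinity>k. hol k) + of_real (Im \<omega>) * (\<Sum>\<^sub>\<infinity>k. nonhol k)) (at 0)"
    using main by simp
qed

section \<open>Theta times R, regrouped as the double series of \<open>H2\<close>\<close>

lemma has_sum_finite_sum:
  fixes f :: "'i \<Rightarrow> 'a \<Rightarrow> 'b::topological_comm_monoid_add"
  assumes "finite I" "\<And>i. i \<in> I \<Longrightarrow> (f i has_sum s i) A"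
  shows "((\<lambda>x. \<Sum>i\<in>I. f i x) has_sum (\<Sum>i\<in>I. s i)) A"
  using assms by (induction I rule: finite_induct) (auto intro!: has_sum_add)

definition theta_term :: "nat \<Rightarrow> nat \<Rightarrow> complex \<Rightarrow> int \<Rightarrow> complex" where
  "theta_term l m \<tau> k = (let \<nu> = real_of_int k + 1/2 in
     exp (of_real pi * \<i> * of_real (\<nu>\<^sup>2) * (of_nat l * \<tau>) + 2 * of_real pi * \<i> * of_real \<nu> * (of_nat m * \<tau> + (of_nat l - 1) / 2 + 1/2)))"

lemma theta_eq: "theta (of_nat m * \<tau> + (of_nat l - 1) / 2) (of_nat l * \<tau>) = (\<Sum>\<^sub>\<infinity>k. theta_term l m \<tau> k)"
  by (simp add: theta_def theta_term_def)

text \<open>The half-integers nu1 of theta and nu of R enter the product only through n = nu1 + nu =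
  k1 + k + 1 and r = l nu - m, once the square is completed. Hence the product of the two series can
  be resummed over n and r.\<close>

lemma theta_term_times_R_coeff:
  fixes l m :: nat and x :: real and \<tau> :: complex and k1 k :: int
  shows "theta_term l m \<tau> k1 * R_coeff l m x \<tau> k = - \<i> * ((-1) powi (int l * (k1 + k + 1)) * cis (2 * pi * x * R_shift l m k) *
    qpow (real l / 2 * (of_int (k1 + k + 1))\<^sup>2 - of_int (k1 + k + 1) * R_shift l m k) \<tau>)"
proof -
  have mi: "- \<i> = cis (- (pi / 2))" by (simp add: complex_eq_iff)
  show ?thesis
    unfolding theta_term_def R_coeff_def Let_def R_shift_def neg_one_powi mi cis_conv_exp qpow_def exp_add[symmetric]
    by (rule arg_cong[where f = exp]) (simp add: field_simps power2_eq_square)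
qed

lemma H2_term_theta_R:
  fixes l m :: nat and x :: real and \<tau> :: complex and k1 k :: int
  assumes l: "l \<ge> 1" and \<tau>: "Im \<tau> > 0"
  shows "theta_term l m \<tau> k1 * (of_real (nonhol_f (real l / (2 * Im \<tau>)) (R_shift l m k)) * R_coeff l m x \<tau> k) =
     - \<i> * H2_term l x 0 1 \<tau> (k1 + k + 1, int l * k1 + int m)"
proof -
  define n where "n = k1 + k + 1"
  define t where "t = R_shift l m k"
  have t: "real l * (of_int n - of_int 0 * x) - (of_int (int l * k1 + int m) + real l / 2) = t"
    by (simp add: n_def t_def R_shift_def field_simps)
  have e: "- (real l / 2) * (of_int n - of_int 0 * x)\<^sup>2 + (of_int n - of_int 0 * x) * (of_int (int l * k1 + int m) + real l / 2) = real l / 2 * (of_int n)\<^sup>2 - of_int n * t"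
  proof -
    have m: "of_int (int l * k1 + int m) + real l / 2 = real l * of_int n - t" using t by simp
    show ?thesis unfolding m by (simp add: power2_eq_square algebra_simps)
  qed
  have c: "exp (2 * of_real pi * \<i> * of_real (of_int 1 * x * t)) = cis (2 * pi * x * t)"
    unfolding cis_conv_exp by (rule arg_cong[where f = exp]) simp
  have "H2_term l x 0 1 \<tau> (n, int l * k1 + int m) = (-1) powi (int l * n) * cis (2 * pi * x * t) * of_real (nonhol_f (real l / (2 * Im \<tau>)) t) *
     qpow (real l / 2 * (of_int n)\<^sup>2 - of_int n * t) \<tau>"
    unfolding H2_term_def Let_def prod.case t e c f_fun_eq[OF l \<tau>] by (rule refl)
  moreover have "theta_term l m \<tau> k1 * (of_real (nonhol_f (real l / (2 * Im \<tau>)) t) * R_coeff l m x \<tau> k) =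
     of_real (nonhol_f (real l / (2 * Im \<tau>)) t) * (theta_term l m \<tau> k1 * R_coeff l m x \<tau> k)" by (simp only: mult_ac)
  ultimately show ?thesis
    unfolding theta_term_times_R_coeff n_def[symmetric] t_def[symmetric] by (simp only: mult_ac)
qed

text \<open>Division with remainder, m' = l k1 + m with 0 <= m < l: the l products of a theta series
  with an R series are the residue classes modulo l of one double series.\<close>

lemma infsum_H2_split:
  fixes l :: nat and x :: real and \<tau> :: complex
  assumes l: "l \<ge> 1" and \<tau>: "Im \<tau> > 0"
  shows "(\<Sum>m<l. \<Sum>\<^sub>\<infinity>k1. \<Sum>\<^sub>\<infinity>k. theta_term l m \<tau> k1 * (of_real (nonhol_f (real l / (2 * Im \<tau>)) (R_shift l m k)) * R_coeff l m x \<tau> k))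
     = 2 * of_real pi * \<i> * H2 l x 0 1 \<tau>"
proof -
  define B where "B = (\<lambda>m::nat. {(n::int, m'::int). m' mod int l = int m})"
  have summ: "H2_term l x 0 1 \<tau> summable_on S" for S
    by (rule summable_on_subset_banach[OF abs_summable_summable[OF H2_term_abs_summable[OF l \<tau>, of x 0 1]]]) simp
  have slice: "(\<Sum>\<^sub>\<infinity>k1. \<Sum>\<^sub>\<infinity>k. theta_term l m \<tau> k1 * (of_real (nonhol_f (real l / (2 * Im \<tau>)) (R_shift l m k)) * R_coeff l m x \<tau> k)) =
      - \<i> * infsum (H2_term l x 0 1 \<tau>) (B m)" if m: "m < l" for m
  proof -
    define h where "h = (\<lambda>(k1, k). H2_term l x 0 1 \<tau> (k1 + k + 1, int l * k1 + int m))"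
    have bij: "(h has_sum infsum (H2_term l x 0 1 \<tau>) (B m)) (UNIV \<times> UNIV)"
    proof (rule has_sum_reindex_bij_witness[of _ "\<lambda>(k1, k). (k1 + k + 1, int l * k1 + int m)" "\<lambda>(n, m'). (m' div int l, n - 1 - m' div int l)", THEN iffD1, rotated -1])
      show "(H2_term l x 0 1 \<tau> has_sum infsum (H2_term l x 0 1 \<tau>) (B m)) (B m)"
        by (rule has_sum_infsum[OF summ])
    qed (use m l in \<open>auto simp: B_def h_def\<close>, (metis mult_div_mod_eq)+)
    have "infsum (H2_term l x 0 1 \<tau>) (B m) = infsum h (UNIV \<times> UNIV)"
      using infsumI[OF bij] by simp
    also have "\<dots> = (\<Sum>\<^sub>\<infinity>k1. \<Sum>\<^sub>\<infinity>k. h (k1, k))"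
      by (rule infsum_Sigma_banach[symmetric]) (rule has_sum_imp_summable[OF bij])
    finally show ?thesis
      unfolding H2_term_theta_R[OF l \<tau>] infsum_cmult_right' by (simp add: h_def)
  qed
  have "(\<Sum>m<l. infsum (H2_term l x 0 1 \<tau>) (B m)) = infsum (H2_term l x 0 1 \<tau>) (\<Union>m\<in>{..<l}. B m)"
    by (rule sum_infsum) (auto simp: summ B_def)
  also have "(\<Union>m\<in>{..<l}. B m) = UNIV"
  proof -
    have "\<exists>m<l. m' mod int l = int m" for m'
      using l by (intro exI[of _ "nat (m' mod int l)"]) (auto simp: nat_less_iff)
    thus ?thesis by (auto simp: B_def)
  qed
  finally have "(\<Sum>m<l. infsum (H2_term l x 0 1 \<tau>) (B m)) = - (2 * of_real pi) * H2 l x 0 1 \<tau>"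
    by (simp add: H2_def)
  moreover have "(\<Sum>m<l. \<Sum>\<^sub>\<infinity>k1. \<Sum>\<^sub>\<infinity>k. theta_term l m \<tau> k1 * (of_real (nonhol_f (real l / (2 * Im \<tau>)) (R_shift l m k)) * R_coeff l m x \<tau> k))
     = (\<Sum>m<l. - \<i> * infsum (H2_term l x 0 1 \<tau>) (B m))"
    by (intro sum.cong refl slice) simp
  ultimately show ?thesis by (simp only: sum_distrib_left[symmetric]) simp
qed

text \<open>On the left, i/2 is the prefactor in \<open>A_hat\<close> and -i/2 the Wirtinger
  derivative of Im u. The term f contains |r|, whereas R supplies r sgn(nu). As r = l nu - m with 0
  <= m < l, these agree except for nu = 1/2 and m > l/2, where they differ by 2 r. The leftover is
  holomorphic in tau and is later counted with \<open>H1\<close>.\<close>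

lemma R_row_eq:
  fixes l m :: nat and x :: real and \<tau> :: complex
  assumes l: "l \<ge> 1" and m: "m < l" and \<tau>: "Im \<tau> > 0"
  defines "hol \<equiv> \<lambda>k. - 2 * of_real pi * \<i> * of_real (R_shift l m k * (sgn (real_of_int k + 1/2) - E_fun (R_shift l m k / real l * sqrt (2 * real l * Im \<tau>)))) * R_coeff l m x \<tau> k"
  defines "nonhol \<equiv> \<lambda>k. of_real (- 2 * exp (- pi * (R_shift l m k / real l * sqrt (2 * real l * Im \<tau>))\<^sup>2) * (sqrt (2 * real l * Im \<tau>) / Im \<tau>)) * R_coeff l m x \<tau> k"
  shows "\<i> / 2 * ((\<Sum>\<^sub>\<infinity>k. hol k) - \<i> / 2 * (\<Sum>\<^sub>\<infinity>k. nonhol k)) =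
     (\<Sum>\<^sub>\<infinity>k. of_real (nonhol_f (real l / (2 * Im \<tau>)) (R_shift l m k)) * R_coeff l m x \<tau> k) +
     (if l div 2 < m then 2 * of_real pi * of_real (R_shift l m 0) * R_coeff l m x \<tau> 0 else 0)"
proof -
  define y where "y = Im \<tau>"
  define T where "T = real l / (2 * y)"
  have y: "y > 0" using \<tau> by (simp add: y_def)
  have L: "real l > 0" using l by simp
  have T: "T > 0" using L y by (simp add: T_def)
  define corr where "corr = (\<lambda>k::int. if k = 0 \<and> l div 2 < m then 2 * of_real pi * of_real (R_shift l m 0) * R_coeff l m x \<tau> 0 else 0)"
  have s1: "R_shift l m k / real l * sqrt (2 * real l * y) = R_shift l m k / sqrt T" for k
  proof -
    have "sqrt (2 * real l * y) * sqrt T = real l"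
      unfolding real_sqrt_mult[symmetric] T_def using y L by (simp add: field_simps power2_eq_square[symmetric])
    thus ?thesis using L T by (simp add: field_simps)
  qed
  have s2: "sqrt (2 * real l * y) / y = 2 * sqrt T"
  proof -
    have "sqrt (2 * real l * y) = sqrt ((2 * y)\<^sup>2 * T)"
      by (rule arg_cong[where f = sqrt]) (use y in \<open>simp add: T_def power2_eq_square\<close>)
    also have "\<dots> = 2 * y * sqrt T" using y by (simp add: real_sqrt_mult)
    finally show ?thesis using y by simp
  qed
  have pt: "\<i> / 2 * (hol k - \<i> / 2 * nonhol k) = of_real (nonhol_f T (R_shift l m k)) * R_coeff l m x \<tau> k + corr k" for k
  proof -
    define t where "t = R_shift l m k"
    define sg where "sg = sgn (real_of_int k + 1/2)"
    have e: "(t / sqrt T)\<^sup>2 = t\<^sup>2 / T" using T by (simp add: power_divide)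
    have "\<i> / 2 * (hol k - \<i> / 2 * nonhol k) = of_real (pi * t * (sg - E_fun (t / sqrt T)) - sqrt T * exp (- pi * t\<^sup>2 / T)) * R_coeff l m x \<tau> k"
      unfolding hol_def nonhol_def y_def[symmetric] s1 s2 t_def[symmetric] sg_def[symmetric] e
      by (simp add: algebra_simps)
    also have "pi * t * (sg - E_fun (t / sqrt T)) = pi * \<bar>t\<bar> * (1 - E_fun (\<bar>t\<bar> / sqrt T)) + pi * (t * sg - \<bar>t\<bar>)"
      by (cases "t \<ge> 0") (auto simp: E_fun_minus algebra_simps)
    also have "of_real (pi * \<bar>t\<bar> * (1 - E_fun (\<bar>t\<bar> / sqrt T)) + pi * (t * sg - \<bar>t\<bar>) - sqrt T * exp (- pi * t\<^sup>2 / T)) * R_coeff l m x \<tau> k =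
       of_real (nonhol_f T t) * R_coeff l m x \<tau> k + of_real (pi * (t * sg - \<bar>t\<bar>)) * R_coeff l m x \<tau> k"
      by (simp add: nonhol_f_def algebra_simps)
    also have "of_real (pi * (t * sg - \<bar>t\<bar>)) * R_coeff l m x \<tau> k = corr k"
    proof -
      have mL: "real m < real l" using m by simp
      consider "k \<ge> 1" | "k = 0" | "k \<le> -1" by linarith
      thus ?thesis
      proof cases
        case 1
        hence "real l * 1 \<le> real l * (real_of_int k + 1/2)" by (intro mult_left_mono) auto
        hence "t > 0" unfolding t_def R_shift_def using mL by linarith
        thus ?thesis using 1 by (simp add: corr_def sg_def)
      next
        case 2
        have sg: "sg = 1" using 2 by (simp add: sg_def)
        have t: "t = real l / 2 - real m" by (simp add: t_def R_shift_def 2)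
        show ?thesis
        proof (cases "l div 2 < m")
          case True
          hence "l < 2 * m" by linarith
          hence "t < 0" by (simp add: t)
          thus ?thesis using True 2 by (simp add: corr_def sg t_def)
        next
          case False
          hence "2 * m \<le> l" by linarith
          hence "t \<ge> 0" by (simp add: t)
          thus ?thesis using False by (simp add: corr_def sg)
        qed
      next
        case 3
        hence "real_of_int k \<le> -1" by linarith
        hence k: "real_of_int k + 1/2 < 0" by simp
        hence "real l * (real_of_int k + 1/2) < 0" using L by (intro mult_pos_neg)
        hence "t < 0" by (simp add: t_def R_shift_def)
        thus ?thesis using 3 k by (simp add: corr_def sg_def)
      qed
    qed
    finally show ?thesis by (simp add: t_def)
  qed
  have \<omega>: "norm (1::complex) \<le> 1" by simp
  note hs = has_vector_derivative_R_fun(1,2)[OF l m \<tau> \<omega>, of x, folded hol_def nonhol_def]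
  have 1: "((\<lambda>k. \<i> / 2 * (hol k - \<i> / 2 * nonhol k)) has_sum (\<i> / 2 * ((\<Sum>\<^sub>\<infinity>k. hol k) - \<i> / 2 * (\<Sum>\<^sub>\<infinity>k. nonhol k)))) UNIV"
    unfolding diff_conv_add_uminus
    by (intro has_sum_cmult_right has_sum_add has_sum_uminusI has_sum_infsum hs)
  have 2: "(corr has_sum corr 0) UNIV"
    by (rule has_sum_finite_neutralI[where B = "{0}"]) (auto simp: corr_def)
  have "((\<lambda>k. of_real (nonhol_f T (R_shift l m k)) * R_coeff l m x \<tau> k) has_sum
     (\<i> / 2 * ((\<Sum>\<^sub>\<infinity>k. hol k) - \<i> / 2 * (\<Sum>\<^sub>\<infinity>k. nonhol k)) + - corr 0)) UNIV"
    using has_sum_add[OF 1 has_sum_uminusI[OF 2]] unfolding pt by simp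
  from infsumI[OF this] show ?thesis by (simp add: T_def y_def corr_def algebra_simps)
qed

text \<open>Both quantities are rational in W. The Lipschitz row of \<open>H1\<close> has theta
  equal to 0 or 1/2, while the term of the derivative of \<open>A_fun\<close> is the same kind of
  expression started at W^N with N - theta = l/2. By \<open>geometric_deriv_partial\<close> they
  differ by the terms 1 <= k < N, and m = k + l div 2 identifies these with the holomorphic
  leftovers of the R part.\<close>

lemma has_sum_H1_from_A:
  fixes l :: nat and x :: real and \<tau> :: complex
  assumes l: "l \<ge> 1" and \<tau>: "Im \<tau> > 0" and x: "x \<notin> \<int>"
  defines "W \<equiv> \<lambda>n::int. exp (2 * of_real pi * \<i> * (- of_real x)) * qpow (of_int n) \<tau>"
  defines "\<alpha> \<equiv> \<lambda>n::int. (-1) powi (int l * n) * qpow (real l * of_int n * (of_int n + 1) / 2) \<tau> * exp (of_real pi * \<i> * of_nat l * (- of_real x)) *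
     (of_real (real l / 2) / (1 - W n) + W n / (1 - W n)\<^sup>2)"
  defines "Bt \<equiv> \<lambda>(m::nat) (n::int). of_real (real m - real l / 2) * ((-1) powi (int l * n) * cis (2 * pi * x * (real l / 2 - real m)) *
     qpow (real l / 2 * (of_int n)\<^sup>2 - of_int n * (real l / 2 - real m)) \<tau>)"
  shows "((\<lambda>n. \<alpha> n + (\<Sum>m\<in>{l div 2<..<l}. Bt m n)) has_sum H1 l x 0 1 \<tau>) UNIV"
proof -
  define \<theta> where "\<theta> = (if even l then 0 else 1/2 :: real)"
  define L where "L = l div 2"
  define N where "N = l - L"
  have \<theta>: "0 \<le> \<theta>" "\<theta> \<le> 1" by (auto simp: \<theta>_def)
  have lL: "real l = 2 * real L + 2 * \<theta>" unfolding L_def \<theta>_def by (auto elim: evenE oddE)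
  have N1: "N \<ge> 1" "L < l" using l by (auto simp: N_def L_def)
  have N\<theta>: "real N - \<theta> = real l / 2" using lL N1 by (simp add: N_def)
  have row: "- 1 / (4 * (of_real pi)\<^sup>2) * cis (- (pi * real l * (of_int 0 * x) * (of_int 1 * x))) *
       (cis (pi * real l * (of_int n + of_int n * (of_int 1 * x))) * exp (of_real pi * \<i> * of_nat l * of_real (of_int n - of_int 0 * x) * (of_real (of_int n - of_int 0 * x) * \<tau> - of_real (of_int 1 * x)))) *
       (\<Sum>\<^sub>\<infinity>k::int. cis (2 * pi * of_int k * (real l * (2 * (of_int n - of_int 0 * x) + 1) / 2)) / (of_real (of_int n - of_int 0 * x) * \<tau> - of_real (of_int 1 * x) + of_int k)\<^sup>2)
     = \<alpha> n + (\<Sum>m\<in>{l div 2<..<l}. Bt m n)" for n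
  proof -
    define z where "z = of_int n * \<tau> - of_real x"
    define P where "P = cis (pi * real l * (of_int n + of_int n * x)) * exp (of_real pi * \<i> * of_nat l * of_int n * z)"
    have zi: "z \<notin> \<int>"
    proof (cases "n = 0")
      case True
      thus ?thesis using x by (auto simp: z_def complex_is_Int_iff) (metis Ints_minus Ints_of_int minus_minus)
    next
      case False
      thus ?thesis using \<tau> by (auto simp: z_def complex_is_Int_iff)
    qed
    have W: "W n = exp (2 * of_real pi * \<i> * z)"
      unfolding W_def qpow_def exp_add[symmetric] by (rule arg_cong[where f = exp]) (simp add: z_def algebra_simps)
    have W1: "W n \<noteq> 1" unfolding W using exp_eq_1_imp_Ints[of z] zi by auto
    \<comment> \<open>The phase l (2n + 1)/2 exceeds theta by the integer l n + l div 2.\<close>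
    have ph: "cis (2 * pi * of_int k * (real l * (2 * of_int n + 1) / 2)) = cis (2 * pi * of_int k * \<theta>)" for k
    proof -
      have "2 * pi * of_int k * (real l * (2 * of_int n + 1) / 2) = 2 * pi * of_int k * \<theta> + 2 * pi * of_int (k * (int l * n + int L))"
        by (simp add: lL) (simp add: field_simps)
      hence "cis (2 * pi * of_int k * (real l * (2 * of_int n + 1) / 2)) = cis (2 * pi * of_int k * \<theta>) * cis (2 * pi * of_int (k * (int l * n + int L)))"
        by (simp only: cis_mult)
      also have "cis (2 * pi * of_int (k * (int l * n + int L))) = 1" by (rule cis_multiple_2pi) simp
      finally show ?thesis by simp
    qed
    define Z where "Z = exp (- 2 * of_real pi * \<i> * of_real \<theta> * z)"
    have "(\<Sum>\<^sub>\<infinity>k::int. cis (2 * pi * of_int k * (real l * (2 * of_int n + 1) / 2)) / (z + of_int k)\<^sup>2) =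
      - 4 * (of_real pi)\<^sup>2 * Z * (W n / (1 - W n)\<^sup>2 - of_real \<theta> * W n / (1 - W n))"
      unfolding ph infsum_lipschitz_closed[OF zi \<theta>] W Z_def ..
    hence "- 1 / (4 * (of_real pi)\<^sup>2) * P * (\<Sum>\<^sub>\<infinity>k::int. cis (2 * pi * of_int k * (real l * (2 * of_int n + 1) / 2)) / (z + of_int k)\<^sup>2) =
      P * Z * (W n / (1 - W n)\<^sup>2 - of_real \<theta> * W n / (1 - W n))" by simp
    also have "W n / (1 - W n)\<^sup>2 - of_real \<theta> * W n / (1 - W n) = (\<Sum>k\<in>{1..<N}. (of_nat k - of_real \<theta>) * W n ^ k) + W n ^ N * ((of_nat N - of_real \<theta>) / (1 - W n) + W n / (1 - W n)\<^sup>2)"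
      using geometric_deriv_partial[OF W1 N1(1), of "of_real \<theta>"] by simp
    also have "P * Z * \<dots> = P * Z * W n ^ N * ((of_nat N - of_real \<theta>) / (1 - W n) + W n / (1 - W n)\<^sup>2) + (\<Sum>k\<in>{1..<N}. (of_nat k - of_real \<theta>) * (P * Z * W n ^ k))"
      by (simp add: distrib_left sum_distrib_left mult_ac)
    also have "of_nat N - of_real \<theta> = (of_real (real l / 2) :: complex)" unfolding N\<theta>[symmetric] by simp
    also have PZ: "P * Z * W n ^ k = (-1) powi (int l * n) * cis (2 * pi * x * - (real k - \<theta>)) * qpow (real l / 2 * (of_int n)\<^sup>2 - of_int n * - (real k - \<theta>)) \<tau>" for k
      unfolding P_def Z_def W neg_one_powi cis_conv_exp qpow_def exp_of_nat_mult[symmetric] exp_add[symmetric]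
      by (rule arg_cong[where f = exp]) (simp add: z_def power2_eq_square algebra_simps)
    have "P * Z * W n ^ N = (-1) powi (int l * n) * qpow (real l * of_int n * (of_int n + 1) / 2) \<tau> * exp (of_real pi * \<i> * of_nat l * (- of_real x))"
    proof -
      have "P * Z * W n ^ N = (-1) powi (int l * n) * cis (2 * pi * x * - (real l / 2)) * qpow (real l / 2 * (of_int n)\<^sup>2 - of_int n * - (real l / 2)) \<tau>"
        unfolding PZ N\<theta> ..
      also have "cis (2 * pi * x * - (real l / 2)) = exp (of_real pi * \<i> * of_nat l * (- of_real x))"
        unfolding cis_conv_exp by (rule arg_cong[where f = exp]) simp
      also have "real l / 2 * (of_int n)\<^sup>2 - of_int n * - (real l / 2) = real l * of_int n * (of_int n + 1) / 2"
        by (simp add: power2_eq_square field_simps)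
      finally show ?thesis by (simp only: mult_ac)
    qed
    hence A: "P * Z * W n ^ N * (of_real (real l / 2) / (1 - W n) + W n / (1 - W n)\<^sup>2) = \<alpha> n" by (simp only: \<alpha>_def)
    have S: "(\<Sum>k\<in>{1..<N}. (of_nat k - of_real \<theta>) * (P * Z * W n ^ k)) = (\<Sum>m\<in>{l div 2<..<l}. Bt m n)"
    proof (rule sum.reindex_bij_witness[of _ "\<lambda>m. m - L" "\<lambda>k. k + L"])
      fix k assume "k \<in> {1..<N}"
      have k: "- (real k - \<theta>) = real l / 2 - real (k + L)" "real k - \<theta> = real (k + L) - real l / 2" unfolding lL by (auto simp: field_simps)
      have "Bt (k + L) n = of_real (real k - \<theta>) * (P * Z * W n ^ k)"
        unfolding Bt_def PZ k(1) unfolding k(2) by (rule refl)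
      thus "Bt (k + L) n = (of_nat k - of_real \<theta>) * (P * Z * W n ^ k)" by simp
    qed (auto simp: N_def L_def)
    have "- 1 / (4 * (of_real pi)\<^sup>2) * P * (\<Sum>\<^sub>\<infinity>k::int. cis (2 * pi * of_int k * (real l * (2 * of_int n + 1) / 2)) / (z + of_int k)\<^sup>2) = \<alpha> n + (\<Sum>m\<in>{l div 2<..<l}. Bt m n)"
      using calculation unfolding A S by simp
    thus ?thesis unfolding P_def z_def by simp
  qed
  have nz: "\<not> (of_int 0 * x \<in> \<int> \<and> of_int 1 * x \<in> \<int>)" using x by simp
  show ?thesis using has_sum_H1_rows[OF l \<tau> nz] unfolding row .
qed

text \<open>\<open>H2\<close> comes entirely from the regrouped products of theta and R.
  \<open>H1\<close> is the derivative of \<open>A_fun\<close> together with the leftover terms for m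
  > l/2.\<close>

theorem dA_hat_eq:
  fixes l :: nat and x :: real and \<tau> :: complex
  assumes l: "l \<ge> 1" and \<tau>: "Im \<tau> > 0" and x: "x \<notin> \<int>"
  shows "dA_hat l (- of_real x) \<tau> = 2 * of_real pi * \<i> * (H1 l x 0 1 \<tau> + H2 l x 0 1 \<tau>)"
proof -
  define W where "W = (\<lambda>n::int. exp (2 * of_real pi * \<i> * (- of_real x)) * qpow (of_int n) \<tau>)"
  define \<alpha> where "\<alpha> = (\<lambda>n::int. (-1) powi (int l * n) * qpow (real l * of_int n * (of_int n + 1) / 2) \<tau> * exp (of_real pi * \<i> * of_nat l * (- of_real x)) *
     (of_real (real l / 2) / (1 - W n) + W n / (1 - W n)\<^sup>2))"
  define Bt where "Bt = (\<lambda>(m::nat) (n::int). of_real (real m - real l / 2) * ((-1) powi (int l * n) * cis (2 * pi * x * (real l / 2 - real m)) *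
     qpow (real l / 2 * (of_int n)\<^sup>2 - of_int n * (real l / 2 - real m)) \<tau>))"
  define hol where "hol = (\<lambda>m k. - 2 * of_real pi * \<i> * of_real (R_shift l m k * (sgn (real_of_int k + 1/2) - E_fun (R_shift l m k / real l * sqrt (2 * real l * Im \<tau>)))) * R_coeff l m x \<tau> k)"
  define nonhol where "nonhol = (\<lambda>m k. of_real (- 2 * exp (- pi * (R_shift l m k / real l * sqrt (2 * real l * Im \<tau>))\<^sup>2) * (sqrt (2 * real l * Im \<tau>) / Im \<tau>)) * R_coeff l m x \<tau> k)"
  define \<Theta> where "\<Theta> = (\<lambda>m. theta (of_nat m * \<tau> + (of_nat l - 1) / 2) (of_nat l * \<tau>))"
  define D where "D = (\<lambda>\<omega>. \<omega> * (2 * of_real pi * \<i> * (\<Sum>\<^sub>\<infinity>n. \<alpha> n)) + \<i> / 2 * (\<Sum>m<l. \<Theta> m * (\<omega> * (\<Sum>\<^sub>\<infinity>k. hol m k) + of_real (Im \<omega>) * (\<Sum>\<^sub>\<infinity>k. nonhol m k))))"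
  have \<alpha>s: "\<alpha> summable_on UNIV"
    using has_vector_derivative_A_fun(1)[OF l \<tau> x, of 1] by (simp add: \<alpha>_def W_def)
  have der: "((\<lambda>t. A_hat l (\<omega> * of_real t - of_real x) \<tau>) has_vector_derivative D \<omega>) (at 0)" if \<omega>: "norm \<omega> \<le> 1" for \<omega>
  proof -
    have eq: "A_hat l (\<omega> * of_real t - of_real x) \<tau> = A_fun l (\<omega> * of_real t - of_real x) \<tau> + \<i> / 2 * (\<Sum>m<l. \<Theta> m *
        (exp (2 * of_real pi * \<i> * of_nat m * (\<omega> * of_real t - of_real x)) *
             R_fun (of_nat l * (\<omega> * of_real t - of_real x) - of_nat m * \<tau> - (of_nat l - 1) / 2) (of_nat l * \<tau>)))" for t
      unfolding A_hat_def \<Theta>_def by (simp only: mult_ac)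
    have A: "((\<lambda>t. A_fun l (\<omega> * of_real t - of_real x) \<tau>) has_vector_derivative \<omega> * (2 * of_real pi * \<i> * (\<Sum>\<^sub>\<infinity>n. \<alpha> n))) (at 0)"
      using has_vector_derivative_A_fun(2)[OF l \<tau> x \<omega>] by (simp only: \<alpha>_def W_def)
    have R: "((\<lambda>t. exp (2 * of_real pi * \<i> * of_nat m * (\<omega> * of_real t - of_real x)) *
             R_fun (of_nat l * (\<omega> * of_real t - of_real x) - of_nat m * \<tau> - (of_nat l - 1) / 2) (of_nat l * \<tau>))
          has_vector_derivative \<omega> * (\<Sum>\<^sub>\<infinity>k. hol m k) + of_real (Im \<omega>) * (\<Sum>\<^sub>\<infinity>k. nonhol m k)) (at 0)" if "m < l" for m
      using has_vector_derivative_R_fun(3)[OF l that \<tau> \<omega>, of x] by (simp only: hol_def nonhol_def)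
    show ?thesis
      unfolding eq D_def
      by (intro has_vector_derivative_add A has_vector_derivative_mult_right has_vector_derivative_sum R) auto
  qed
  have "dA_hat l (- of_real x) \<tau> = 1 / 2 * (D 1 - \<i> * D \<i>)"
    unfolding dA_hat_def
  proof (rule wirtinger_eqI)
    show "((\<lambda>t. A_hat l (0 + of_real t + - of_real x) \<tau>) has_vector_derivative D 1) (at 0)"
      using der[of 1] by simp
    show "((\<lambda>t. A_hat l (0 + \<i> * of_real t + - of_real x) \<tau>) has_vector_derivative D \<i>) (at 0)"
      using der[of \<i>] by simp
  qed
  also have "\<dots> = 2 * of_real pi * \<i> * (\<Sum>\<^sub>\<infinity>n. \<alpha> n) + (\<Sum>m<l. \<Theta> m * (\<i> / 2 * ((\<Sum>\<^sub>\<infinity>k. hol m k) - \<i> / 2 * (\<Sum>\<^sub>\<infinity>k. nonhol m k))))"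
  proof -
    \<comment> \<open>In (D 1 - i D i)/2 the parts linear in omega keep the coefficient 1, and the
      parts proportional to Im omega get the coefficient -i/2.\<close>
    have id: "1 / 2 * ((1 * a + \<i> / 2 * s1) - \<i> * (\<i> * a + \<i> / 2 * s2)) = a + \<i> / 2 * (1 / 2 * (s1 - \<i> * s2))" for a s1 s2 :: complex
      by (simp add: field_simps)
    have "1 / 2 * ((\<Sum>m<l. \<Theta> m * (1 * h m + of_real (Im 1) * nh m)) - \<i> * (\<Sum>m<l. \<Theta> m * (\<i> * h m + of_real (Im \<i>) * nh m))) =
      (\<Sum>m<l. \<Theta> m * (h m - \<i> / 2 * nh m))" for h nh :: "nat \<Rightarrow> complex"
      unfolding sum_distrib_left sum_subtractf[symmetric]
      by (intro sum.cong refl) (simp add: field_simps)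
    note e = this[of "\<lambda>m. \<Sum>\<^sub>\<infinity>k. hol m k" "\<lambda>m. \<Sum>\<^sub>\<infinity>k. nonhol m k"]
    show ?thesis unfolding D_def id e by (simp add: sum_distrib_left mult.left_commute)
  qed
  also have "(\<Sum>m<l. \<Theta> m * (\<i> / 2 * ((\<Sum>\<^sub>\<infinity>k. hol m k) - \<i> / 2 * (\<Sum>\<^sub>\<infinity>k. nonhol m k)))) =
     (\<Sum>m<l. \<Theta> m * (\<Sum>\<^sub>\<infinity>k. of_real (nonhol_f (real l / (2 * Im \<tau>)) (R_shift l m k)) * R_coeff l m x \<tau> k)) +
     (\<Sum>m<l. if l div 2 < m then \<Theta> m * (2 * of_real pi * of_real (R_shift l m 0) * R_coeff l m x \<tau> 0) else 0)"
    unfolding sum.distrib[symmetric]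
  proof (intro sum.cong refl)
    fix m assume "m \<in> {..<l}"
    hence m: "m < l" by simp
    show "\<Theta> m * (\<i> / 2 * ((\<Sum>\<^sub>\<infinity>k. hol m k) - \<i> / 2 * (\<Sum>\<^sub>\<infinity>k. nonhol m k))) =
      \<Theta> m * (\<Sum>\<^sub>\<infinity>k. of_real (nonhol_f (real l / (2 * Im \<tau>)) (R_shift l m k)) * R_coeff l m x \<tau> k) +
      (if l div 2 < m then \<Theta> m * (2 * of_real pi * of_real (R_shift l m 0) * R_coeff l m x \<tau> 0) else 0)"
      using R_row_eq[OF l m \<tau>, of x] by (simp add: hol_def nonhol_def distrib_left)
  qed
  also have "(\<Sum>m<l. \<Theta> m * (\<Sum>\<^sub>\<infinity>k. of_real (nonhol_f (real l / (2 * Im \<tau>)) (R_shift l m k)) * R_coeff l m x \<tau> k)) = 2 * of_real pi * \<i> * H2 l x 0 1 \<tau>"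
    unfolding infsum_H2_split[OF l \<tau>, symmetric] \<Theta>_def theta_eq infsum_cmult_left' infsum_cmult_right' by (rule refl)
  also have "(\<Sum>m<l. if l div 2 < m then \<Theta> m * (2 * of_real pi * of_real (R_shift l m 0) * R_coeff l m x \<tau> 0) else 0) =
     2 * of_real pi * \<i> * (\<Sum>m\<in>{l div 2<..<l}. \<Sum>\<^sub>\<infinity>n. Bt m n)"
  proof -
    have "(\<Sum>m<l. if l div 2 < m then \<Theta> m * (2 * of_real pi * of_real (R_shift l m 0) * R_coeff l m x \<tau> 0) else 0) =
       (\<Sum>m\<in>{l div 2<..<l}. \<Theta> m * (2 * of_real pi * of_real (R_shift l m 0) * R_coeff l m x \<tau> 0))"
      by (rule sum.mono_neutral_cong_right) auto
    also have "\<dots> = (\<Sum>m\<in>{l div 2<..<l}. 2 * of_real pi * \<i> * (\<Sum>\<^sub>\<infinity>n. Bt m n))"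
    proof (intro sum.cong refl)
      fix m
      have r0: "R_shift l m 0 = real l / 2 - real m" by (simp add: R_shift_def)
      have "\<Theta> m * (2 * of_real pi * of_real (R_shift l m 0) * R_coeff l m x \<tau> 0) =
         (\<Sum>\<^sub>\<infinity>k1. 2 * of_real pi * \<i> * Bt m (k1 + 1))"
        unfolding \<Theta>_def theta_eq infsum_cmult_left'[symmetric]
      proof (rule infsum_cong)
        fix k1
        have "theta_term l m \<tau> k1 * (2 * of_real pi * of_real (R_shift l m 0) * R_coeff l m x \<tau> 0) =
           2 * of_real pi * of_real (R_shift l m 0) * (theta_term l m \<tau> k1 * R_coeff l m x \<tau> 0)" by (simp only: mult_ac)
        thus "theta_term l m \<tau> k1 * (2 * of_real pi * of_real (R_shift l m 0) * R_coeff l m x \<tau> 0) = 2 * of_real pi * \<i> * Bt m (k1 + 1)"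
          unfolding theta_term_times_R_coeff r0 Bt_def by (simp add: algebra_simps)
      qed
      \<comment> \<open>The leftover terms have k = 0, so the index n = k1 + k + 1 is k1 +
        1.\<close>
      also have "\<dots> = (\<Sum>\<^sub>\<infinity>n. 2 * of_real pi * \<i> * Bt m n)"
        by (rule infsum_reindex_bij_witness[of _ "\<lambda>n. n - 1" "\<lambda>k. k + 1"]) auto
      finally show "\<Theta> m * (2 * of_real pi * of_real (R_shift l m 0) * R_coeff l m x \<tau> 0) = 2 * of_real pi * \<i> * (\<Sum>\<^sub>\<infinity>n. Bt m n)"
        by (simp only: infsum_cmult_right')
    qed
    finally show ?thesis by (simp only: sum_distrib_left)
  qed
  finally have main: "dA_hat l (- of_real x) \<tau> = 2 * of_real pi * \<i> * ((\<Sum>\<^sub>\<infinity>n. \<alpha> n) + (\<Sum>m\<in>{l div 2<..<l}. \<Sum>\<^sub>\<infinity>n. Bt m n) + H2 l x 0 1 \<tau>)"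
    by (simp add: algebra_simps)
  have Bs: "Bt m summable_on UNIV" for m
  proof (rule abs_summable_summable, rule Infinite_Sum.abs_summable_on_comparison_test')
    define y where "y = Im \<tau>"
    define j where "j = real m - real l / 2"
    show "(\<lambda>n::int. \<bar>j\<bar> * exp (2 * pi * y * \<bar>j\<bar> * \<bar>real_of_int n\<bar> - pi * y * real l * (real_of_int n)\<^sup>2)) summable_on UNIV"
      using l \<tau> by (intro summable_on_cmult_right summable_on_int_gauss) (simp add: y_def)
    fix n :: int
    have "norm (Bt m n) = \<bar>j\<bar> * exp (- 2 * pi * (real l / 2 * (of_int n)\<^sup>2 - of_int n * - j) * y)"
    proof -
      have "real l / 2 - real m = - j" by (simp add: j_def)
      moreover have "norm (of_real j :: complex) = \<bar>j\<bar>" by (rule norm_of_real)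
      ultimately show ?thesis unfolding Bt_def j_def[symmetric] norm_mult norm_power_int norm_qpow y_def by simp
    qed
    also have "\<dots> \<le> \<bar>j\<bar> * exp (2 * pi * y * \<bar>j\<bar> * \<bar>real_of_int n\<bar> - pi * y * real l * (real_of_int n)\<^sup>2)"
    proof (intro mult_left_mono iffD2[OF exp_le_cancel_iff])
      have "- (of_int n * j) \<le> \<bar>of_int n * j\<bar>" by linarith
      hence "2 * pi * y * - (of_int n * j) \<le> 2 * pi * y * \<bar>of_int n * j\<bar>" using \<tau> by (intro mult_left_mono) (auto simp: y_def)
      thus "- 2 * pi * (real l / 2 * (of_int n)\<^sup>2 - of_int n * - j) * y \<le> 2 * pi * y * \<bar>j\<bar> * \<bar>real_of_int n\<bar> - pi * y * real l * (real_of_int n)\<^sup>2"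
        by (simp add: abs_mult algebra_simps)
    qed auto
    finally show "norm (Bt m n) \<le> \<bar>j\<bar> * exp (2 * pi * y * \<bar>j\<bar> * \<bar>real_of_int n\<bar> - pi * y * real l * (real_of_int n)\<^sup>2)" .
  qed
  have "((\<lambda>n. \<alpha> n + (\<Sum>m\<in>{l div 2<..<l}. Bt m n)) has_sum ((\<Sum>\<^sub>\<infinity>n. \<alpha> n) + (\<Sum>m\<in>{l div 2<..<l}. \<Sum>\<^sub>\<infinity>n. Bt m n))) UNIV"
    by (intro has_sum_add has_sum_finite_sum has_sum_infsum \<alpha>s Bs) auto
  moreover have "((\<lambda>n. \<alpha> n + (\<Sum>m\<in>{l div 2<..<l}. Bt m n)) has_sum H1 l x 0 1 \<tau>) UNIV"
    using has_sum_H1_from_A[OF l \<tau> x] by (simp only: \<alpha>_def W_def Bt_def)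
  ultimately have "(\<Sum>\<^sub>\<infinity>n. \<alpha> n) + (\<Sum>m\<in>{l div 2<..<l}. \<Sum>\<^sub>\<infinity>n. Bt m n) = H1 l x 0 1 \<tau>" by (rule has_sum_unique)
  thus ?thesis unfolding main by simp
qed

subsection \<open>Modularity\<close>

lemma parity_form: "even (m * n + m + n) \<longleftrightarrow> even m \<and> even n" for m n :: int
  by auto

lemma eis_modular:
  fixes l :: nat and x :: real and a b c d :: int and \<tau> :: complex
  assumes det: "a * d - b * c = 1" and \<tau>: "Im \<tau> > 0"
  defines "j \<equiv> of_int c * \<tau> + of_int d"
  defines "\<tau>' \<equiv> (of_int a * \<tau> + of_int b) / j"
  shows "j \<noteq> 0" "Im \<tau>' > 0" "eis l 0 x \<tau>' = j\<^sup>2 * eis l (of_int c * x) (of_int d * x) \<tau>"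
proof -
  have detr: "real_of_int a * of_int d - of_int b * of_int c = 1" using det by (metis of_int_1 of_int_diff of_int_mult)
  show j0: "j \<noteq> 0"
  proof
    assume "j = 0"
    hence "Im j = 0" "Re j = 0" by auto
    hence "c = 0" "d = 0" using \<tau> by (auto simp: j_def)
    thus False using det by simp
  qed
  have "\<tau>' = (of_int a * \<tau> + of_int b) * cnj j / of_real ((norm j)\<^sup>2)"
    unfolding \<tau>'_def by (subst complex_div_cnj) (simp add: complex_norm_square)
  moreover have "Im ((of_int a * \<tau> + of_int b) * cnj j) = Im \<tau> * (of_int a * of_int d - of_int b * of_int c)"
    by (simp add: j_def algebra_simps)
  ultimately have Im': "Im \<tau>' = Im \<tau> / (norm j)\<^sup>2" using detr by (simp add: Im_divide_of_real del: of_real_power)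
  thus Im0: "Im \<tau>' > 0" using j0 \<tau> by simp
  have pt: "eis_term l 0 x \<tau>' (m, n) = j\<^sup>2 * eis_term l (of_int c * x) (of_int d * x) \<tau> (m * a + n * c, m * b + n * d)" for m n
  proof -
    define w' where "w' = of_real (of_int m - 0) * \<tau>' + of_real (of_int n - x)"
    define w where "w = of_real (of_int (m * a + n * c) - of_int c * x) * \<tau> + of_real (of_int (m * b + n * d) - of_int d * x)"
    have "w = j * w'"
      using j0 by (simp add: w_def w'_def \<tau>'_def field_simps) (simp add: j_def algebra_simps)
    hence w': "w' = w / j" using j0 by simp
    have e: "- (pi * real l / (2 * Im \<tau>')) * (norm w')\<^sup>2 = - (pi * real l / (2 * Im \<tau>)) * (norm w)\<^sup>2"
      unfolding w' Im' using j0 by (simp add: norm_divide power_divide)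
    have q: "X / w'\<^sup>2 = j\<^sup>2 * (X / w\<^sup>2)" for X by (simp add: w' power_divide)
    \<comment> \<open>An integer matrix of determinant 1 maps the pairs with both entries even onto
      themselves, hence preserves the parity of mn + m + n.\<close>
    have par: "even ((m * n + m + n) - ((m * a + n * c) * (m * b + n * d) + (m * a + n * c) + (m * b + n * d)))"
    proof -
      define m' where "m' = m * a + n * c"
      define n' where "n' = m * b + n * d"
      have "m' * d - n' * c = m * (a * d - b * c)" "n' * a - m' * b = n * (a * d - b * c)"
        by (simp_all add: m'_def n'_def algebra_simps)
      hence "m = m' * d - n' * c" "n = n' * a - m' * b" using det by auto
      hence "even m \<and> even n \<longleftrightarrow> even m' \<and> even n'" by (metis dvd_diff dvd_mult2 dvd_add m'_def n'_def)
      hence "even (m * n + m + n) = even (m' * n' + m' + n')" by (simp only: parity_form)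
      thus ?thesis unfolding m'_def n'_def by (simp only: even_diff even_add)
    qed
    have par': "cis (pi * of_int (int l * (m * n + m + n))) = cis (pi * of_int (int l * ((m * a + n * c) * (m * b + n * d) + (m * a + n * c) + (m * b + n * d))))"
      by (rule cis_pi_of_int_neq) (use par in \<open>simp add: right_diff_distrib[symmetric]\<close>)
    have mm: "of_int (m * a + n * c) * (of_int d * x) - of_int (m * b + n * d) * (of_int c * x) = of_int m * x"
    proof -
      have "of_int (m * a + n * c) * (of_int d * x) - of_int (m * b + n * d) * (of_int c * x) = (real_of_int a * of_int d - of_int b * of_int c) * (of_int m * x)"
        by (simp add: algebra_simps)
      thus ?thesis unfolding detr by simp
    qed
    have ph: "cis (pi * of_int (int l * (m * n + m + n)) + pi * real l * (of_int m * x - of_int n * 0)) =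
       cis (pi * of_int (int l * ((m * a + n * c) * (m * b + n * d) + (m * a + n * c) + (m * b + n * d))) + pi * real l * (of_int (m * a + n * c) * (of_int d * x) - of_int (m * b + n * d) * (of_int c * x)))"
      unfolding mm cis_mult[symmetric] par' by simp
    show ?thesis
      unfolding eis_term_def Let_def prod.case w'_def[symmetric] w_def[symmetric] e ph
      by (rule q)
  qed
  have "eis l 0 x \<tau>' = (\<Sum>\<^sub>\<infinity>mn. j\<^sup>2 * eis_term l (of_int c * x) (of_int d * x) \<tau> mn)"
    unfolding eis_def
  proof (rule infsum_reindex_bij_witness[of _ "\<lambda>(m, n). (m * d - n * c, n * a - m * b)" "\<lambda>(m, n). (m * a + n * c, m * b + n * d)"])
    fix mn :: "int \<times> int"
    obtain m n where mn: "mn = (m, n)" by force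
    have 1: "(m * a + n * c) * d - (m * b + n * d) * c = m * (a * d - b * c)" "(m * b + n * d) * a - (m * a + n * c) * b = n * (a * d - b * c)"
      "(m * d - n * c) * a + (n * a - m * b) * c = m * (a * d - b * c)" "(m * d - n * c) * b + (n * a - m * b) * d = n * (a * d - b * c)"
      by (simp_all add: algebra_simps)
    show "(case (case mn of (m, n) \<Rightarrow> (m * a + n * c, m * b + n * d)) of (m, n) \<Rightarrow> (m * d - n * c, n * a - m * b)) = mn"
      "(case (case mn of (m, n) \<Rightarrow> (m * d - n * c, n * a - m * b)) of (m, n) \<Rightarrow> (m * a + n * c, m * b + n * d)) = mn"
      using 1 by (simp_all add: mn det)
    show "j\<^sup>2 * eis_term l (of_int c * x) (of_int d * x) \<tau> (case mn of (m, n) \<Rightarrow> (m * a + n * c, m * b + n * d)) = eis_term l 0 x \<tau>' mn"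
      by (simp add: mn pt)
  qed auto
  thus "eis l 0 x \<tau>' = j\<^sup>2 * eis l (of_int c * x) (of_int d * x) \<tau>"
    by (simp add: infsum_cmult_right' eis_def)
qed

text \<open>Indeed x = a (dx) - b (cx). This guarantees that no denominator of \<open>eis\<close>
  vanishes at the transformed parameters (cx, dx).\<close>

lemma Ints_of_coprime_multiples:
  fixes x :: real and a b c d :: int
  assumes "a * d - b * c = 1" "of_int c * x \<in> \<int>" "of_int d * x \<in> \<int>"
  shows "x \<in> \<int>"
proof -
  have "real_of_int a * of_int d - of_int b * of_int c = 1" using assms(1) by (metis of_int_1 of_int_diff of_int_mult)
  hence "x = (real_of_int a * of_int d - of_int b * of_int c) * x" by simp
  also have "\<dots> = of_int a * (of_int d * x) - of_int b * (of_int c * x)" by (simp add: algebra_simps)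
  also have "\<dots> \<in> \<int>" by (intro Ints_diff Ints_mult[OF Ints_of_int assms(3)] Ints_mult[OF Ints_of_int assms(2)])
  finally show ?thesis .
qed

text \<open>\<open>H1_plus_H2_eq_eis\<close> is applied twice: at the transformed point with bottom
  row (0, 1), to pass from the derivative to \<open>eis\<close>, and at tau with bottom row (c, d),
  to return after the modular transformation.\<close>

theorem slash_dA_hat_eq:
  fixes l :: nat and x :: real and a b c d :: int and \<tau> :: complex
  assumes l: "l \<ge> 1" and x: "x \<notin> \<int>" and det: "a * d - b * c = 1" and \<tau>: "Im \<tau> > 0"
  defines "g \<equiv> 1 / (2 * of_real pi * \<i>) * exp (- of_real pi * \<i> * of_real (real l * of_int c * of_int d * x\<^sup>2))
               * slash2 (dA_hat l (- of_real x)) a b c d \<tau>"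
  shows "g = - 1 / (4 * (of_real pi)\<^sup>2) * cis (- (pi * real l * (of_int c * x) * (of_int d * x))) * eis l (of_int c * x) (of_int d * x) \<tau>"
    and "g = H1 l x c d \<tau> + H2 l x c d \<tau>"
proof -
  define j where "j = of_int c * \<tau> + of_int d"
  define \<tau>' where "\<tau>' = (of_int a * \<tau> + of_int b) / j"
  note mod = eis_modular[OF det \<tau>, folded j_def, folded \<tau>'_def]
  have nz0: "\<not> (of_int 0 * x \<in> \<int> \<and> of_int 1 * x \<in> \<int>)" using x by simp
  have nz: "\<not> (of_int c * x \<in> \<int> \<and> of_int d * x \<in> \<int>)" using Ints_of_coprime_multiples[OF det] x by blast
  have "dA_hat l (- of_real x) \<tau>' = 2 * of_real pi * \<i> * (- 1 / (4 * (of_real pi)\<^sup>2) * eis l 0 x \<tau>')"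
    unfolding dA_hat_eq[OF l mod(2) x] H1_plus_H2_eq_eis[OF l mod(2) nz0] by simp
  also have "\<dots> = 2 * of_real pi * \<i> * (- 1 / (4 * (of_real pi)\<^sup>2) * (j\<^sup>2 * eis l (of_int c * x) (of_int d * x) \<tau>))"
    unfolding mod(3) ..
  finally have d0: "dA_hat l (- of_real x) \<tau>' = 2 * of_real pi * \<i> * (- 1 / (4 * (of_real pi)\<^sup>2) * (j\<^sup>2 * eis l (of_int c * x) (of_int d * x) \<tau>))" .
  have jj: "j powi (-2) * j\<^sup>2 = 1" using mod(1) by (simp add: power_int_minus)
  have "slash2 (dA_hat l (- of_real x)) a b c d \<tau> = j powi (-2) * dA_hat l (- of_real x) \<tau>'"
    unfolding slash2_def j_def \<tau>'_def ..
  also have "\<dots> = (j powi (-2) * j\<^sup>2) * (2 * of_real pi * \<i> * (- 1 / (4 * (of_real pi)\<^sup>2) * eis l (of_int c * x) (of_int d * x) \<tau>))"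
    unfolding d0 by (simp only: mult_ac)
  finally have dA: "slash2 (dA_hat l (- of_real x)) a b c d \<tau> = 2 * of_real pi * \<i> * (- 1 / (4 * (of_real pi)\<^sup>2) * eis l (of_int c * x) (of_int d * x) \<tau>)"
    unfolding jj by simp
  have e: "exp (- of_real pi * \<i> * of_real (real l * of_int c * of_int d * x\<^sup>2)) = cis (- (pi * real l * (of_int c * x) * (of_int d * x)))"
    unfolding cis_conv_exp by (rule arg_cong[where f = exp]) (simp add: power2_eq_square)
  show "g = - 1 / (4 * (of_real pi)\<^sup>2) * cis (- (pi * real l * (of_int c * x) * (of_int d * x))) * eis l (of_int c * x) (of_int d * x) \<tau>"
    unfolding g_def dA e by simp
  thus "g = H1 l x c d \<tau> + H2 l x c d \<tau>" unfolding H1_plus_H2_eq_eis[OF l \<tau> nz] .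
qed

subsection \<open>Fourier expansion and nonholomorphic part\<close>

text \<open>\<open>\<kappa>\<close> will be the Fourier index of a term, so this sorts a double
  series into a Fourier series; the fibres may be infinite.\<close>

lemma has_sum_group_by:
  fixes F :: "'a \<Rightarrow> complex" and \<kappa> :: "'a \<Rightarrow> int"
  assumes "F summable_on A"
  shows "((\<lambda>k. \<Sum>\<^sub>\<infinity>p\<in>{p\<in>A. \<kappa> p = k}. F p) has_sum (\<Sum>\<^sub>\<infinity>p\<in>A. F p)) UNIV"
proof -
  have "((\<lambda>(k, p). F p) has_sum (\<Sum>\<^sub>\<infinity>p\<in>A. F p)) (Sigma UNIV (\<lambda>k. {p\<in>A. \<kappa> p = k}))"
    using has_sum_infsum[OF assms]
    by (rule has_sum_reindex_bij_witness[of _ snd "\<lambda>p. (\<kappa> p, p)", THEN iffD1, rotated -1]) auto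
  from has_sum_rows[OF has_sum_imp_summable[OF this]] infsumI[OF this]
  show ?thesis by simp
qed

lemma summable_group_by:
  fixes F :: "'a \<Rightarrow> real" and \<kappa> :: "'a \<Rightarrow> int"
  assumes "F summable_on A"
  shows "(\<lambda>k. \<Sum>\<^sub>\<infinity>p\<in>{p\<in>A. \<kappa> p = k}. F p) summable_on UNIV"
proof -
  have "((\<lambda>(k, p). F p) has_sum (\<Sum>\<^sub>\<infinity>p\<in>A. F p)) (Sigma UNIV (\<lambda>k. {p\<in>A. \<kappa> p = k}))"
    using has_sum_infsum[OF assms]
    by (rule has_sum_reindex_bij_witness[of _ snd "\<lambda>p. (\<kappa> p, p)", THEN iffD1, rotated -1]) auto
  from has_sum_imp_summable[OF has_sum_rows[OF has_sum_imp_summable[OF this]]]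
  show ?thesis by simp
qed

lemma qpow_periodic:
  assumes "N > 0"
  shows "qpow (of_int k / real N) (\<tau> + of_nat N) = qpow (of_int k / real N) \<tau>"
proof -
  have "2 * of_real pi * \<i> * of_real (of_int k / real N) * (\<tau> + of_nat N) = 2 * of_real pi * \<i> * of_real (of_int k / real N) * \<tau> + 2 * of_real pi * \<i> * of_int k"
    using assms by (simp add: field_simps)
  thus ?thesis unfolding qpow_def by (simp only: exp_add exp_of_int_2pi_i mult_1_right)
qed

text \<open>The Fourier coefficients split as e_n + d_n(y), where e_n collects \<open>H1\<close>,
  with C entering at n = 0, and d_n(y) collects \<open>H2\<close>. It remains to see that each
  d_n(y) tends to 0 as y grows.\<close>

theorem has_hol_nonhol_parts_H1_H2:
  fixes l :: nat and x :: real and c d :: int and g :: "complex \<Rightarrow> complex"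
  assumes l: "l \<ge> 1" and x: "x \<in> \<rat>"
    and g: "\<And>\<tau>. Im \<tau> > 0 \<Longrightarrow> g \<tau> = H1 l x c d \<tau> + H2 l x c d \<tau>"
    and an: "real_analytic_on g upper_half_plane"
  shows "has_hol_nonhol_parts g (H1 l x c d) (H2 l x c d)"
proof -
  obtain Pn Q where Q: "Q > 0" and xq: "x = of_int Pn / real Q"
    using x by (auto elim!: Rats_cases' ) (metis of_int_of_nat_eq zero_less_imp_eq_int)
  define u where "u = c * Pn"
  have p: "of_int c * x = of_int u / real Q" by (simp add: xq u_def)
  \<comment> \<open>With x = Pn/Q all exponents of q have the denominator 2 Q^2: Q^2 from the
    quadratic terms in cx, and 2 from l/2. \<open>\<kappa>1\<close> and \<open>\<kappa>2\<close> are
    the resulting integer numerators.\<close>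
  define N where "N = 2 * Q\<^sup>2"
  have N: "N > 0" using Q by (simp add: N_def)
  define \<kappa>1 where "\<kappa>1 = (\<lambda>(n, m). int l * (n * int Q + u)\<^sup>2 + (n * int Q + u) * (2 * int Q * m - 2 * int l * u - int l * int Q))"
  define \<kappa>2 where "\<kappa>2 = (\<lambda>(n, m). - int l * (n * int Q - u)\<^sup>2 + (n * int Q - u) * (2 * m + int l) * int Q)"
  define M where "M = M_const l x c"
  have M_eq: "M = real l * (of_int u / real Q) + real l / 2" by (simp add: M_def M_const_def p[symmetric])
  define e1 where "e1 = (\<lambda>(n, m). (-1) powi (int l * n) * exp (2 * of_real pi * \<i> * of_real ((of_int m - M) * of_int d * x)) * of_real (of_int m - M) :: complex)"
  define e2 where "e2 = (\<lambda>(n, m) y. (-1) powi (int l * n)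
     * exp (2 * of_real pi * \<i> * of_real (of_int d * x * (real l * (of_int n - of_int c * x) - (of_int m + real l / 2))))
     * of_real (f_fun l (real l * (of_int n - of_int c * x) - (of_int m + real l / 2)) y) :: complex)"
  have t1: "H1_term l x c d \<tau> p = e1 p * qpow (of_int (\<kappa>1 p) / real N) \<tau>" for p \<tau>
  proof -
    obtain n m where p': "p = (n, m)" by force
    have "real l / 2 * (of_int n + of_int c * x)\<^sup>2 + (of_int n + of_int c * x) * (of_int m - M) = of_int (\<kappa>1 (n, m)) / real N"
      unfolding M_eq p \<kappa>1_def N_def using Q by (simp add: field_simps power2_eq_square)
    thus ?thesis unfolding p' H1_term_def e1_def Let_def prod.case M_def[symmetric] by simp
  qed
  have t2: "H2_term l x c d \<tau> p = e2 p (Im \<tau>) * qpow (of_int (\<kappa>2 p) / real N) \<tau>" for p \<tau>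
  proof -
    obtain n m where p': "p = (n, m)" by force
    have "- (real l / 2) * (of_int n - of_int c * x)\<^sup>2 + (of_int n - of_int c * x) * (of_int m + real l / 2) = of_int (\<kappa>2 (n, m)) / real N"
      unfolding p \<kappa>2_def N_def using Q by (simp add: field_simps power2_eq_square)
    thus ?thesis unfolding p' H2_term_def e2_def Let_def prod.case by simp
  qed
  define A where "A = H1_index_pos l x c"
  define B where "B = H1_index_neg l x c"
  define e where "e = (\<lambda>k. (if k = 0 then of_real (C_const l x c d) else 0) +
     ((\<Sum>\<^sub>\<infinity>p\<in>{p\<in>A. \<kappa>1 p = k}. e1 p) - (\<Sum>\<^sub>\<infinity>p\<in>{p\<in>B. \<kappa>1 p = k}. e1 p)))"
  define dk where "dk = (\<lambda>k y. - 1 / (2 * of_real pi) * (\<Sum>\<^sub>\<infinity>p\<in>{p. \<kappa>2 p = k}. e2 p y))"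
  have grp1: "(\<Sum>\<^sub>\<infinity>p\<in>{p\<in>S. \<kappa>1 p = k}. H1_term l x c d \<tau> p) = (\<Sum>\<^sub>\<infinity>p\<in>{p\<in>S. \<kappa>1 p = k}. e1 p) * qpow (of_int k / real N) \<tau>" for S k \<tau>
    unfolding infsum_cmult_left'[symmetric] by (rule infsum_cong) (auto simp: t1)
  have grp2: "(\<Sum>\<^sub>\<infinity>p\<in>{p. \<kappa>2 p = k}. H2_term l x c d \<tau> p) = (\<Sum>\<^sub>\<infinity>p\<in>{p. \<kappa>2 p = k}. e2 p (Im \<tau>)) * qpow (of_int k / real N) \<tau>" for k \<tau>
    unfolding infsum_cmult_left'[symmetric] by (rule infsum_cong) (auto simp: t2)
  have dkq: "dk k (Im \<tau>) * qpow (of_int k / real N) \<tau> = - 1 / (2 * of_real pi) * (\<Sum>\<^sub>\<infinity>p\<in>{p. \<kappa>2 p = k}. H2_term l x c d \<tau> p)" for k \<tau>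
    unfolding dk_def grp2 by simp
  have hsH1: "((\<lambda>k. e k * qpow (of_int k / real N) \<tau>) has_sum H1 l x c d \<tau>) UNIV" if \<tau>: "Im \<tau> > 0" for \<tau>
  proof -
    have a: "((\<lambda>k. \<Sum>\<^sub>\<infinity>p\<in>{p\<in>A. \<kappa>1 p = k}. H1_term l x c d \<tau> p) has_sum (\<Sum>\<^sub>\<infinity>p\<in>A. H1_term l x c d \<tau> p)) UNIV"
      unfolding A_def by (rule has_sum_group_by[OF H1_term_summable(1)[OF l \<tau>]])
    have b: "((\<lambda>k. \<Sum>\<^sub>\<infinity>p\<in>{p\<in>B. \<kappa>1 p = k}. H1_term l x c d \<tau> p) has_sum (\<Sum>\<^sub>\<infinity>p\<in>B. H1_term l x c d \<tau> p)) UNIV"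
      unfolding B_def by (rule has_sum_group_by[OF H1_term_summable(2)[OF l \<tau>]])
    have c: "((\<lambda>k::int. if k = 0 then of_real (C_const l x c d) else 0) has_sum (of_real (C_const l x c d) :: complex)) UNIV"
      by (rule has_sum_finite_neutralI[where B = "{0}"]) auto
    have "((\<lambda>k. (if k = 0 then of_real (C_const l x c d) else 0) +
       ((\<Sum>\<^sub>\<infinity>p\<in>{p\<in>A. \<kappa>1 p = k}. H1_term l x c d \<tau> p) + - (\<Sum>\<^sub>\<infinity>p\<in>{p\<in>B. \<kappa>1 p = k}. H1_term l x c d \<tau> p))) has_sum
       (of_real (C_const l x c d) + ((\<Sum>\<^sub>\<infinity>p\<in>A. H1_term l x c d \<tau> p) + - (\<Sum>\<^sub>\<infinity>p\<in>B. H1_term l x c d \<tau> p)))) UNIV"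
      by (intro has_sum_add a has_sum_uminusI[OF b] c)
    moreover have "(if k = 0 then of_real (C_const l x c d) else 0) +
       ((\<Sum>\<^sub>\<infinity>p\<in>{p\<in>A. \<kappa>1 p = k}. H1_term l x c d \<tau> p) + - (\<Sum>\<^sub>\<infinity>p\<in>{p\<in>B. \<kappa>1 p = k}. H1_term l x c d \<tau> p)) = e k * qpow (of_int k / real N) \<tau>" for k
      unfolding grp1 e_def by (auto simp: qpow_def algebra_simps)
    ultimately show ?thesis by (simp add: H1_def A_def B_def)
  qed
  have hsH2: "((\<lambda>k. dk k (Im \<tau>) * qpow (of_int k / real N) \<tau>) has_sum H2 l x c d \<tau>) UNIV" if \<tau>: "Im \<tau> > 0" for \<tau>
    unfolding dkq H2_def
    using has_sum_group_by[OF abs_summable_summable[OF H2_term_abs_summable[OF l \<tau>, of x c d]], of \<kappa>2]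
    by (intro has_sum_cmult_right) simp
  have hsg: "((\<lambda>k. (e k + dk k (Im \<tau>)) * qpow (of_int k / real N) \<tau>) has_sum g \<tau>) UNIV" if \<tau>: "Im \<tau> > 0" for \<tau>
    using has_sum_add[OF hsH1[OF \<tau>] hsH2[OF \<tau>]] unfolding g[OF \<tau>] by (simp add: distrib_right)
  have per: "g (\<tau> + of_nat N) = g \<tau>" if \<tau>: "Im \<tau> > 0" for \<tau>
  proof -
    have \<tau>': "Im (\<tau> + of_nat N) > 0" using \<tau> by simp
    show ?thesis using hsg[OF \<tau>'] hsg[OF \<tau>] by (simp only: qpow_periodic[OF N] plus_complex.sel complex_Im_of_nat add_0_right) (rule has_sum_unique)
  qed
  have dkbound: "norm (dk k (Im \<tau>) * qpow (of_int k / real N) \<tau>) \<le> 1 / (2 * pi) * (\<Sum>\<^sub>\<infinity>p\<in>{p\<in>UNIV. \<kappa>2 p = k}. H2_bound l (of_int c * x) Y p)"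
    if Y: "Y > 0" "Y \<le> Im \<tau>" for k Y \<tau>
  proof -
    have \<tau>: "Im \<tau> > 0" using Y by simp
    have "H2_bound l (of_int c * x) Y summable_on {p\<in>UNIV. \<kappa>2 p = k}"
      by (rule summable_on_subset_banach[OF summable_on_H2_bound[OF l Y(1)]]) auto
    moreover have "H2_term l x c d \<tau> summable_on {p\<in>UNIV. \<kappa>2 p = k}"
      by (rule summable_on_subset_banach[OF abs_summable_summable[OF H2_term_abs_summable[OF l \<tau>, of x c d]]]) auto
    ultimately have "norm (\<Sum>\<^sub>\<infinity>p\<in>{p\<in>UNIV. \<kappa>2 p = k}. H2_term l x c d \<tau> p) \<le> (\<Sum>\<^sub>\<infinity>p\<in>{p\<in>UNIV. \<kappa>2 p = k}. H2_bound l (of_int c * x) Y p)"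
      by (intro norm_infsum_le[OF has_sum_infsum has_sum_infsum] norm_H2_term_le l Y)
    from mult_left_mono[OF this, of "1 / (2 * pi)"]
    show ?thesis unfolding dkq by (simp add: norm_divide norm_mult)
  qed
  have bs: "(\<lambda>k. 1 / (2 * pi) * (\<Sum>\<^sub>\<infinity>p\<in>{p\<in>UNIV. \<kappa>2 p = k}. H2_bound l (of_int c * x) Y p)) summable_on UNIV" if Y: "Y > 0" for Y
    by (intro summable_on_cmult_right summable_group_by summable_on_H2_bound l Y)
  have ul: "uniform_limit {\<tau>. Im \<tau> \<ge> Y} (\<lambda>F \<tau>. \<Sum>k\<in>F. dk k (Im \<tau>) * qpow (of_int k / real N) \<tau>) (H2 l x c d) (finite_subsets_at_top UNIV)"
    if Y: "Y > 0" for Y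
  proof -
    have "uniform_limit {\<tau>. Im \<tau> \<ge> Y} (\<lambda>F \<tau>. \<Sum>k\<in>F. dk k (Im \<tau>) * qpow (of_int k / real N) \<tau>)
       (\<lambda>\<tau>. \<Sum>\<^sub>\<infinity>k. dk k (Im \<tau>) * qpow (of_int k / real N) \<tau>) (finite_subsets_at_top UNIV)"
      by (rule Weierstrass_m_test_general[OF dkbound[OF Y] bs[OF Y]]) auto
    thus ?thesis
      by (rule uniform_limit_cong'[THEN iffD1, rotated -1]) (use Y in \<open>auto simp: infsumI[OF hsH2]\<close>)
  qed
  \<comment> \<open>A fibre may be infinite, so dominated convergence is needed. On the fibre the
    exponent is a constant E and mu^2 = t^2 + 2 l E, so decay in t alone is decay in both n and
    m.\<close>
  have lim: "(dk k \<longlongrightarrow> 0) at_top" for k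
  proof -
    have "((\<lambda>y. \<Sum>\<^sub>\<infinity>p\<in>{p. \<kappa>2 p = k}. e2 p y) \<longlongrightarrow> (\<Sum>\<^sub>\<infinity>p\<in>{p. \<kappa>2 p = k}. 0)) at_top"
    proof (rule tendsto_infsum_dominated)
      define t where "t = (\<lambda>(n::int, m::int). real l * (of_int n - of_int c * x) - (of_int m + real l / 2))"
      have ne2: "norm (e2 p y) = \<bar>f_fun l (t p) y\<bar>" for p y
        by (cases p) (simp add: e2_def t_def norm_mult norm_power_int)
      have L: "real l > 0" using l by simp
      \<comment> \<open>The bound for f at y = 1, with sqrt(l/(2y)) enlarged to sqrt l; it dominates
        all y >= 1.\<close>
      define G where "G = (\<lambda>p. (pi * \<bar>t p\<bar> + sqrt (real l)) * exp (- 2 * pi * (t p)\<^sup>2 / real l))"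
      have fb: "\<bar>f_fun l (t p) y\<bar> \<le> (pi * \<bar>t p\<bar> + sqrt (real l / (2 * y))) * exp (- 2 * pi * (t p)\<^sup>2 / real l * y)" if "y > 0" for p y
      proof -
        have e: "- pi * (t p)\<^sup>2 / (real l / (2 * y)) = - 2 * pi * (t p)\<^sup>2 / real l * y" using L that by (simp add: field_simps)
        show ?thesis unfolding f_fun_eq[OF l that] e[symmetric] by (rule abs_nonhol_f_le) (use that L in auto)
      qed
      show "((\<lambda>y. e2 p y) \<longlongrightarrow> 0) at_top" for p
      proof (rule Lim_null_comparison)
        show "\<forall>\<^sub>F y in at_top. norm (e2 p y) \<le> (pi * \<bar>t p\<bar> + sqrt (real l / (2 * y))) * exp (- 2 * pi * (t p)\<^sup>2 / real l * y)"
          using eventually_gt_at_top[of 0] by eventually_elim (simp only: ne2 fb)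
        have s0: "((\<lambda>y. sqrt (real l / (2 * y))) \<longlongrightarrow> 0) at_top"
        proof -
          have "((\<lambda>y::real. sqrt (1 / y)) \<longlongrightarrow> 0) at_top" by real_asymp
          from tendsto_mult_right_zero[OF this, of "sqrt (real l / 2)"] show ?thesis
            by (simp add: real_sqrt_mult[symmetric])
        qed
        show "((\<lambda>y. (pi * \<bar>t p\<bar> + sqrt (real l / (2 * y))) * exp (- 2 * pi * (t p)\<^sup>2 / real l * y)) \<longlongrightarrow> 0) at_top"
        \<comment> \<open>At t = 0 there is no exponential decay, and the limit rests on
          sqrt(l/(2y)) alone.\<close>
        proof (cases "t p = 0")
          case True
          thus ?thesis using s0 by simp
        next
          case False
          define k' where "k' = 2 * pi * (t p)\<^sup>2 / real l"
          have k': "k' > 0" using False L by (simp add: k'_def)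
          have "((\<lambda>y. exp (- (k' * y))) \<longlongrightarrow> 0) at_top" using k' by real_asymp
          from tendsto_mult[OF tendsto_add[OF tendsto_const s0] this, of "pi * \<bar>t p\<bar>"]
          show ?thesis by (simp add: k'_def)
        qed
      qed
      show "\<forall>\<^sub>F y in at_top. \<forall>p\<in>{p. \<kappa>2 p = k}. norm (e2 p y) \<le> G p"
        using eventually_ge_at_top[of 1]
      proof eventually_elim
        case (elim y)
        show ?case
        proof
          fix p
          have "norm (e2 p y) \<le> (pi * \<bar>t p\<bar> + sqrt (real l / (2 * y))) * exp (- 2 * pi * (t p)\<^sup>2 / real l * y)"
            unfolding ne2 using elim by (intro fb) simp
          also have "\<dots> \<le> G p"
            unfolding G_def
          proof (intro mult_mono add_left_mono real_sqrt_le_mono iffD2[OF exp_le_cancel_iff])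
            show "real l / (2 * y) \<le> real l" using elim L by (simp add: field_simps)
            have "2 * pi * (t p)\<^sup>2 / real l * 1 \<le> 2 * pi * (t p)\<^sup>2 / real l * y" using elim L by (intro mult_left_mono) auto
            thus "- 2 * pi * (t p)\<^sup>2 / real l * y \<le> - 2 * pi * (t p)\<^sup>2 / real l" by simp
          qed (use L elim in auto)
          finally show "norm (e2 p y) \<le> G p" .
        qed
      qed
      show "G summable_on {p. \<kappa>2 p = k}"
      proof (rule summable_on_comparison_test)
        define E where "E = real_of_int k / real N"
        define p0 where "p0 = of_int c * x"
        have gs: "(\<lambda>(n::int, m::int). exp (pi * E) * (((pi * real l * \<bar>of_int n - p0\<bar> + (sqrt (real l) + 1)) * exp (- (pi * real l / 8) * (of_int n - p0)\<^sup>2)) *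
           ((pi * \<bar>of_int m + real l / 2\<bar> + 1) * exp (- (pi / (4 * real l)) * (of_int m + real l / 2)\<^sup>2)))) summable_on UNIV"
        proof -
          have "(\<lambda>n::int. (pi * real l * \<bar>of_int n - p0\<bar> + (sqrt (real l) + 1)) * exp (- (pi * real l / 8) * (of_int n - p0)\<^sup>2)) summable_on UNIV"
            using summable_on_int_gauss_shift[of "pi * real l / 8" "pi * real l" "sqrt (real l) + 1" "- p0" 0] L by simp
          moreover have "(\<lambda>m::int. (pi * \<bar>of_int m + real l / 2\<bar> + 1) * exp (- (pi / (4 * real l)) * (of_int m + real l / 2)\<^sup>2)) summable_on UNIV"
            using summable_on_int_gauss_shift[of "pi / (4 * real l)" pi 1 "real l / 2" 0] L by simp
          ultimately have "(\<lambda>(n::int, m::int). ((pi * real l * \<bar>of_int n - p0\<bar> + (sqrt (real l) + 1)) * exp (- (pi * real l / 8) * (of_int n - p0)\<^sup>2)) *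
            ((pi * \<bar>of_int m + real l / 2\<bar> + 1) * exp (- (pi / (4 * real l)) * (of_int m + real l / 2)\<^sup>2))) summable_on UNIV \<times> UNIV"
            by (intro summable_on_product_nonneg) auto
          from summable_on_cmult_right[OF this, of "exp (pi * E)"] show ?thesis by (simp add: case_prod_beta')
        qed
        show "(\<lambda>(n::int, m::int). exp (pi * E) * (((pi * real l * \<bar>of_int n - p0\<bar> + (sqrt (real l) + 1)) * exp (- (pi * real l / 8) * (of_int n - p0)\<^sup>2)) *
           ((pi * \<bar>of_int m + real l / 2\<bar> + 1) * exp (- (pi / (4 * real l)) * (of_int m + real l / 2)\<^sup>2)))) summable_on {p. \<kappa>2 p = k}"
          by (rule summable_on_subset_banach[OF gs]) simp
        fix p assume "p \<in> {p. \<kappa>2 p = k}"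
        hence kp: "\<kappa>2 p = k" by simp
        obtain n m where p': "p = (n, m)" by force
        define s where "s = of_int n - p0"
        define \<mu> where "\<mu> = of_int m + real l / 2"
        have tp: "t p = real l * s - \<mu>" by (simp add: t_def p' s_def \<mu>_def p0_def)
        have "- (real l / 2) * s\<^sup>2 + s * \<mu> = of_int (\<kappa>2 (n, m)) / real N"
          unfolding s_def \<mu>_def p0_def p \<kappa>2_def N_def using Q by (simp add: field_simps power2_eq_square)
        hence E: "- (real l / 2) * s\<^sup>2 + s * \<mu> = E" using kp by (simp add: E_def p')
        have EE: "2 * real l * E = \<mu>\<^sup>2 - (t p)\<^sup>2" unfolding E[symmetric] tp by (simp add: power2_eq_square algebra_simps)
        have "(real l * s)\<^sup>2 \<le> 2 * (\<mu>\<^sup>2 + (t p)\<^sup>2)"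
        proof -
          have "real l * s = t p + \<mu>" by (simp add: tp)
          moreover have "0 \<le> (t p - \<mu>)\<^sup>2" by simp
          ultimately show ?thesis by (simp add: power2_eq_square algebra_simps)
        qed
        moreover have "A / 8 + B / 4 \<le> (B + C) / 2" if "A \<le> 2 * (B + C)" "0 \<le> C" for A B C :: real
          using that by (simp add: field_simps)
        ultimately have h: "(real l * s)\<^sup>2 / 8 + \<mu>\<^sup>2 / 4 \<le> (\<mu>\<^sup>2 + (t p)\<^sup>2) / 2"
          using zero_le_power2 by blast
        \<comment> \<open>On the fibre t^2 = (mu^2 + t^2)/2 - l E. The constant part becomes the
          factor exp(pi E), the rest is split between s and mu by \<open>h\<close>.\<close>
        have G1: "exp (- 2 * pi * (t p)\<^sup>2 / real l) \<le> exp (pi * E) * (exp (- (pi * real l / 8) * s\<^sup>2) * exp (- (pi / (4 * real l)) * \<mu>\<^sup>2))"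
        proof -
          have "2 * (t p)\<^sup>2 \<ge> - (real l * E) + ((real l * s)\<^sup>2 / 8 + \<mu>\<^sup>2 / 4)"
          proof -
            have "- A + B \<le> 2 * C" if "B \<le> (D + C) / 2" "2 * A = D - C" "0 \<le> C" for A B C D :: real
              using that by (simp add: field_simps)
            from this[OF h _ zero_le_power2, of "real l * E"] EE show ?thesis by (simp add: mult.assoc)
          qed
          hence "pi / real l * (- (real l * E) + ((real l * s)\<^sup>2 / 8 + \<mu>\<^sup>2 / 4)) \<le> pi / real l * (2 * (t p)\<^sup>2)"
            using L by (intro mult_left_mono) auto
          moreover have "pi / real l * (- (real l * E) + ((real l * s)\<^sup>2 / 8 + \<mu>\<^sup>2 / 4)) = - (pi * E) + (pi * real l / 8) * s\<^sup>2 + (pi / (4 * real l)) * \<mu>\<^sup>2"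
            using L by (simp add: field_simps power2_eq_square)
          moreover have "pi / real l * (2 * (t p)\<^sup>2) = 2 * pi * (t p)\<^sup>2 / real l" by simp
          ultimately show ?thesis unfolding exp_add[symmetric] exp_le_cancel_iff by simp
        qed
        have G2: "pi * \<bar>t p\<bar> + sqrt (real l) \<le> (pi * real l * \<bar>s\<bar> + (sqrt (real l) + 1)) * (pi * \<bar>\<mu>\<bar> + 1)"
        proof -
          have "\<bar>t p\<bar> \<le> real l * \<bar>s\<bar> + \<bar>\<mu>\<bar>" unfolding tp using L abs_triangle_ineq4[of "real l * s" \<mu>] by (simp add: abs_mult)
          hence "pi * \<bar>t p\<bar> \<le> pi * (real l * \<bar>s\<bar> + \<bar>\<mu>\<bar>)" by (intro mult_left_mono) auto
          hence "pi * \<bar>t p\<bar> \<le> pi * real l * \<bar>s\<bar> + pi * \<bar>\<mu>\<bar>" by (simp add: algebra_simps)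
          moreover have "0 \<le> pi * real l * \<bar>s\<bar> * (pi * \<bar>\<mu>\<bar>)" "0 \<le> sqrt (real l) * (pi * \<bar>\<mu>\<bar>)" using L by auto
          ultimately show ?thesis unfolding distrib_left distrib_right by linarith
        qed
        have "G p \<le> ((pi * real l * \<bar>s\<bar> + (sqrt (real l) + 1)) * (pi * \<bar>\<mu>\<bar> + 1)) * (exp (pi * E) * (exp (- (pi * real l / 8) * s\<^sup>2) * exp (- (pi / (4 * real l)) * \<mu>\<^sup>2)))"
          unfolding G_def by (rule mult_mono[OF G2 G1]) (use L in auto)
        thus "G p \<le> (case p of (n, m) \<Rightarrow> exp (pi * E) * (((pi * real l * \<bar>of_int n - p0\<bar> + (sqrt (real l) + 1)) * exp (- (pi * real l / 8) * (of_int n - p0)\<^sup>2)) *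
           ((pi * \<bar>of_int m + real l / 2\<bar> + 1) * exp (- (pi / (4 * real l)) * (of_int m + real l / 2)\<^sup>2))))"
          unfolding p' prod.case s_def \<mu>_def by (simp only: mult_ac)
        show "0 \<le> G p" unfolding G_def using L by simp
      qed
    qed
    from tendsto_mult_left[OF this, of "- 1 / (2 * of_real pi)"]
    show ?thesis unfolding dk_def[abs_def] by simp
  qed
  show ?thesis
    unfolding has_hol_nonhol_parts_def
  proof (intro conjI an exI[of _ N] exI[of _ "\<lambda>k y. e k + dk k y"] exI[of _ e] N ballI allI impI)
    fix k
    show "((\<lambda>y. e k + dk k y) \<longlongrightarrow> e k) at_top" using tendsto_add[OF tendsto_const lim[of k], of "e k"] by simp
  next
    fix \<tau> assume "\<tau> \<in> upper_half_plane"
    hence \<tau>: "Im \<tau> > 0" by simp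
    show "g (\<tau> + of_nat N) = g \<tau>" by (rule per[OF \<tau>])
    show "((\<lambda>k. (e k + dk k (Im \<tau>)) * qpow (of_int k / real N) \<tau>) has_sum g \<tau>) UNIV" by (rule hsg[OF \<tau>])
    show "((\<lambda>k. e k * qpow (of_int k / real N) \<tau>) has_sum H1 l x c d \<tau>) UNIV" by (rule hsH1[OF \<tau>])
    show "(\<lambda>k. norm ((e k + dk k (Im \<tau>) - e k) * qpow (of_int k / real N) \<tau>)) summable_on UNIV"
      using Infinite_Sum.abs_summable_on_comparison_test'[OF bs[OF \<tau>] dkbound[OF \<tau> order.refl]] by simp
  next
    fix Y :: real assume "Y > 0"
    from ul[OF this] show "uniform_limit {\<tau>. Im \<tau> \<ge> Y} (\<lambda>F \<tau>. \<Sum>k\<in>F. (e k + dk k (Im \<tau>) - e k) * qpow (of_int k / real N) \<tau>) (H2 l x c d) (finite_subsets_at_top UNIV)"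
      by simp
  qed
qed

subsection \<open>Real analyticity\<close>

text \<open>
  Real analyticity is checked with a majorant: the double power series of \<open>f\<close> around the origin
  has absolute sum at most \<open>K\<close> on the bidisc of radius \<open>\<rho>\<close>. These bounds behave like a submultiplicative
  norm, so that a series of such functions is real analytic once the bounds are summable.
\<close>
definition has_majorant :: "real \<Rightarrow> real \<Rightarrow> (real \<Rightarrow> real \<Rightarrow> complex) \<Rightarrow> bool" where
  "has_majorant \<rho> K f \<longleftrightarrow> (\<exists>a :: nat \<times> nat \<Rightarrow> complex.
     (\<lambda>i. norm (a i) * \<rho> ^ (fst i + snd i)) summable_on UNIV \<and>
     (\<Sum>\<^sub>\<infinity>i. norm (a i) * \<rho> ^ (fst i + snd i)) \<le> K \<and>
     (\<forall>s t. \<bar>s\<bar> \<le> \<rho> \<longrightarrow> \<bar>t\<bar> \<le> \<rho> \<longrightarrow> ((\<lambda>i. a i * of_real (s ^ fst i * t ^ snd i)) has_sum f s t) UNIV))"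

lemma monomial_bound:
  fixes \<rho> s t :: real
  assumes "\<bar>s\<bar> \<le> \<rho>" "\<bar>t\<bar> \<le> \<rho>"
  shows "\<bar>s ^ j * t ^ k\<bar> \<le> \<rho> ^ (j + k :: nat)"
  unfolding power_add abs_mult power_abs using assms by (intro mult_mono power_mono) auto

lemma has_majorant_norm_le:
  assumes "has_majorant \<rho> K f" "\<bar>s\<bar> \<le> \<rho>" "\<bar>t\<bar> \<le> \<rho>"
  shows "norm (f s t) \<le> K"
proof -
  obtain a where a: "(\<lambda>i. norm (a i) * \<rho> ^ (fst i + snd i)) summable_on UNIV"
    "(\<Sum>\<^sub>\<infinity>i. norm (a i) * \<rho> ^ (fst i + snd i)) \<le> K"
    "((\<lambda>i. a i * of_real (s ^ fst i * t ^ snd i)) has_sum f s t) UNIV"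
    using assms unfolding has_majorant_def by blast
  have b: "norm (a i * of_real (s ^ fst i * t ^ snd i)) \<le> norm (a i) * \<rho> ^ (fst i + snd i)" for i
    using mult_left_mono[OF monomial_bound[OF assms(2,3), of "fst i" "snd i"], of "norm (a i)"]
    by (simp only: norm_mult norm_of_real norm_ge_zero)
  have "norm (f s t) \<le> (\<Sum>\<^sub>\<infinity>i. norm (a i) * \<rho> ^ (fst i + snd i))"
    by (rule norm_infsum_le[OF a(3) has_sum_infsum[OF a(1)]]) (use b in auto)
  with a(2) show ?thesis by simp
qed

lemma has_majorant_mono: "has_majorant \<rho> K f \<Longrightarrow> K \<le> K' \<Longrightarrow> has_majorant \<rho> K' f"
  unfolding has_majorant_def by (meson order.trans)

lemma has_majorant_cong:
  assumes "has_majorant \<rho> K f" "\<And>s t. \<bar>s\<bar> \<le> \<rho> \<Longrightarrow> \<bar>t\<bar> \<le> \<rho> \<Longrightarrow> f s t = g s t"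
  shows "has_majorant \<rho> K g"
  using assms unfolding has_majorant_def by auto

text \<open>Multiplication by a monomial only shifts coefficients. Together with
  \<open>has_majorant_infsum\<close> it yields products, because a product is a sum of monomial
  multiples of one factor.\<close>

lemma has_majorant_monomial_mult:
  assumes f: "has_majorant \<rho> K f" and \<rho>: "\<rho> \<ge> 0"
  shows "has_majorant \<rho> (norm c * \<rho> ^ (j + k) * K) (\<lambda>s t. c * of_real (s ^ j * t ^ k) * f s t)"
proof -
  obtain a where a: "(\<lambda>i. norm (a i) * \<rho> ^ (fst i + snd i)) summable_on UNIV"
    "(\<Sum>\<^sub>\<infinity>i. norm (a i) * \<rho> ^ (fst i + snd i)) \<le> K"
    "\<And>s t. \<bar>s\<bar> \<le> \<rho> \<Longrightarrow> \<bar>t\<bar> \<le> \<rho> \<Longrightarrow> ((\<lambda>i. a i * of_real (s ^ fst i * t ^ snd i)) has_sum f s t) UNIV"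
    using f unfolding has_majorant_def by blast
  define S where "S = {i :: nat \<times> nat. j \<le> fst i \<and> k \<le> snd i}"
  define b where "b = (\<lambda>i. if i \<in> S then c * a (fst i - j, snd i - k) else 0)"
  have reindex: "(h has_sum v) UNIV \<Longrightarrow> (\<And>i. h i = g (fst i + j, snd i + k)) \<Longrightarrow> (\<And>i. i \<notin> S \<Longrightarrow> g i = 0) \<Longrightarrow> (g has_sum v) UNIV"
    for h g :: "nat \<times> nat \<Rightarrow> 'z::{comm_monoid_add, topological_space}" and v
  proof -
    assume h: "(h has_sum v) UNIV" and hg: "\<And>i. h i = g (fst i + j, snd i + k)" and g0: "\<And>i. i \<notin> S \<Longrightarrow> g i = 0"
    have "(g has_sum v) S"
      using h by (rule has_sum_reindex_bij_witness[of _ "\<lambda>i. (fst i - j, snd i - k)" "\<lambda>i. (fst i + j, snd i + k)", THEN iffD1, rotated -1])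
        (auto simp: S_def hg)
    thus "(g has_sum v) UNIV"
      by (rule has_sum_cong_neutral[THEN iffD1, rotated -1]) (use g0 in auto)
  qed
  have S1: "((\<lambda>i. norm (b i) * \<rho> ^ (fst i + snd i)) has_sum (norm c * \<rho> ^ (j + k) * (\<Sum>\<^sub>\<infinity>i. norm (a i) * \<rho> ^ (fst i + snd i)))) UNIV"
    by (rule reindex[OF has_sum_cmult_right[OF has_sum_infsum[OF a(1)], of "norm c * \<rho> ^ (j + k)"]])
       (auto simp: b_def S_def norm_mult power_add)
  have S2: "norm c * \<rho> ^ (j + k) * (\<Sum>\<^sub>\<infinity>i. norm (a i) * \<rho> ^ (fst i + snd i)) \<le> norm c * \<rho> ^ (j + k) * K"
    using a(2) \<rho> by (intro mult_left_mono) auto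
  have S3: "((\<lambda>i. b i * of_real (s ^ fst i * t ^ snd i)) has_sum (c * of_real (s ^ j * t ^ k) * f s t)) UNIV"
    if "\<bar>s\<bar> \<le> \<rho>" "\<bar>t\<bar> \<le> \<rho>" for s t
    by (rule reindex[OF has_sum_cmult_right[OF a(3)[OF that], of "c * of_real (s ^ j * t ^ k)"]])
       (auto simp: b_def S_def power_add)
  show ?thesis
    unfolding has_majorant_def
  proof (intro exI[of _ b] conjI allI impI)
    show "(\<lambda>i. norm (b i) * \<rho> ^ (fst i + snd i)) summable_on UNIV" by (rule has_sum_imp_summable[OF S1])
    show "(\<Sum>\<^sub>\<infinity>i. norm (b i) * \<rho> ^ (fst i + snd i)) \<le> norm c * \<rho> ^ (j + k) * K"
      unfolding infsumI[OF S1] by (rule S2)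
  qed (rule S3)
qed

text \<open>The coefficients of the sum are the sums of the coefficients. Summability of
  \<open>K\<close> makes the family absolutely summable over indices and monomials jointly, so the
  two summations commute.\<close>

lemma has_majorant_infsum:
  fixes f :: "'i \<Rightarrow> real \<Rightarrow> real \<Rightarrow> complex"
  assumes f: "\<And>i. has_majorant \<rho> (K i) (f i)" and K: "K summable_on UNIV" and \<rho>: "\<rho> > 0"
  shows "has_majorant \<rho> (\<Sum>\<^sub>\<infinity>i. K i) (\<lambda>s t. \<Sum>\<^sub>\<infinity>i. f i s t)"
proof -
  define N where "N = (\<lambda>(a :: nat \<times> nat \<Rightarrow> complex) i. norm (a i) * \<rho> ^ (fst i + snd i))"
  have N0: "N a i \<ge> 0" for a i using \<rho> by (simp add: N_def)
  have "\<forall>i. \<exists>a. N a summable_on UNIV \<and> infsum (N a) UNIV \<le> K i \<and>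
    (\<forall>s t. \<bar>s\<bar> \<le> \<rho> \<longrightarrow> \<bar>t\<bar> \<le> \<rho> \<longrightarrow> ((\<lambda>j. a j * of_real (s ^ fst j * t ^ snd j)) has_sum f i s t) UNIV)"
    using f unfolding has_majorant_def N_def by blast
  from choice[OF this] obtain a where a: "\<And>i. N (a i) summable_on UNIV" "\<And>i. infsum (N (a i)) UNIV \<le> K i"
    "\<And>i s t. \<bar>s\<bar> \<le> \<rho> \<Longrightarrow> \<bar>t\<bar> \<le> \<rho> \<Longrightarrow> ((\<lambda>j. a i j * of_real (s ^ fst j * t ^ snd j)) has_sum f i s t) UNIV"
    by blast
  have K0: "0 \<le> infsum (N (a i)) UNIV" for i by (intro infsum_nonneg N0)
  have Ks: "(\<lambda>i. infsum (N (a i)) UNIV) summable_on UNIV"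
    by (rule summable_on_comparison_test[OF K]) (use a(2) K0 in auto)
  have NS: "(\<lambda>(i, j). N (a i) j) summable_on (UNIV \<times> UNIV)"
    by (rule summable_on_SigmaI[where g = "\<lambda>i. infsum (N (a i)) UNIV"]) (use a(1) Ks N0 in auto)
  hence NS': "(\<lambda>(j, i). N (a i) j) summable_on (UNIV \<times> UNIV)"
    using summable_on_swap[of "\<lambda>(i, j). N (a i) j" UNIV UNIV] by simp
  have Nrow: "(\<lambda>i. N (a i) j) summable_on UNIV" for j
    using summable_on_SigmaD1[of "\<lambda>j i. N (a i) j" UNIV "\<lambda>_. UNIV" j] NS' by simp
  have aj: "(\<lambda>i. a i j) summable_on UNIV" for j
  proof (rule abs_summable_summable)
    have "(\<lambda>i. N (a i) j * (1 / \<rho> ^ (fst j + snd j))) summable_on UNIV" by (intro summable_on_cmult_left Nrow)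
    thus "(\<lambda>i. norm (a i j)) summable_on UNIV" using \<rho> by (simp add: N_def)
  qed
  define A where "A = (\<lambda>j. \<Sum>\<^sub>\<infinity>i. a i j)"
  have NA: "N A j \<le> (\<Sum>\<^sub>\<infinity>i. N (a i) j)" for j
  proof -
    have "((\<lambda>i. a i j * of_real (\<rho> ^ (fst j + snd j))) has_sum (A j * of_real (\<rho> ^ (fst j + snd j)))) UNIV"
      unfolding A_def by (intro has_sum_cmult_left has_sum_infsum aj)
    from norm_infsum_le[OF this has_sum_infsum[OF Nrow[of j]]]
    show ?thesis using \<rho> by (simp add: N_def norm_mult norm_power)
  qed
  have Ns: "(\<lambda>j. \<Sum>\<^sub>\<infinity>i. N (a i) j) summable_on UNIV"
    using summable_on_Sigma_banach[of "\<lambda>j i. N (a i) j" UNIV "\<lambda>_. UNIV"] NS' by simp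
  have NAs: "N A summable_on UNIV"
    by (rule summable_on_comparison_test[OF Ns]) (use NA N0 in auto)
  have "infsum (N A) UNIV \<le> (\<Sum>\<^sub>\<infinity>j. \<Sum>\<^sub>\<infinity>i. N (a i) j)"
    by (rule infsum_mono[OF NAs Ns NA])
  also have "\<dots> = (\<Sum>\<^sub>\<infinity>i. \<Sum>\<^sub>\<infinity>j. N (a i) j)"
    by (rule infsum_swap_banach) (use NS' in auto)
  also have "\<dots> \<le> (\<Sum>\<^sub>\<infinity>i. K i)"
    by (rule infsum_mono[OF Ks K a(2)])
  finally have le: "infsum (N A) UNIV \<le> (\<Sum>\<^sub>\<infinity>i. K i)" .
  have hs: "((\<lambda>j. A j * of_real (s ^ fst j * t ^ snd j)) has_sum (\<Sum>\<^sub>\<infinity>i. f i s t)) UNIV"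
    if st: "\<bar>s\<bar> \<le> \<rho>" "\<bar>t\<bar> \<le> \<rho>" for s t
  proof -
    define e where "e = (\<lambda>j i. a i j * of_real (s ^ fst j * t ^ snd j))"
    have S: "(\<lambda>(j, i). e j i) summable_on (UNIV \<times> UNIV)"
    proof (rule abs_summable_summable, rule Infinite_Sum.abs_summable_on_comparison_test'[OF NS'])
      fix ji :: "(nat \<times> nat) \<times> 'i"
      obtain j i where ji: "ji = (j, i)" by (cases ji)
      have "norm (e j i) \<le> N (a i) j"
        using mult_left_mono[OF monomial_bound[OF st, of "fst j" "snd j"], of "norm (a i j)"]
        by (simp only: e_def N_def norm_mult norm_of_real norm_ge_zero)
      thus "norm (case ji of (j, i) \<Rightarrow> e j i) \<le> (case ji of (j, i) \<Rightarrow> N (a i) j)" by (simp add: ji)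
    qed
    have "((\<lambda>j. \<Sum>\<^sub>\<infinity>i. e j i) has_sum (\<Sum>\<^sub>\<infinity>j. \<Sum>\<^sub>\<infinity>i. e j i)) UNIV"
      using summable_on_Sigma_banach[OF S] by simp
    also have "(\<Sum>\<^sub>\<infinity>j. \<Sum>\<^sub>\<infinity>i. e j i) = (\<Sum>\<^sub>\<infinity>i. \<Sum>\<^sub>\<infinity>j. e j i)"
      by (rule infsum_swap_banach) (use S in auto)
    also have "(\<lambda>i. \<Sum>\<^sub>\<infinity>j. e j i) = (\<lambda>i. f i s t)"
      unfolding e_def by (intro ext infsumI a(3) st)
    also have "(\<lambda>j. \<Sum>\<^sub>\<infinity>i. e j i) = (\<lambda>j. A j * of_real (s ^ fst j * t ^ snd j))"
      unfolding e_def A_def by (intro ext infsum_cmult_left')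
    finally show ?thesis .
  qed
  show ?thesis
    unfolding has_majorant_def using NAs le hs unfolding N_def by blast
qed

lemma has_majorant_mult:
  assumes f: "has_majorant \<rho> K f" and g: "has_majorant \<rho> L g" and \<rho>: "\<rho> > 0"
  shows "has_majorant \<rho> (K * L) (\<lambda>s t. f s t * g s t)"
proof -
  obtain a where a: "(\<lambda>i. norm (a i) * \<rho> ^ (fst i + snd i)) summable_on UNIV"
    "(\<Sum>\<^sub>\<infinity>i. norm (a i) * \<rho> ^ (fst i + snd i)) \<le> K"
    "\<And>s t. \<bar>s\<bar> \<le> \<rho> \<Longrightarrow> \<bar>t\<bar> \<le> \<rho> \<Longrightarrow> ((\<lambda>i. a i * of_real (s ^ fst i * t ^ snd i)) has_sum f s t) UNIV"
    using f unfolding has_majorant_def by blast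
  have L0: "L \<ge> 0" using order.trans[OF norm_ge_zero has_majorant_norm_le[OF g, of 0 0]] \<rho> by simp
  have "has_majorant \<rho> (\<Sum>\<^sub>\<infinity>i. norm (a i) * \<rho> ^ (fst i + snd i) * L) (\<lambda>s t. \<Sum>\<^sub>\<infinity>i. a i * of_real (s ^ fst i * t ^ snd i) * g s t)"
    using \<rho> by (intro has_majorant_infsum has_majorant_monomial_mult g summable_on_cmult_left a(1)) auto
  moreover have "(\<Sum>\<^sub>\<infinity>i. norm (a i) * \<rho> ^ (fst i + snd i) * L) \<le> K * L"
    unfolding infsum_cmult_left' by (intro mult_right_mono a(2) L0)
  ultimately have "has_majorant \<rho> (K * L) (\<lambda>s t. \<Sum>\<^sub>\<infinity>i. a i * of_real (s ^ fst i * t ^ snd i) * g s t)"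
    by (rule has_majorant_mono)
  thus ?thesis
    by (rule has_majorant_cong) (simp only: infsum_cmult_left' infsumI[OF a(3)])
qed

lemma has_majorant_const [intro]: "has_majorant \<rho> (norm c) (\<lambda>s t. c)"
proof -
  have 1: "((\<lambda>i. norm (if i = (0, 0) then c else 0) * \<rho> ^ (fst i + snd i)) has_sum norm c) (UNIV :: (nat \<times> nat) set)"
    by (rule has_sum_finite_neutralI[where B = "{(0, 0)}"]) auto
  have 2: "((\<lambda>i. (if i = (0, 0) then c else 0) * of_real (s ^ fst i * t ^ snd i)) has_sum c) (UNIV :: (nat \<times> nat) set)" for s t
    by (rule has_sum_finite_neutralI[where B = "{(0, 0)}"]) auto
  show ?thesis
    unfolding has_majorant_def
    by (rule exI[of _ "\<lambda>i. if i = (0, 0) then c else 0"]) (use 1 2 has_sum_imp_summable[OF 1] infsumI[OF 1] in auto)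
qed

lemma has_majorant_cmult: "has_majorant \<rho> K f \<Longrightarrow> \<rho> > 0 \<Longrightarrow> has_majorant \<rho> (norm c * K) (\<lambda>s t. c * f s t)"
  using has_majorant_mult[OF has_majorant_const] .

lemma has_majorant_fst: "\<rho> > 0 \<Longrightarrow> has_majorant \<rho> \<rho> (\<lambda>s t. of_real s)"
  using has_majorant_monomial_mult[OF has_majorant_const[of \<rho> 1], of 1 1 0] by simp

lemma has_majorant_snd: "\<rho> > 0 \<Longrightarrow> has_majorant \<rho> \<rho> (\<lambda>s t. of_real t)"
  using has_majorant_monomial_mult[OF has_majorant_const[of \<rho> 1], of 1 0 1] by simp

lemma has_majorant_add:
  assumes "has_majorant \<rho> K f" "has_majorant \<rho> L g" "\<rho> > 0"
  shows "has_majorant \<rho> (K + L) (\<lambda>s t. f s t + g s t)"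
proof -
  have "has_majorant \<rho> (\<Sum>\<^sub>\<infinity>b. if b then K else L) (\<lambda>s t. \<Sum>\<^sub>\<infinity>b. (if b then f else g) s t)"
    by (rule has_majorant_infsum) (use assms in auto)
  thus ?thesis by (simp add: UNIV_bool add.commute)
qed

lemma has_majorant_power:
  assumes "has_majorant \<rho> K f" "\<rho> > 0"
  shows "has_majorant \<rho> (K ^ n) (\<lambda>s t. f s t ^ n)"
proof (induction n)
  case 0
  show ?case using has_majorant_const[of \<rho> 1] by simp
next
  case (Suc n)
  show ?case using has_majorant_mult[OF assms(1) Suc assms(2)] by simp
qed

lemma has_majorant_exp:
  assumes f: "has_majorant \<rho> K f" and \<rho>: "\<rho> > 0"
  shows "has_majorant \<rho> (exp K) (\<lambda>s t. exp (f s t))"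
proof -
  have hs: "((\<lambda>n. of_real (1 / fact n) * z ^ n) has_sum exp z) UNIV" for z :: "'z::{real_normed_field, banach}"
    using exp_converges[of z] summable_norm_exp[of z]
    by (intro norm_summable_imp_has_sum) (auto simp: scaleR_conv_of_real divide_inverse norm_mult norm_power norm_inverse)
  have k: "((\<lambda>n. norm (of_real (1 / fact n) :: complex) * K ^ n) has_sum exp K) UNIV"
    using hs[of K] by (simp add: norm_divide)
  have "has_majorant \<rho> (\<Sum>\<^sub>\<infinity>n. norm (of_real (1 / fact n) :: complex) * K ^ n) (\<lambda>s t. \<Sum>\<^sub>\<infinity>n. of_real (1 / fact n) * f s t ^ n)"
    by (intro has_majorant_infsum has_majorant_cmult has_majorant_power f \<rho> has_sum_imp_summable[OF k])
  thus ?thesis by (simp only: infsumI[OF hs] infsumI[OF k])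
qed

text \<open>A geometric series; this is how the denominators w and Im tau of the lattice sum are
  handled.\<close>

lemma has_majorant_inverse_one_minus:
  assumes f: "has_majorant \<rho> K f" and \<rho>: "\<rho> > 0" and K: "K < 1"
  shows "has_majorant \<rho> (1 / (1 - K)) (\<lambda>s t. 1 / (1 - f s t))"
proof -
  have K0: "K \<ge> 0" using order.trans[OF norm_ge_zero has_majorant_norm_le[OF f, of 0 0]] \<rho> by simp
  have hs: "((\<lambda>n. z ^ n) has_sum (1 / (1 - z))) UNIV" if "norm z < 1" for z :: "'z::{real_normed_field, banach}"
    using that by (intro norm_summable_imp_has_sum geometric_sums) (auto simp: norm_power intro!: summable_geometric)
  have k: "((\<lambda>n. K ^ n) has_sum (1 / (1 - K))) UNIV" using hs[of K] K K0 by simp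
  have "has_majorant \<rho> (\<Sum>\<^sub>\<infinity>n. K ^ n) (\<lambda>s t. \<Sum>\<^sub>\<infinity>n. f s t ^ n)"
    by (intro has_majorant_infsum has_majorant_power f \<rho> has_sum_imp_summable[OF k])
  hence "has_majorant \<rho> (1 / (1 - K)) (\<lambda>s t. \<Sum>\<^sub>\<infinity>n. f s t ^ n)" by (simp only: infsumI[OF k])
  thus ?thesis
  proof (rule has_majorant_cong)
    fix s t assume "\<bar>s\<bar> \<le> \<rho>" "\<bar>t\<bar> \<le> \<rho>"
    hence "norm (f s t) < 1" using has_majorant_norm_le[OF f] K by (meson order.strict_trans1)
    thus "(\<Sum>\<^sub>\<infinity>n. f s t ^ n) = 1 / (1 - f s t)" by (intro infsumI hs)
  qed
qed

lemma real_analytic_onI: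
  assumes "\<And>z. z \<in> S \<Longrightarrow> \<exists>\<rho>>0. \<exists>K. has_majorant \<rho> K (\<lambda>s t. g (z + Complex s t))"
  shows "real_analytic_on g S"
  unfolding real_analytic_on_def
proof
  fix z assume "z \<in> S"
  then obtain \<rho> K where \<rho>: "\<rho> > 0" "has_majorant \<rho> K (\<lambda>s t. g (z + Complex s t))" using assms by blast
  obtain a :: "nat \<times> nat \<Rightarrow> complex" where a: "\<forall>s t. \<bar>s\<bar> \<le> \<rho> \<longrightarrow> \<bar>t\<bar> \<le> \<rho> \<longrightarrow> ((\<lambda>i. a i * of_real (s ^ fst i * t ^ snd i)) has_sum g (z + Complex s t)) UNIV"
    using \<rho>(2) unfolding has_majorant_def by (elim exE conjE)
  have "((\<lambda>(j, k). a (j, k) * of_real (s ^ j * t ^ k)) has_sum g (z + Complex s t)) UNIV" if "\<bar>s\<bar> < \<rho>" "\<bar>t\<bar> < \<rho>" for s t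
  proof -
    have "((\<lambda>i. a i * of_real (s ^ fst i * t ^ snd i)) has_sum g (z + Complex s t)) UNIV"
      using a that by (meson less_imp_le)
    also have "(\<lambda>i. a i * of_real (s ^ fst i * t ^ snd i)) = (\<lambda>(j, k). a (j, k) * of_real (s ^ j * t ^ k))"
      by (simp only: case_prod_beta' prod.collapse)
    finally show ?thesis .
  qed
  hence "\<forall>s t :: real. \<bar>s\<bar> < \<rho> \<longrightarrow> \<bar>t\<bar> < \<rho> \<longrightarrow>
        ((\<lambda>(j, k). (\<lambda>j k. a (j, k)) j k * of_real (s ^ j * t ^ k)) has_sum g (z + Complex s t)) UNIV"
    by (intro allI impI)
  with \<rho>(1) show "\<exists>r>0. \<exists>a :: nat \<Rightarrow> nat \<Rightarrow> complex. \<forall>s t :: real. \<bar>s\<bar> < r \<longrightarrow> \<bar>t\<bar> < r \<longrightarrow>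
        ((\<lambda>(j, k). a j k * of_real (s ^ j * t ^ k)) has_sum g (z + Complex s t)) UNIV"
    by (intro exI[of _ \<rho>] conjI exI[of _ "\<lambda>j k. a (j, k)"])
qed

text \<open>For increments (s, t), w = w0 (1 - h), |w|^2 = W + d and y/(y + t) = 1/(1 - T), so
  geometric series in h and T and the exponential series produce the whole term. The radius Im z/24
  is small enough that the exponent differs from its value -kappa W at the centre by something of
  majorant at most kappa W/2. Half of the Gaussian survives, and this keeps the majorants summable
  over the lattice.\<close>

lemma has_majorant_eis_term:
  fixes z :: complex and p r :: real and m n :: int
  assumes z: "Im z > 0"
  defines "w0 \<equiv> of_real (of_int m - p) * z + of_real (of_int n - r)"
  assumes w0: "w0 \<noteq> 0"
  shows "has_majorant (Im z / 24) (4 / (norm w0)\<^sup>2 * exp (- (pi * real l / (4 * Im z)) * (norm w0)\<^sup>2))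
    (\<lambda>s t. eis_term l p r (z + Complex s t) (m, n))"
proof -
  define y where "y = Im z"
  define \<rho> where "\<rho> = y / 24"
  define \<alpha> where "\<alpha> = of_int m - p"
  define \<beta> where "\<beta> = of_int n - r"
  define u where "u = \<alpha> * Re z + \<beta>"
  define W where "W = (norm w0)\<^sup>2"
  define \<kappa> where "\<kappa> = pi * real l / (2 * y)"
  have y: "y > 0" and \<rho>: "\<rho> > 0" using z by (auto simp: y_def \<rho>_def)
  have \<kappa>: "\<kappa> \<ge> 0" using y by (simp add: \<kappa>_def)
  have w0_eq: "w0 = Complex u (\<alpha> * y)" by (simp add: w0_def complex_eq_iff u_def \<alpha>_def \<beta>_def y_def)
  have Wuy: "W = u\<^sup>2 + (\<alpha> * y)\<^sup>2" by (simp add: W_def w0_eq cmod_def)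
  have W0: "W > 0" using w0 by (simp add: W_def)
  have u1: "\<bar>u\<bar> * \<bar>\<alpha> * y\<bar> \<le> W"
  proof -
    have "0 \<le> (\<bar>u\<bar> - \<bar>\<alpha> * y\<bar>)\<^sup>2 + u\<^sup>2 + (\<alpha> * y)\<^sup>2" by simp
    thus ?thesis unfolding Wuy power2_diff power2_abs by linarith
  qed
  have a1: "\<alpha>\<^sup>2 * y\<^sup>2 \<le> W" unfolding Wuy by (simp add: power_mult_distrib)
  have a2: "\<bar>\<alpha>\<bar> * y \<le> norm w0"
    using abs_Im_le_cmod[of w0] y by (simp add: w0_eq abs_mult)
  define D :: "real \<Rightarrow> real \<Rightarrow> complex" where "D = (\<lambda>s t. of_real (2 * u * \<alpha>) * of_real s + of_real (\<alpha>\<^sup>2) * (of_real s * of_real s)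
    + (of_real (2 * \<alpha>\<^sup>2 * y) * of_real t + of_real (\<alpha>\<^sup>2) * (of_real t * of_real t)))"
  have "has_majorant \<rho> (norm (of_real (2 * u * \<alpha>) :: complex) * \<rho> + norm (of_real (\<alpha>\<^sup>2) :: complex) * (\<rho> * \<rho>)
    + (norm (of_real (2 * \<alpha>\<^sup>2 * y) :: complex) * \<rho> + norm (of_real (\<alpha>\<^sup>2) :: complex) * (\<rho> * \<rho>))) D"
    unfolding D_def by (intro has_majorant_add has_majorant_cmult has_majorant_mult has_majorant_fst has_majorant_snd \<rho>)
  \<comment> \<open>98/576 = 1/12 + 1/12 + 2/576, from rho = y/24 and the bounds |u alpha y| <= W
    and alpha^2 y^2 <= W.\<close>
  moreover have "norm (of_real (2 * u * \<alpha>) :: complex) * \<rho> + norm (of_real (\<alpha>\<^sup>2) :: complex) * (\<rho> * \<rho>)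
    + (norm (of_real (2 * \<alpha>\<^sup>2 * y) :: complex) * \<rho> + norm (of_real (\<alpha>\<^sup>2) :: complex) * (\<rho> * \<rho>)) \<le> 98 / 576 * W"
  proof -
    have "norm (of_real (2 * u * \<alpha>) :: complex) * \<rho> = (\<bar>u\<bar> * \<bar>\<alpha> * y\<bar>) / 12"
      using y unfolding norm_of_real \<rho>_def by (simp add: abs_mult)
    moreover have "norm (of_real (2 * \<alpha>\<^sup>2 * y) :: complex) * \<rho> = (\<alpha>\<^sup>2 * y\<^sup>2) / 12"
      using y unfolding norm_of_real \<rho>_def by (simp add: abs_mult power2_eq_square)
    moreover have "norm (of_real (\<alpha>\<^sup>2) :: complex) * (\<rho> * \<rho>) = (\<alpha>\<^sup>2 * y\<^sup>2) / 576"
      unfolding norm_of_real \<rho>_def by (simp add: power2_eq_square)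
    ultimately show ?thesis using u1 a1 by linarith
  qed
  ultimately have D: "has_majorant \<rho> (98 / 576 * W) D" by (rule has_majorant_mono)
  define T :: "real \<Rightarrow> real \<Rightarrow> complex" where "T = (\<lambda>s t. of_real (- 1 / y) * of_real t)"
  have T: "has_majorant \<rho> (1 / 24) T"
    using has_majorant_cmult[OF has_majorant_snd[OF \<rho>] \<rho>, of "of_real (- 1 / y)"] y unfolding T_def norm_of_real by (simp add: \<rho>_def)
  define J where "J = (\<lambda>s t. 1 / (1 - T s t))"
  have J: "has_majorant \<rho> (24 / 23) J"
    using has_majorant_inverse_one_minus[OF T \<rho>] unfolding J_def by simp
  \<comment> \<open>The exponent at (s, t) minus its value -kappa W at the centre, rewritten with J
    = 1 + T J.\<close>
  define X where "X = (\<lambda>s t. of_real (- \<kappa>) * (D s t * J s t) + of_real (- (\<kappa> * W)) * (T s t * J s t))"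
  have "has_majorant \<rho> (norm (of_real (- \<kappa>) :: complex) * (98 / 576 * W * (24 / 23)) + norm (of_real (- (\<kappa> * W)) :: complex) * (1 / 24 * (24 / 23))) X"
    unfolding X_def by (intro has_majorant_add has_majorant_cmult has_majorant_mult D J T \<rho>)
  moreover have "norm (of_real (- \<kappa>) :: complex) * (98 / 576 * W * (24 / 23)) + norm (of_real (- (\<kappa> * W)) :: complex) * (1 / 24 * (24 / 23)) \<le> \<kappa> * W / 2"
    using mult_nonneg_nonneg[of \<kappa> W] \<kappa> W0 unfolding norm_of_real by (simp add: abs_mult)
  ultimately have X: "has_majorant \<rho> (\<kappa> * W / 2) X" by (rule has_majorant_mono)
  define h where "h = (\<lambda>s t. - (of_real \<alpha> / w0) * (of_real s + \<i> * of_real t))"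
  have "has_majorant \<rho> (norm (- (of_real \<alpha> / w0)) * (\<rho> + norm \<i> * \<rho>)) h"
    unfolding h_def by (intro has_majorant_add has_majorant_cmult has_majorant_fst has_majorant_snd \<rho>)
  moreover have "norm (- (of_real \<alpha> / w0)) * (\<rho> + norm \<i> * \<rho>) \<le> 1 / 12"
    using a2 w0 by (simp add: norm_divide \<rho>_def field_simps)
  ultimately have h: "has_majorant \<rho> (1 / 12) h" by (rule has_majorant_mono)
  define V where "V = (\<lambda>s t. 1 / (1 - h s t))"
  have V: "has_majorant \<rho> (12 / 11) V"
    using has_majorant_inverse_one_minus[OF h \<rho>] unfolding V_def by simp
  define e where "e = cis (pi * of_int (int l * (m * n + m + n)) + pi * real l * (of_int m * r - of_int n * p))"
  have "has_majorant \<rho> (norm (e * of_real (exp (- (\<kappa> * W)))) * exp (\<kappa> * W / 2) * (norm (1 / w0\<^sup>2) * (12 / 11 * (12 / 11))))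
    (\<lambda>s t. e * of_real (exp (- (\<kappa> * W))) * exp (X s t) * (1 / w0\<^sup>2 * (V s t * V s t)))"
    by (intro has_majorant_cmult has_majorant_mult has_majorant_exp X V \<rho>)
  moreover have "norm (e * of_real (exp (- (\<kappa> * W)))) * exp (\<kappa> * W / 2) * (norm (1 / w0\<^sup>2) * (12 / 11 * (12 / 11)))
    \<le> 4 / W * exp (- (\<kappa> / 2) * W)"
  proof -
    have "norm (e * of_real (exp (- (\<kappa> * W)))) * exp (\<kappa> * W / 2) = exp (- (\<kappa> / 2) * W)"
      by (simp add: norm_mult e_def exp_add[symmetric])
    moreover have "norm (1 / w0\<^sup>2) * (12 / 11 * (12 / 11)) \<le> 4 / W"
      using W0 by (simp add: norm_divide norm_power W_def[symmetric] field_simps)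
    ultimately show ?thesis
      using mult_left_mono[of "norm (1 / w0\<^sup>2) * (12 / 11 * (12 / 11))" "4 / W" "exp (- (\<kappa> / 2) * W)"]
      by (simp only: mult.commute) simp
  qed
  ultimately have "has_majorant \<rho> (4 / W * exp (- (\<kappa> / 2) * W))
    (\<lambda>s t. e * of_real (exp (- (\<kappa> * W))) * exp (X s t) * (1 / w0\<^sup>2 * (V s t * V s t)))"
    by (rule has_majorant_mono)
  hence "has_majorant \<rho> (4 / W * exp (- (\<kappa> / 2) * W)) (\<lambda>s t. eis_term l p r (z + Complex s t) (m, n))"
  proof (rule has_majorant_cong)
    fix s t :: real assume st: "\<bar>s\<bar> \<le> \<rho>" "\<bar>t\<bar> \<le> \<rho>"
    have yt: "y + t > 0" using st y by (simp add: \<rho>_def abs_le_iff)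
    define w where "w = of_real \<alpha> * (z + Complex s t) + of_real \<beta>"
    have w: "w = w0 * (1 - h s t)"
    proof -
      have "w0 * (1 - h s t) = w0 + of_real \<alpha> * (of_real s + \<i> * of_real t)" using w0 by (simp add: h_def right_diff_distrib distrib_left)
      thus ?thesis by (simp add: w_def w0_def \<alpha>_def \<beta>_def complex_eq_iff algebra_simps)
    qed
    have wV: "1 / w0\<^sup>2 * (V s t * V s t) = 1 / w\<^sup>2" by (simp add: w V_def power2_eq_square)
    define d where "d = 2 * u * \<alpha> * s + \<alpha>\<^sup>2 * (s * s) + (2 * \<alpha>\<^sup>2 * y * t + \<alpha>\<^sup>2 * (t * t))"
    have Dd: "D s t = of_real d" by (simp add: D_def d_def)
    have "w = Complex (u + \<alpha> * s) (\<alpha> * (y + t))"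
      by (simp add: w_def complex_eq_iff u_def y_def algebra_simps)
    hence nw: "(norm w)\<^sup>2 = W + d"
      unfolding Wuy d_def cmod_power2 by (simp add: power2_eq_square algebra_simps)
    have J': "J s t = of_real (y / (y + t))"
    proof -
      have "1 - T s t = of_real ((y + t) / y)" using y by (simp add: T_def field_simps)
      thus ?thesis by (simp add: J_def)
    qed
    have Xr: "X s t = of_real (- \<kappa> * (d * (y / (y + t))) - (\<kappa> * W) * (- t / y * (y / (y + t))))"
      unfolding X_def Dd J' T_def by simp
    have "- (\<kappa> * W) + (- \<kappa> * (d * (y / (y + t))) - (\<kappa> * W) * (- t / y * (y / (y + t)))) = - (pi * real l / (2 * (y + t))) * (W + d)"
      using y yt by (simp add: \<kappa>_def divide_simps) (simp add: algebra_simps)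
    hence "of_real (exp (- (\<kappa> * W))) * exp (X s t) = (of_real (exp (- (pi * real l / (2 * (y + t))) * (W + d))) :: complex)"
      unfolding Xr exp_of_real of_real_mult[symmetric] exp_add[symmetric] by simp
    thus "e * of_real (exp (- (\<kappa> * W))) * exp (X s t) * (1 / w0\<^sup>2 * (V s t * V s t)) = eis_term l p r (z + Complex s t) (m, n)"
      unfolding wV eis_term_def Let_def prod.case \<alpha>_def[symmetric] \<beta>_def[symmetric] w_def[symmetric] e_def[symmetric] nw
      by (simp add: y_def mult.assoc)
  qed
  thus ?thesis by (simp add: \<rho>_def y_def W_def \<kappa>_def)
qed

lemma has_majorant_eis:
  assumes l: "l \<ge> 1" and z: "Im z > 0" and nz: "\<not> (p \<in> \<int> \<and> r \<in> \<int>)"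
  obtains K where "has_majorant (Im z / 24) K (\<lambda>s t. eis l p r (z + Complex s t))"
proof -
  obtain \<delta> d where \<delta>: "\<delta> > 0" "d > 0"
    "\<And>a b::real. \<delta> * (a\<^sup>2 + b\<^sup>2) \<le> (norm (of_real a * z + of_real b))\<^sup>2"
    "\<And>m n::int. d \<le> norm (of_real (of_int m - p) * z + of_real (of_int n - r))"
    using eis_denominator_bound[OF z nz] by blast
  define A where "A = pi * real l / (4 * Im z)"
  have A: "A > 0" using l z by (simp add: A_def)
  define K where "K = (\<lambda>mn::int \<times> int. 4 / d\<^sup>2 * (case mn of (m, n) \<Rightarrow> exp (- (A * \<delta>) * ((of_int m - p)\<^sup>2 + (of_int n - r)\<^sup>2))))"
  have K: "K summable_on UNIV"
    unfolding K_def using A \<delta>(1) by (intro summable_on_cmult_right summable_on_gauss_2d) auto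
  have maj: "has_majorant (Im z / 24) (K mn) (\<lambda>s t. eis_term l p r (z + Complex s t) mn)" for mn
  proof -
    obtain m n where mn: "mn = (m, n)" by force
    define w where "w = of_real (of_int m - p) * z + of_real (of_int n - r)"
    have dw: "d \<le> norm w" using \<delta>(4)[of m n] by (simp add: w_def)
    hence w0: "w \<noteq> 0" using \<delta>(2) by auto
    have "exp (- A * (norm w)\<^sup>2) \<le> exp (- (A * \<delta>) * ((of_int m - p)\<^sup>2 + (of_int n - r)\<^sup>2))"
      using \<delta>(3)[of "of_int m - p" "of_int n - r"] A by (simp add: w_def)
    moreover have "4 / (norm w)\<^sup>2 \<le> 4 / d\<^sup>2"
      using dw \<delta>(2) by (intro divide_left_mono power_mono mult_pos_pos zero_less_power) auto
    ultimately have "4 / (norm w)\<^sup>2 * exp (- A * (norm w)\<^sup>2) \<le> K mn"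
      unfolding K_def mn prod.case by (intro mult_mono) auto
    moreover have "has_majorant (Im z / 24) (4 / (norm w)\<^sup>2 * exp (- A * (norm w)\<^sup>2)) (\<lambda>s t. eis_term l p r (z + Complex s t) mn)"
      using has_majorant_eis_term[OF z w0[unfolded w_def], of l] unfolding mn w_def A_def .
    ultimately show ?thesis using has_majorant_mono by blast
  qed
  have "has_majorant (Im z / 24) (\<Sum>\<^sub>\<infinity>mn. K mn) (\<lambda>s t. eis l p r (z + Complex s t))"
    unfolding eis_def using z by (intro has_majorant_infsum maj K) simp
  thus ?thesis by (rule that)
qed

theorem theorem2p1:
  fixes l :: nat and x :: real and a b c d :: int
  assumes "l \<ge> 1"
    and "x \<in> \<rat>" and "x > 0" and "x \<notin> \<int>"
    and "a * d - b * c = 1" and "c \<ge> 0"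
  shows "let g = (\<lambda>\<tau>. 1 / (2 * of_real pi * \<i>)
               * exp (- of_real pi * \<i> * of_real (real l * of_int c * of_int d * x\<^sup>2))
               * slash2 (dA_hat l (- of_real x)) a b c d \<tau>)
         in (\<forall>\<tau>\<in>upper_half_plane.
               H1_term l x c d \<tau> summable_on H1_index_pos l x c \<and>
               H1_term l x c d \<tau> summable_on H1_index_neg l x c \<and>
               H2_term l x c d \<tau> summable_on UNIV \<and>
               g \<tau> = H1 l x c d \<tau> + H2 l x c d \<tau>)
          \<and> has_hol_nonhol_parts g (H1 l x c d) (H2 l x c d)"
proof -
  define g where "g = (\<lambda>\<tau>. 1 / (2 * of_real pi * \<i>)
               * exp (- of_real pi * \<i> * of_real (real l * of_int c * of_int d * x\<^sup>2))
               * slash2 (dA_hat l (- of_real x)) a b c d \<tau>)"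
  define k where "k = - 1 / (4 * (of_real pi)\<^sup>2) * cis (- (pi * real l * (of_int c * x) * (of_int d * x)))"
  have geis: "g \<tau> = k * eis l (of_int c * x) (of_int d * x) \<tau>" if "Im \<tau> > 0" for \<tau>
    using slash_dA_hat_eq(1)[OF assms(1,4,5) that] unfolding g_def k_def .
  have gH: "g \<tau> = H1 l x c d \<tau> + H2 l x c d \<tau>" if "Im \<tau> > 0" for \<tau>
    using slash_dA_hat_eq(2)[OF assms(1,4,5) that] unfolding g_def .
  have nz: "\<not> (of_int c * x \<in> \<int> \<and> of_int d * x \<in> \<int>)"
    using Ints_of_coprime_multiples[OF assms(5)] assms(4) by blast
  have "real_analytic_on g upper_half_plane"
  proof (rule real_analytic_onI)
    fix z :: complex assume "z \<in> upper_half_plane"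
    hence z: "Im z > 0" by simp
    hence \<rho>: "Im z / 24 > 0" by simp
    obtain K where "has_majorant (Im z / 24) K (\<lambda>s t. eis l (of_int c * x) (of_int d * x) (z + Complex s t))"
      using has_majorant_eis[OF assms(1) z nz] .
    from has_majorant_cmult[OF this \<rho>, of k]
    have "has_majorant (Im z / 24) (norm k * K) (\<lambda>s t. g (z + Complex s t))"
    proof (rule has_majorant_cong)
      fix s t :: real assume "\<bar>t\<bar> \<le> Im z / 24"
      hence "Im (z + Complex s t) > 0" using z by (simp add: abs_le_iff)
      thus "k * eis l (of_int c * x) (of_int d * x) (z + Complex s t) = g (z + Complex s t)" by (simp only: geis)
    qed
    thus "\<exists>\<rho>>0. \<exists>K. has_majorant \<rho> K (\<lambda>s t. g (z + Complex s t))" using \<rho> by blast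
  qed
  hence "has_hol_nonhol_parts g (H1 l x c d) (H2 l x c d)"
    by (intro has_hol_nonhol_parts_H1_H2 assms(1,2) gH)
  thus ?thesis
    unfolding Let_def g_def[symmetric]
    using H1_term_summable[OF assms(1)] abs_summable_summable[OF H2_term_abs_summable[OF assms(1)]] gH by simp
qed

end
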